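(* There exists a randomized single-pass semi-streaming algorithm that, given an $n$-vertex labeled graph $G=(V,E)$ specified via a stream of the edges of $G$ (in arbitrary order) together with their labels, with high probability (i.e., with probability at least $1-1/\mathrm{poly}(n)$) outputs a clustering of $V$ that is an $O(1)$-approximation to the correlation clustering problem on $G$, using $O(n\log n)$ space. Moreover, the algorithm has $O(\log n)$ processing time per element of the stream and $O(n\log^2 n)$ post-processing time.
   Context: A labeled graph $G=(V,E)$ is a complete undirected graph on $n$ vertices in which every edge is labeled $+1$ or $-1$. For a clustering $\mathcal{C}$ (partition of $V$), the cost of an edge $e=(u,v)$ is $1$ if $e$ is a $(+)$-edge whose endpoints are in different clusters, $1$ if $e$ is a $(-)$-edge whose endpoints are in the same cluster, and $0$ otherwise; the cost of $\mathcal{C}$ is the sum of costs of all edges. Correlation clustering asks for a clustering minimizing this cost; an $O(1)$-approximation is a clustering of cost at most a constant times the optimum. In the streaming model, the vertex set is known in advance, the edges with their labels arrive one by one, the algorithm reads the stream once, and space is measured in machine words of $O(\log n)$ bits; at the end of the stream it outputs a clustering. *)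

theory Defs
  imports "HOL-Probability.Probability" "HOL-Library.Landau_Symbols" "HOL-Library.Disjoint_Sets"
begin

section \<open>Correlation clustering\<close>

datatype label = Plus | Minus

definition edges :: "'a set \<Rightarrow> 'a set set" where
  "edges V = {e. e \<subseteq> V \<and> card e = 2}"

text \<open>A labeled graph on \<open>V\<close> is complete, so it is given by \<open>V\<close> and a labeling
  \<open>lab\<close> of the two-element subsets of \<open>V\<close>; the values of \<open>lab\<close> elsewhere are never used.
  A clustering of \<open>V\<close> is a \<open>\<C>\<close> with \<^term>\<open>partition_on V \<C>\<close>.\<close>

definition same_cluster :: "'a set set \<Rightarrow> 'a set \<Rightarrow> bool" where
  "same_cluster \<C> e \<longleftrightarrow> (\<exists>A\<in>\<C>. e \<subseteq> A)"

definition edge_cost :: "('a set \<Rightarrow> label) \<Rightarrow> 'a set set \<Rightarrow> 'a set \<Rightarrow> nat" where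
  "edge_cost lab \<C> e =
     (case lab e of
        Plus \<Rightarrow> (if same_cluster \<C> e then 0 else 1)
      | Minus \<Rightarrow> (if same_cluster \<C> e then 1 else 0))"

definition cost :: "'a set \<Rightarrow> ('a set \<Rightarrow> label) \<Rightarrow> 'a set set \<Rightarrow> nat" where
  "cost V lab \<C> = (\<Sum>e\<in>edges V. edge_cost lab \<C> e)"

definition opt_cost :: "'a set \<Rightarrow> ('a set \<Rightarrow> label) \<Rightarrow> nat" where
  "opt_cost V lab = (INF \<C>\<in>{\<C>. partition_on V \<C>}. cost V lab \<C>)"

definition approx_clustering ::
  "real \<Rightarrow> 'a set \<Rightarrow> ('a set \<Rightarrow> label) \<Rightarrow> 'a set set \<Rightarrow> bool" where
  "approx_clustering \<alpha> V lab \<C> \<longleftrightarrow>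
     partition_on V \<C> \<and> real (cost V lab \<C>) \<le> \<alpha> * real (opt_cost V lab)"


section \<open>A randomized word RAM\<close>

text \<open>The machine has registers holding one word each and a random-access memory of words.
  A program is a fixed piece of syntax, independent of the input, so it mentions only
  constantly many registers and constants, and its control stack (the \<open>com list\<close> below)
  has constant depth; the space used by a computation is therefore the size of its memory, up
  to an additive constant.\<close>

datatype operand = Imm nat | Reg nat

datatype binop = Add | Sub | Mul | Div | Mod

datatype cmpop = Less | Leq | Equal | Unequal

datatype com =
    Skip
  | Compute nat binop operand operand
  | Load nat operand
  | Store operand operand
  | Random nat operand
  | Seq com com
  | Branch cmpop operand operand com com
  | While cmpop operand operand com

record state =
  regs :: "nat \<Rightarrow> nat"
  mem :: "nat \<Rightarrow> nat"

fun operand_val :: "operand \<Rightarrow> state \<Rightarrow> nat" where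
  "operand_val (Imm k) \<sigma> = k"
| "operand_val (Reg r) \<sigma> = regs \<sigma> r"

text \<open>\<^const>\<open>Sub\<close> is truncated at zero; \<open>a div 0 = 0\<close> and \<open>a mod 0 = a\<close>.\<close>

fun binop_val :: "binop \<Rightarrow> nat \<Rightarrow> nat \<Rightarrow> nat" where
  "binop_val Add a b = a + b"
| "binop_val Sub a b = a - b"
| "binop_val Mul a b = a * b"
| "binop_val Div a b = a div b"
| "binop_val Mod a b = a mod b"

fun cmpop_val :: "cmpop \<Rightarrow> nat \<Rightarrow> nat \<Rightarrow> bool" where
  "cmpop_val Less a b \<longleftrightarrow> a < b"
| "cmpop_val Leq a b \<longleftrightarrow> a \<le> b"
| "cmpop_val Equal a b \<longleftrightarrow> a = b"
| "cmpop_val Unequal a b \<longleftrightarrow> a \<noteq> b"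

text \<open>The machine is run with \<open>s\<close> words of memory and words of \<open>w\<close> bits. A computation crashes
  (its subprobability mass is lost) if it produces a value that does not fit into a word, accesses
  memory at an address \<open>\<ge> s\<close>, or draws from an empty range.\<close>

definition set_reg :: "nat \<Rightarrow> nat \<Rightarrow> nat \<Rightarrow> state \<Rightarrow> state spmf" where
  "set_reg w r x \<sigma> =
     (if x < 2 ^ w then return_spmf (\<sigma>\<lparr>regs := (regs \<sigma>)(r := x)\<rparr>) else return_pmf None)"

definition load :: "nat \<Rightarrow> nat \<Rightarrow> nat \<Rightarrow> nat \<Rightarrow> state \<Rightarrow> state spmf" where
  "load s w r a \<sigma> = (if a < s then set_reg w r (mem \<sigma> a) \<sigma> else return_pmf None)"

definition store :: "nat \<Rightarrow> nat \<Rightarrow> nat \<Rightarrow> nat \<Rightarrow> state \<Rightarrow> state spmf" where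
  "store s w a x \<sigma> =
     (if a < s \<and> x < 2 ^ w then return_spmf (\<sigma>\<lparr>mem := (mem \<sigma>)(a := x)\<rparr>) else return_pmf None)"

text \<open>One time step: execute the topmost command \<open>c\<close> of the control stack \<open>c # K\<close>.
  \<^term>\<open>Random r x\<close> draws a fresh uniformly random integer from \<open>{0..<x}\<close>.\<close>

fun step :: "nat \<Rightarrow> nat \<Rightarrow> com \<Rightarrow> com list \<Rightarrow> state \<Rightarrow> (com list \<times> state) spmf" where
  "step s w Skip K \<sigma> = return_spmf (K, \<sigma>)"
| "step s w (Compute r f x y) K \<sigma> =
     map_spmf (Pair K) (set_reg w r (binop_val f (operand_val x \<sigma>) (operand_val y \<sigma>)) \<sigma>)"
| "step s w (Load r x) K \<sigma> = map_spmf (Pair K) (load s w r (operand_val x \<sigma>) \<sigma>)"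
| "step s w (Store x y) K \<sigma> =
     map_spmf (Pair K) (store s w (operand_val x \<sigma>) (operand_val y \<sigma>) \<sigma>)"
| "step s w (Random r x) K \<sigma> =
     map_spmf (Pair K) (bind_spmf (spmf_of_set {..<operand_val x \<sigma>}) (\<lambda>k. set_reg w r k \<sigma>))"
| "step s w (Seq c d) K \<sigma> = return_spmf (c # d # K, \<sigma>)"
| "step s w (Branch p x y c d) K \<sigma> =
     return_spmf ((if cmpop_val p (operand_val x \<sigma>) (operand_val y \<sigma>) then c else d) # K, \<sigma>)"
| "step s w (While p x y c) K \<sigma> =
     return_spmf
       (if cmpop_val p (operand_val x \<sigma>) (operand_val y \<sigma>) then c # While p x y c # K else K, \<sigma>)"

text \<open>Run until the control stack is empty; mass is also lost if this takes more than the given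
  number \<open>t\<close> of steps. Hence \<open>exec s w t K \<sigma>\<close> is lossless iff, for every outcome of the random
  choices, the computation halts within \<open>t\<close> steps without crashing.\<close>

fun exec :: "nat \<Rightarrow> nat \<Rightarrow> nat \<Rightarrow> com list \<Rightarrow> state \<Rightarrow> state spmf" where
  "exec s w t [] \<sigma> = return_spmf \<sigma>"
| "exec s w 0 (c # K) \<sigma> = return_pmf None"
| "exec s w (Suc t) (c # K) \<sigma> = bind_spmf (step s w c K \<sigma>) (\<lambda>(K', \<sigma>'). exec s w t K' \<sigma>')"


section \<open>Single-pass streaming algorithms for labeled graphs\<close>

text \<open>A stream lists every edge of the labeled graph on \<open>{..<n}\<close> exactly once, in arbitrary order
  and with its endpoints in arbitrary order.\<close>

definition edge_stream ::
  "nat \<Rightarrow> (nat set \<Rightarrow> label) \<Rightarrow> (nat \<times> nat \<times> label) list \<Rightarrow> bool" where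
  "edge_stream n lab xs \<longleftrightarrow>
     distinct (map (\<lambda>(u, v, l). {u, v}) xs) \<and>
     (\<lambda>(u, v, l). {u, v}) ` set xs = edges {..<n} \<and>
     (\<forall>(u, v, l)\<in>set xs. l = lab {u, v})"

text \<open>\<open>on_start\<close> runs once before the stream, \<open>on_edge\<close> once per stream element, and \<open>on_end\<close>
  once after the stream. Registers and memory persist from one run to the next.\<close>

datatype stream_alg = Stream_Alg (on_start: com) (on_edge: com) (on_end: com)

definition start_state :: "nat \<Rightarrow> state" where
  "start_state n = \<lparr>regs = (\<lambda>_. 0)(0 := n), mem = (\<lambda>_. 0)\<rparr>"

text \<open>The next stream element is delivered in registers 0, 1 and 2.\<close>

fun feed :: "nat \<times> nat \<times> label \<Rightarrow> state \<Rightarrow> state" where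
  "feed (u, v, l) \<sigma> =
     \<sigma>\<lparr>regs := (regs \<sigma>)(0 := u, 1 := v, 2 := (case l of Plus \<Rightarrow> 1 | Minus \<Rightarrow> 0))\<rparr>"

fun process_stream ::
  "nat \<Rightarrow> nat \<Rightarrow> nat \<Rightarrow> com \<Rightarrow> (nat \<times> nat \<times> label) list \<Rightarrow> state \<Rightarrow> state spmf" where
  "process_stream s w t c [] \<sigma> = return_spmf \<sigma>"
| "process_stream s w t c (e # es) \<sigma> =
     bind_spmf (exec s w t [c] (feed e \<sigma>)) (process_stream s w t c es)"

text \<open>The output is read off the first \<open>n\<close> memory words: word \<open>v\<close> names the cluster of vertex
  \<open>v\<close>. The \<open>n\<close> output words are required to lie within the \<open>s\<close> words of available memory.\<close>

definition output_clustering :: "nat \<Rightarrow> state \<Rightarrow> nat set set" where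
  "output_clustering n \<sigma> = (\<lambda>v. {u \<in> {..<n}. mem \<sigma> u = mem \<sigma> v}) ` {..<n}"

text \<open>\<open>t\<close> bounds the number of steps for each single stream element; \<open>T\<close> bounds the number of
  steps of the post-processing and, likewise, of the initialization.\<close>

definition run_alg ::
  "nat \<Rightarrow> nat \<Rightarrow> nat \<Rightarrow> nat \<Rightarrow> stream_alg \<Rightarrow> nat \<Rightarrow> (nat \<times> nat \<times> label) list \<Rightarrow>
   nat set set spmf" where
  "run_alg s w t T \<A> n xs =
     (if n \<le> s \<and> n < 2 ^ w then
        do {
          \<sigma>\<^sub>0 \<leftarrow> exec s w T [on_start \<A>] (start_state n);
          \<sigma>\<^sub>1 \<leftarrow> process_stream s w t (on_edge \<A>) xs \<sigma>\<^sub>0;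
          \<sigma>\<^sub>2 \<leftarrow> exec s w T [on_end \<A>] \<sigma>\<^sub>1;
          return_spmf (output_clustering n \<sigma>\<^sub>2)
        }
      else return_pmf None)"

end

theory Submission
  imports Defs
begin

text \<open>Give the vertices random ranks, let every vertex \<open>v\<close> point to the vertex \<open>F v\<close> of lowest rank in its
  closed neighbourhood \<open>N v\<close> of \<open>(+)\<close>-edges, and let \<open>v\<close> join the cluster of \<open>F v\<close> if \<open>F v\<close> points to
  itself; otherwise \<open>v\<close> stays alone. Pointers are maintained in constant time per edge. Two vertices \<open>u\<close>, \<open>v\<close>
  share a cluster iff some \<open>p\<close> has the lowest rank in \<open>N u \<union> N v \<union> N p\<close>, so every error is charged to a bad
  triple: a path of two \<open>(+)\<close>-edges whose ends are joined by a \<open>(-)\<close>-edge. Weighting a bad triple by the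
  inverse size of a neighbourhood bounds the expected cost by a constant times the optimum, since every
  clustering errs on each bad triple and each pair carries only constant weight.

  To make this hold with high probability, run \<open>L = O(log n)\<close> independent copies. All but a quarter of them
  are near the optimum except with probability \<open>2\<^sup>-\<^sup>L\<close>. The number of pairs on which two clusterings
  differ is a metric, so the copy whose distances to the others have the smallest sum is near the optimum as
  well. No cost has to be estimated; the \<open>L\<^sup>2\<close> distances take \<open>O(n)\<close> time each.\<close>

section \<open>The expected cost of one copy\<close>

text \<open>Sequential pivot clustering removes clusters in rank order, which would need the edges
  again. Cutting it off at one pointer per vertex leaves a rule that can be evaluated from the
  pointers alone; the price is a further error on (+)-edges, a common pivot that is itself beaten by
  a neighbour, paid for by the last term of \<open>error_weight\<close>. The constants: 12 is 4
  roles of a pair in a charged triple times 3 pairs on which a clustering may err, Markov's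
  inequality at 1/512 gives 6144 = 12 * 512, and the one-median costs a factor 7, hence 43008. A
  copy fails with probability at most 1/256, so that \<open>L / 4\<close> given copies fail with
  probability about 1 in \<open>4 ^ L\<close>, which beats the \<open>2 ^ L\<close> choices of the
  failing set. The edges are gone after the stream, so costs cannot be computed then; but twice the
  cost of a clustering is its distance to the (+)-relation, which need not be an equivalence and yet
  is a point of the same metric space. All randomness is drawn during initialization, so the rest of
  a run is a function of one uniform table of ranks.\<close>

definition lowest :: "('a \<Rightarrow> nat) \<Rightarrow> 'a set \<Rightarrow> 'a \<Rightarrow> bool" where
  "lowest f S x \<longleftrightarrow> x \<in> S \<and> (\<forall>y\<in>S. f x \<le> f y)"

lemma lowest_exists:
  assumes "finite S" "S \<noteq> {}"
  obtains x where "lowest f S x"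
proof -
  have "Min (f ` S) \<in> f ` S" using assms by (intro Min_in) auto
  then obtain x where "x \<in> S" "f x = Min (f ` S)" by auto
  then show ?thesis using assms that[of x] by (auto simp: lowest_def)
qed

lemma lowest_unique:
  assumes "inj_on f V" "S \<subseteq> V" "lowest f S x" "lowest f S y"
  shows "x = y"
proof -
  have "f x = f y" using assms(3,4) by (auto simp: lowest_def intro: antisym)
  then show ?thesis using assms by (auto simp: lowest_def inj_on_def)
qed

section \<open>Uniform rankings without ties\<close>

definition rankings :: "'a set \<Rightarrow> nat \<Rightarrow> ('a \<Rightarrow> nat) set" where
  "rankings V M = {f \<in> V \<rightarrow>\<^sub>E {..<M}. inj_on f V}"

lemma finite_rankings [simp]: "finite V \<Longrightarrow> finite (rankings V M)"
  unfolding rankings_def by (rule finite_subset[of _ "V \<rightarrow>\<^sub>E {..<M}"]) (auto intro: finite_PiE)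

text \<open>Composing a ranking with the transposition of \<open>x\<close> and \<open>y\<close> is
  injective, preserves \<open>V\<close> and \<open>S\<close>, and moves the minimum over
  \<open>S\<close> from \<open>x\<close> to \<open>y\<close>. Exchanging the roles gives
  equality.\<close>

lemma card_lowest_le:
  assumes "finite V" "S \<subseteq> V" "x \<in> S" "y \<in> S"
  shows "card {f \<in> rankings V M. lowest f S x} \<le> card {f \<in> rankings V M. lowest f S y}"
proof (rule card_inj_on_le)
  let ?t = "Transposition.transpose x y"
  have inv: "?t ` V = V" "?t ` S = S" using assms by (auto simp: Transposition.transpose_def image_iff)
  show "inj_on (\<lambda>f. f \<circ> ?t) {f \<in> rankings V M. lowest f S x}"
  proof (rule inj_onI)
    fix f g assume "f \<circ> ?t = g \<circ> ?t"
    then have "f (?t (?t a)) = g (?t (?t a))" for a by (metis comp_apply)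
    then show "f = g" by (simp add: fun_eq_iff)
  qed
  show "(\<lambda>f. f \<circ> ?t) ` {f \<in> rankings V M. lowest f S x} \<subseteq> {f \<in> rankings V M. lowest f S y}"
  proof (rule image_subsetI, clarsimp)
    fix f assume f: "f \<in> rankings V M" "lowest f S x"
    have m: "?t a \<in> V \<longleftrightarrow> a \<in> V" for a using assms by (auto simp: Transposition.transpose_def)
    have mS: "?t a \<in> S \<longleftrightarrow> a \<in> S" for a using assms by (auto simp: Transposition.transpose_def)
    have "f \<circ> ?t \<in> V \<rightarrow>\<^sub>E {..<M}"
      using f(1) m by (auto simp: rankings_def PiE_def Pi_def extensional_def)
    moreover have "inj_on (f \<circ> ?t) V"
      using f(1) inv by (auto simp: rankings_def intro!: comp_inj_on)
    moreover have "lowest (f \<circ> ?t) S y"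
      using f(2) mS assms by (auto simp: lowest_def)
    ultimately show "f \<circ> ?t \<in> rankings V M \<and> lowest (f \<circ> ?t) S y"
      by (auto simp: rankings_def)
  qed
  show "finite {f \<in> rankings V M. lowest f S y}" using assms by simp
qed

text \<open>An injective ranking has exactly one lowest element in \<open>S\<close>, and by symmetry
  each element is so equally often. Probabilities appear as counts relative to
  \<open>card (rankings V M)\<close>.\<close>

lemma card_lowest:
  assumes "finite V" "S \<subseteq> V" "x \<in> S"
  shows "real (card {f \<in> rankings V M. lowest f S x}) = real (card (rankings V M)) / real (card S)"
proof -
  have fS: "finite S" using assms finite_subset by blast
  have eq: "card {f \<in> rankings V M. lowest f S y} = card {f \<in> rankings V M. lowest f S x}" if "y \<in> S" for y
    using card_lowest_le[OF assms(1,2)] that assms(3) by (meson antisym)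
  have un: "rankings V M = (\<Union>y\<in>S. {f \<in> rankings V M. lowest f S y})"
  proof -
    have "\<exists>y\<in>S. lowest f S y" for f
      using lowest_exists[OF fS, of f] assms(3) by (metis empty_iff lowest_def)
    then show ?thesis by auto
  qed
  have "card (rankings V M) = (\<Sum>y\<in>S. card {f \<in> rankings V M. lowest f S y})"
  proof (subst un, rule card_UN_disjoint)
    show "\<forall>y\<in>S. \<forall>z\<in>S. y \<noteq> z \<longrightarrow> {f \<in> rankings V M. lowest f S y} \<inter> {f \<in> rankings V M. lowest f S z} = {}"
      using lowest_unique[OF _ assms(2)] by (auto simp: rankings_def)
  qed (use assms fS in auto)
  also have "\<dots> = card S * card {f \<in> rankings V M. lowest f S x}"
    using eq by simp
  finally have "real (card (rankings V M)) = real (card S) * real (card {f \<in> rankings V M. lowest f S x})"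
    by simp
  moreover have "card S > 0" using assms fS by (auto simp: card_gt_0_iff)
  ultimately show ?thesis by (simp add: field_simps)
qed

text \<open>The difference of \<open>1 / card S\<close> and \<open>1 / card (S \<union> T)\<close>
  is \<open>card (T - S)\<close> over the product of the sizes. It is written as a sum over
  \<open>T - S\<close> so that every \<open>z\<close> that may beat \<open>x\<close> can be charged
  to a bad triple of its own.\<close>

lemma card_lowest_not_lowest:
  assumes "finite V" "S \<subseteq> V" "T \<subseteq> V" "x \<in> S"
  shows "real (card {f \<in> rankings V M. lowest f S x \<and> \<not> lowest f (S \<union> T) x})
    = real (card (rankings V M)) * (\<Sum>z\<in>T - S. 1 / (real (card S) * real (card (S \<union> T))))"
proof -
  have fS: "finite S" "finite T" using assms finite_subset by blast+
  have "{f \<in> rankings V M. lowest f S x \<and> \<not> lowest f (S \<union> T) x}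
     = {f \<in> rankings V M. lowest f S x} - {f \<in> rankings V M. lowest f (S \<union> T) x}" by auto
  moreover have "{f \<in> rankings V M. lowest f (S \<union> T) x} \<subseteq> {f \<in> rankings V M. lowest f S x}"
    using assms by (auto simp: lowest_def)
  ultimately have "real (card {f \<in> rankings V M. lowest f S x \<and> \<not> lowest f (S \<union> T) x})
     = real (card {f \<in> rankings V M. lowest f S x}) - real (card {f \<in> rankings V M. lowest f (S \<union> T) x})"
    using assms by (simp add: card_Diff_subset card_mono of_nat_diff)
  also have "\<dots> = real (card (rankings V M)) / real (card S) - real (card (rankings V M)) / real (card (S \<union> T))"
    using assms by (subst (1 2) card_lowest) auto
  also have "\<dots> = real (card (rankings V M)) * (real (card (S \<union> T)) - real (card S)) / (real (card S) * real (card (S \<union> T)))"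
  proof -
    have "card S > 0" "card (S \<union> T) > 0" using assms fS by (auto simp: card_gt_0_iff)
    then show ?thesis by (simp add: field_simps)
  qed
  also have "real (card (S \<union> T)) - real (card S) = real (card (T - S))"
    using fS by (simp add: card_Un_disjoint[of S "T - S", simplified])
  finally show ?thesis by simp
qed

section \<open>The distance between relations and its one-median\<close>

definition rel_dist :: "'a set \<Rightarrow> ('a \<Rightarrow> 'a \<Rightarrow> bool) \<Rightarrow> ('a \<Rightarrow> 'a \<Rightarrow> bool) \<Rightarrow> nat" where
  "rel_dist V R S = card {(u, v) \<in> V \<times> V. R u v \<noteq> S u v}"

lemma rel_dist_sum:
  assumes "finite V"
  shows "rel_dist V R S = (\<Sum>u\<in>V. \<Sum>v\<in>V. of_bool (R u v \<noteq> S u v))"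
proof -
  have "{(u, v) \<in> V \<times> V. R u v \<noteq> S u v} = (SIGMA u:V. {v\<in>V. R u v \<noteq> S u v})" by auto
  then show ?thesis using assms
    by (simp add: rel_dist_def card_SigmaI of_bool_def sum.If_cases Int_def)
qed

lemma rel_dist_commute: "rel_dist V R S = rel_dist V S R"
  unfolding rel_dist_def by (rule arg_cong[of _ _ card]) auto

lemma rel_dist_triangle:
  assumes "finite V"
  shows "rel_dist V R T \<le> rel_dist V R S + rel_dist V S T"
proof -
  have fin: "finite {(u, v) \<in> V \<times> V. P u v}" for P
    using assms by (auto intro: finite_subset[of _ "V \<times> V"])
  have "rel_dist V R T \<le> card ({(u, v) \<in> V \<times> V. R u v \<noteq> S u v} \<union> {(u, v) \<in> V \<times> V. S u v \<noteq> T u v})"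
    unfolding rel_dist_def by (rule card_mono[OF finite_UnI[OF fin fin]]) auto
  also have "\<dots> \<le> rel_dist V R S + rel_dist V S T"
    unfolding rel_dist_def by (rule card_Un_le)
  finally show ?thesis .
qed

text \<open>If three quarters of the points \<open>x i\<close> lie within \<open>r\<close> of \<open>z\<close>, then so does their
  one-median up to a constant: a minority of bad points cannot outweigh the good ones.\<close>

lemma one_median_near:
  fixes d :: "'b \<Rightarrow> 'b \<Rightarrow> nat"
  assumes tri: "\<And>a b c. d a c \<le> d a b + d b c" and sym: "\<And>a b. d a b = d b a"
    and m: "m < L" and min: "\<And>i. i < L \<Longrightarrow> (\<Sum>j<L. d (x m) (x j)) \<le> (\<Sum>j<L. d (x i) (x j))"
    and bad: "4 * card {i. i < L \<and> d (x i) z > r} \<le> L"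
  shows "d (x m) z \<le> 7 * r"
proof -
  define B where "B = {i. i < L \<and> d (x i) z > r}"
  define G where "G = {..<L} - B"
  have BL: "B \<subseteq> {..<L}" "finite B" by (auto simp: B_def)
  have cG: "card G = L - card B" "card B \<le> L"
    using BL card_mono[of "{..<L}" B] by (auto simp: G_def card_Diff_subset)
  have split: "(\<Sum>j<L. h j) = (\<Sum>j\<in>G. h j) + (\<Sum>j\<in>B. h j)" for h :: "nat \<Rightarrow> nat"
    using BL by (simp add: G_def sum.subset_diff)
  have "card B < L" using bad m by (auto simp: B_def[symmetric])
  then have "G \<noteq> {}" using cG by (metis card.empty not_less zero_less_diff order.refl)
  then obtain g where g: "g \<in> G" by auto
  then have gL: "g < L" by (simp add: G_def)
  have near: "d (x j) z \<le> r" if "j \<in> G" for j using that by (auto simp: G_def B_def)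
  have gg: "d (x g) (x j) \<le> 2 * r" if "j \<in> G" for j
    using tri[where a = "x g" and b = z and c = "x j"] near[OF g] near[OF that] sym[of z] by auto
  have "(\<Sum>j\<in>G. d (x m) (x j)) + (\<Sum>j\<in>B. d (x m) (x j))
      \<le> (\<Sum>j\<in>G. d (x g) (x j)) + (\<Sum>j\<in>B. d (x g) (x j))"
    using min[OF gL] by (simp add: split)
  \<comment> \<open>The detour through \<open>x m\<close> makes the unknown distances from
    \<open>x m\<close> to the bad points occur on both sides, where they cancel.\<close>
  also have "\<dots> \<le> (\<Sum>j\<in>G. 2 * r) + (\<Sum>j\<in>B. d (x g) (x m) + d (x m) (x j))"
    by (intro add_mono sum_mono gg tri)
  finally have 1: "(\<Sum>j\<in>G. d (x m) (x j)) \<le> card G * (2 * r) + card B * d (x g) (x m)"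
    by (simp add: sum.distrib)
  have "(\<Sum>j\<in>G. d (x g) (x m)) \<le> (\<Sum>j\<in>G. d (x m) (x j) + 2 * r)"
  proof (rule sum_mono)
    fix j assume "j \<in> G"
    show "d (x g) (x m) \<le> d (x m) (x j) + 2 * r"
      using tri[where a = "x m" and b = "x j" and c = "x g"] gg[OF \<open>j \<in> G\<close>] sym[of "x g"] by auto
  qed
  then have 2: "card G * d (x g) (x m) \<le> card G * (4 * r) + card B * d (x g) (x m)"
    using 1 by (simp add: sum.distrib algebra_simps)
  \<comment> \<open>There are at least three good points per bad one, so the term with
    \<open>card B\<close> absorbs at most a third of \<open>card G * d (x g) (x m)\<close>; what
    remains yields \<open>6 * r\<close>.\<close>
  have "3 * card B \<le> card G" using bad cG by (auto simp: B_def[symmetric])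
  then have "3 * (card B * d (x g) (x m)) \<le> card G * d (x g) (x m)"
    by (metis mult.assoc mult_le_mono1)
  then have "card G * (2 * d (x g) (x m)) \<le> card G * (12 * r)" using 2 by linarith
  moreover have "card G > 0" using \<open>G \<noteq> {}\<close> by (simp add: G_def card_gt_0_iff)
  ultimately have "2 * d (x g) (x m) \<le> 12 * r" by (meson mult_le_cancel1)
  then have "d (x g) (x m) \<le> 6 * r" by simp
  then show ?thesis
    using tri[where a = "x m" and b = "x g" and c = z] near[OF g] sym[of "x g"] by auto
qed

section \<open>Charging errors to bad triples\<close>

locale plus_graph =
  fixes V :: "'a set" and N :: "'a \<Rightarrow> 'a set"
  assumes finite_V: "finite V"
    and N_sub: "\<And>v. v \<in> V \<Longrightarrow> N v \<subseteq> V"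
    and N_refl: "\<And>v. v \<in> V \<Longrightarrow> v \<in> N v"
    and N_sym: "\<And>u v. u \<in> V \<Longrightarrow> v \<in> N u \<Longrightarrow> u \<in> N v"
begin

text \<open>The witness \<open>p\<close> is the common pointer of \<open>u\<close> and
  \<open>v\<close>, pointing to itself; the clause \<open>u = v\<close> covers vertices that stay
  alone. No pointer function is mentioned, so the relation makes sense for every ranking.\<close>

definition together :: "('a \<Rightarrow> nat) \<Rightarrow> 'a \<Rightarrow> 'a \<Rightarrow> bool" where
  "together f u v \<longleftrightarrow> u = v \<or> (\<exists>p. lowest f (N u) p \<and> lowest f (N v) p \<and> lowest f (N p) p)"

text \<open>The middle vertex of the path comes second, and each path occurs in both directions.
  Reflexivity and symmetry of \<open>N\<close> force the three vertices to be distinct.\<close>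

definition bad_triples :: "('a \<times> 'a \<times> 'a) set" where
  "bad_triples = {(a, b, c). b \<in> V \<and> a \<in> N b \<and> c \<in> N b \<and> c \<notin> N a}"

text \<open>The maximum serves both directions: the weight is at most \<open>1 / card (N a)\<close>
  and \<open>1 / card (N b)\<close>, so it can be summed over either neighbourhood, and it is at
  least \<open>1 / card S\<close> for every finite \<open>S\<close> containing both, so it bounds
  probabilities.\<close>

definition pair_weight :: "'a \<Rightarrow> 'a \<Rightarrow> real" where
  "pair_weight a b = 1 / real (max (card (N a)) (card (N b)))"

definition triple_weight :: real where
  "triple_weight = (\<Sum>(a, b, c)\<in>bad_triples. pair_weight a b)"

lemma finite_N [simp]: "v \<in> V \<Longrightarrow> finite (N v)"
  using N_sub finite_V finite_subset by blast

lemma card_N_pos: "v \<in> V \<Longrightarrow> card (N v) > 0"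
  using N_refl by (auto simp: card_gt_0_iff)

lemma N_in_V: "u \<in> V \<Longrightarrow> v \<in> N u \<Longrightarrow> v \<in> V"
  using N_sub by blast

lemma bad_triples_sub: "bad_triples \<subseteq> V \<times> V \<times> V"
  using N_sub by (fastforce simp: bad_triples_def)

lemma triple_weight_eq:
  "triple_weight = (\<Sum>a\<in>V. \<Sum>b\<in>V. \<Sum>c\<in>V. of_bool ((a, b, c) \<in> bad_triples) * pair_weight a b)"
proof -
  have "triple_weight = (\<Sum>(a, b, c)\<in>V \<times> V \<times> V. of_bool ((a, b, c) \<in> bad_triples) * pair_weight a b)"
    unfolding triple_weight_def using bad_triples_sub finite_V
    by (intro sum.mono_neutral_cong_left) auto
  then show ?thesis by (simp add: sum.cartesian_product)
qed

lemma inverse_card_le_pair_weight: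
  assumes "u \<in> V" "v \<in> V" "finite S" "N u \<subseteq> S" "N v \<subseteq> S"
  shows "1 / real (card S) \<le> pair_weight u v"
proof -
  have "card (N u) \<le> card S" "card (N v) \<le> card S" using assms by (auto intro: card_mono)
  then show ?thesis using card_N_pos[OF assms(1)]
    unfolding pair_weight_def by (intro divide_left_mono) (auto simp: max_def)
qed

lemma pair_weight_nonneg: "pair_weight u v \<ge> 0"
  by (simp add: pair_weight_def)

lemma pair_weight_le:
  assumes "u \<in> V" "v \<in> V"
  shows "pair_weight u v \<le> 1 / real (card (N u))" "pair_weight u v \<le> 1 / real (card (N v))"
  using card_N_pos[OF assms(1)] card_N_pos[OF assms(2)]
  by (auto simp: pair_weight_def intro!: divide_left_mono)

lemma sum_N_inverse:
  assumes "v \<in> V"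
  shows "(\<Sum>c\<in>V. of_bool (c \<in> N v) * (1 / real (card (N v)))) = 1"
proof -
  have "(\<Sum>c\<in>V. of_bool (c \<in> N v) * (1 / real (card (N v)))) = (\<Sum>c\<in>N v. 1 / real (card (N v)))"
    using N_sub[OF assms] finite_V by (intro sum.mono_neutral_cong_right) auto
  then show ?thesis using card_N_pos[OF assms] by simp
qed

text \<open>Every bad triple contains a pair on which an equivalence relation errs, and the weights
  of the triples through one pair, in one fixed role, sum to at most 1.\<close>

lemma triple_weight_le:
  assumes trans: "\<And>a b c. R a b \<Longrightarrow> R b c \<Longrightarrow> R a c" and sym: "\<And>a b. R a b \<Longrightarrow> R b a"
  shows "triple_weight \<le> 3 * real (rel_dist V R (\<lambda>u v. v \<in> N u))"
proof -
  define err where "err u v \<longleftrightarrow> R u v \<noteq> (v \<in> N u)" for u v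
  define i where "i b = 1 / real (card (N b))" for b
  have i_nonneg: "i b \<ge> 0" for b by (simp add: i_def)
  have E: "real (rel_dist V R (\<lambda>u v. v \<in> N u)) = (\<Sum>u\<in>V. \<Sum>v\<in>V. of_bool (err u v))"
    unfolding err_def by (simp add: rel_dist_sum[OF finite_V])
  \<comment> \<open>Each erring pair is weighted by a neighbourhood that contains the remaining
    vertex of the triple: \<open>N b\<close> for an end \<open>c\<close> or \<open>a\<close>,
    \<open>N a\<close> for the middle \<open>b\<close>. The sum over that vertex is then 1.\<close>
  have "triple_weight \<le> (\<Sum>a\<in>V. \<Sum>b\<in>V. \<Sum>c\<in>V. of_bool (err a b) * (of_bool (c \<in> N b) * i b)
      + of_bool (err b c) * (of_bool (a \<in> N b) * i b) + of_bool (err a c) * (of_bool (b \<in> N a) * i a))"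
    unfolding triple_weight_eq
  proof (intro sum_mono)
    fix a b c assume V: "a \<in> V" "b \<in> V" "c \<in> V"
    show "of_bool ((a, b, c) \<in> bad_triples) * pair_weight a b \<le> of_bool (err a b) * (of_bool (c \<in> N b) * i b)
      + of_bool (err b c) * (of_bool (a \<in> N b) * i b) + of_bool (err a c) * (of_bool (b \<in> N a) * i a)"
    proof (cases "(a, b, c) \<in> bad_triples")
      case True
 then have t: "a \<in> N b" "c \<in> N b" "c \<notin> N a" "b \<in> N a"
        using V N_sym by (auto simp: bad_triples_def)
      \<comment> \<open>Without an error \<open>R a b\<close> and \<open>R b c\<close> hold and
        \<open>R a c\<close> fails, against transitivity.\<close>
      then have "err a b \<or> err b c \<or> err a c"
        unfolding err_def using trans by blast
      moreover have "pair_weight a b \<le> i a" "pair_weight a b \<le> i b"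
        using pair_weight_le[OF V(1,2)] by (auto simp: i_def)
      ultimately show ?thesis using t True
        using i_nonneg[of a] i_nonneg[of b]
        by (cases "err a b"; cases "err b c"; cases "err a c") simp_all
    qed (simp add: i_nonneg)
  qed
  also have "\<dots> = (\<Sum>a\<in>V. \<Sum>b\<in>V. of_bool (err a b) * (\<Sum>c\<in>V. of_bool (c \<in> N b) * i b))
     + (\<Sum>b\<in>V. \<Sum>c\<in>V. of_bool (err b c) * (\<Sum>a\<in>V. of_bool (a \<in> N b) * i b))
     + (\<Sum>a\<in>V. \<Sum>c\<in>V. of_bool (err a c) * (\<Sum>b\<in>V. of_bool (b \<in> N a) * i a))"
  proof -
    have 1: "(\<Sum>b\<in>V. \<Sum>c\<in>V. \<Sum>a\<in>V. h a b c) = (\<Sum>a\<in>V. \<Sum>b\<in>V. \<Sum>c\<in>V. h a b c)"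
      for h :: "'a \<Rightarrow> 'a \<Rightarrow> 'a \<Rightarrow> real"
    proof -
      have "(\<Sum>b\<in>V. \<Sum>c\<in>V. \<Sum>a\<in>V. h a b c) = (\<Sum>b\<in>V. \<Sum>a\<in>V. \<Sum>c\<in>V. h a b c)"
        by (rule sum.cong[OF refl], rule sum.swap)
      also have "\<dots> = (\<Sum>a\<in>V. \<Sum>b\<in>V. \<Sum>c\<in>V. h a b c)" by (rule sum.swap)
      finally show ?thesis .
    qed
    have 2: "(\<Sum>a\<in>V. \<Sum>c\<in>V. \<Sum>b\<in>V. h a b c) = (\<Sum>a\<in>V. \<Sum>b\<in>V. \<Sum>c\<in>V. h a b c)"
      for h :: "'a \<Rightarrow> 'a \<Rightarrow> 'a \<Rightarrow> real"
      by (rule sum.cong[OF refl], rule sum.swap)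
    show ?thesis unfolding sum.distrib sum_distrib_left
      using 1[of "\<lambda>a b c. of_bool (err b c) * (of_bool (a \<in> N b) * i b)"]
        2[of "\<lambda>a b c. of_bool (err a c) * (of_bool (b \<in> N a) * i a)"] by simp
  qed
  also have "\<dots> = 3 * real (rel_dist V R (\<lambda>u v. v \<in> N u))"
    unfolding E using sum_N_inverse[folded i_def] by simp
  finally show ?thesis .
qed

text \<open>The sums are the ways in which a pair goes wrong. For a (-)-pair, \<open>x\<close> is a
  common pivot. For a (+)-pair, the lowest vertex \<open>x\<close> of
  \<open>N u \<union> N v\<close> lies only in \<open>N u\<close>, only in \<open>N v\<close>, or in
  both but is beaten by some \<open>z\<close> in \<open>N x\<close>. This last triple does not
  involve \<open>v\<close>, so its weight is shared out evenly over
  \<open>v \<in> N u\<close>.\<close>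

definition error_weight :: "'a \<Rightarrow> 'a \<Rightarrow> real" where
  "error_weight u v =
     (\<Sum>x\<in>V. of_bool ((u, x, v) \<in> bad_triples) * pair_weight u x)
   + (\<Sum>x\<in>V. of_bool ((v, u, x) \<in> bad_triples) * pair_weight v u)
   + (\<Sum>x\<in>V. of_bool ((u, v, x) \<in> bad_triples) * pair_weight u v)
   + (\<Sum>x\<in>V. \<Sum>z\<in>V. of_bool ((u, x, z) \<in> bad_triples) * pair_weight u x
        * (of_bool (v \<in> N u) * (1 / real (card (N u)))))"

text \<open>Each of the four sums meets every triple once; in the last one the shares over
  \<open>v \<in> N u\<close> add up to 1.\<close>

lemma sum_error_weight: "(\<Sum>u\<in>V. \<Sum>v\<in>V. error_weight u v) = 4 * triple_weight"
proof -
  let ?h = "\<lambda>a b c. of_bool ((a, b, c) \<in> bad_triples) * pair_weight a b"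
  have 1: "(\<Sum>u\<in>V. \<Sum>v\<in>V. \<Sum>x\<in>V. ?h u x v) = triple_weight"
    unfolding triple_weight_eq by (rule sum.cong[OF refl], rule sum.swap)
  have 2: "(\<Sum>u\<in>V. \<Sum>v\<in>V. \<Sum>x\<in>V. ?h v u x) = triple_weight"
    unfolding triple_weight_eq by (rule sum.swap)
  have "(\<Sum>v\<in>V. \<Sum>x\<in>V. \<Sum>z\<in>V. ?h u x z * (of_bool (v \<in> N u) * (1 / real (card (N u)))))
      = (\<Sum>x\<in>V. \<Sum>z\<in>V. ?h u x z)" if "u \<in> V" for u
  proof -
    have "(\<Sum>v\<in>V. \<Sum>x\<in>V. \<Sum>z\<in>V. ?h u x z * (of_bool (v \<in> N u) * (1 / real (card (N u)))))
      = (\<Sum>v\<in>V. (of_bool (v \<in> N u) * (1 / real (card (N u)))) * (\<Sum>x\<in>V. \<Sum>z\<in>V. ?h u x z))"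
      unfolding sum_distrib_left by (intro sum.cong refl) (rule mult.commute)
    also have "\<dots> = (\<Sum>x\<in>V. \<Sum>z\<in>V. ?h u x z)"
      by (subst sum_distrib_right[symmetric], subst sum_N_inverse[OF that], simp)
    finally show ?thesis .
  qed
  then have 4: "(\<Sum>u\<in>V. \<Sum>v\<in>V. \<Sum>x\<in>V. \<Sum>z\<in>V.
      ?h u x z * (of_bool (v \<in> N u) * (1 / real (card (N u))))) = triple_weight"
    unfolding triple_weight_eq by (rule sum.cong[OF refl])
  show ?thesis
    unfolding error_weight_def sum.distrib 1 2 4 triple_weight_eq[symmetric] by simp
qed

lemma card_UN_le_sum:
  assumes "finite A" "\<And>x. x \<in> A \<Longrightarrow> real (card (F x)) \<le> g x"
  shows "real (card (\<Union>x\<in>A. F x)) \<le> (\<Sum>x\<in>A. g x)"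
proof -
  have "real (card (\<Union>x\<in>A. F x)) \<le> (\<Sum>x\<in>A. real (card (F x)))"
    using card_UN_le[OF assms(1), of F] by (metis of_nat_le_iff of_nat_sum)
  also have "\<dots> \<le> (\<Sum>x\<in>A. g x)" by (intro sum_mono assms)
  finally show ?thesis .
qed

lemma error_weight_ge:
  assumes "u \<in> V" "v \<in> V"
  shows "(\<Sum>x\<in>V. of_bool ((u, x, v) \<in> bad_triples) * pair_weight u x) \<le> error_weight u v"
    and "(\<Sum>x\<in>V. of_bool ((v, u, x) \<in> bad_triples) * pair_weight v u)
      + (\<Sum>x\<in>V. of_bool ((u, v, x) \<in> bad_triples) * pair_weight u v)
      + (\<Sum>x\<in>V. \<Sum>z\<in>V. of_bool ((u, x, z) \<in> bad_triples) * pair_weight u x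
        * (of_bool (v \<in> N u) * (1 / real (card (N u))))) \<le> error_weight u v"
  unfolding error_weight_def
  by (simp_all only: le_add_same_cancel1 add.assoc le_add_same_cancel2)
    (intro add_nonneg_nonneg sum_nonneg mult_nonneg_nonneg pair_weight_nonneg; simp)+

text \<open>A common pivot \<open>p\<close> is lowest in
  \<open>N u \<union> N v \<union> N p\<close>, which has probability at most
  \<open>pair_weight u p\<close>, and \<open>u, p, v\<close> is a bad triple.\<close>

lemma card_error_minus:
  assumes "u \<in> V" "v \<in> V" "v \<notin> N u"
  shows "real (card {f \<in> rankings V M. together f u v}) \<le> real (card (rankings V M)) * error_weight u v"
proof -
  let ?R = "real (card (rankings V M))"
  have fin: "finite (N u \<inter> N v)" using assms by simp
  have "{f \<in> rankings V M. together f u v}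
      \<subseteq> (\<Union>p\<in>N u \<inter> N v. {f \<in> rankings V M. lowest f (N u \<union> N v \<union> N p) p})"
    using assms N_refl[of u] by (auto simp: together_def lowest_def)
  then have "real (card {f \<in> rankings V M. together f u v})
      \<le> real (card (\<Union>p\<in>N u \<inter> N v. {f \<in> rankings V M. lowest f (N u \<union> N v \<union> N p) p}))"
    using finite_V fin by (intro of_nat_mono card_mono) auto
  also have "\<dots> \<le> (\<Sum>p\<in>N u \<inter> N v. ?R * pair_weight u p)"
  proof (rule card_UN_le_sum[OF fin])
    fix p assume p: "p \<in> N u \<inter> N v"
    then have pV: "p \<in> V" using N_in_V assms by blast
    have "real (card {f \<in> rankings V M. lowest f (N u \<union> N v \<union> N p) p}) = ?R * (1 / real (card (N u \<union> N v \<union> N p)))"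
      using card_lowest[OF finite_V, of "N u \<union> N v \<union> N p" p M] N_sub[OF assms(1)] N_sub[OF assms(2)] N_sub[OF pV] p
      by simp
    also have "\<dots> \<le> ?R * pair_weight u p"
      using assms pV by (intro mult_left_mono inverse_card_le_pair_weight) auto
    finally show "real (card {f \<in> rankings V M. lowest f (N u \<union> N v \<union> N p) p}) \<le> ?R * pair_weight u p" .
  qed
  also have "\<dots> = ?R * (\<Sum>p\<in>N u \<inter> N v. pair_weight u p)" by (simp add: sum_distrib_left)
  also have "(\<Sum>p\<in>N u \<inter> N v. pair_weight u p) = (\<Sum>x\<in>V. of_bool ((u, x, v) \<in> bad_triples) * pair_weight u x)"
    using assms N_sub[OF assms(1)] N_sym finite_V
    by (intro sum.mono_neutral_cong_left) (auto simp: bad_triples_def)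
  also have "?R * \<dots> \<le> ?R * error_weight u v"
    using error_weight_ge(1)[OF assms(1,2)] by (intro mult_left_mono) auto
  finally show ?thesis .
qed

text \<open>The lowest vertex of \<open>N u \<union> N v\<close> decides: if it is common and also
  lowest in its own neighbourhood, it is a pivot of both. The cases are the ways for this to
  fail.\<close>

lemma not_together_cases:
  assumes V: "u \<in> V" "v \<in> V" and "\<not> together f u v"
  obtains (left) x where "x \<in> N u - N v" "lowest f (N u \<union> N v) x"
  | (right) x where "x \<in> N v - N u" "lowest f (N u \<union> N v) x"
  | (common) x where "x \<in> N u \<inter> N v" "lowest f (N u \<union> N v) x" "\<not> lowest f (N u \<union> N v \<union> N x) x"
proof -
  obtain x where x: "lowest f (N u \<union> N v) x"
    using lowest_exists[of "N u \<union> N v"] V N_refl by (metis UnI1 empty_iff finite_N finite_Un)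
  show ?thesis
  proof (cases "x \<in> N u \<inter> N v")
    case True
    have "\<not> lowest f (N u \<union> N v \<union> N x) x"
    proof
      assume "lowest f (N u \<union> N v \<union> N x) x"
      then have "together f u v" using True V N_in_V[of u x] N_refl[of x] by (auto simp: together_def lowest_def)
      then show False using assms by simp
    qed
    then show ?thesis using True x common by blast
  next
    case False
    then show ?thesis using x left right by (auto simp: lowest_def)
  qed
qed

text \<open>Union bound over the three cases. In the first two, \<open>x\<close> is next to only one
  of \<open>u\<close> and \<open>v\<close> and forms a bad triple with the (+)-edge; in the third,
  each \<open>z \<in> N x\<close> outside \<open>N u \<union> N v\<close> gives the bad triple
  \<open>u, x, z\<close>.\<close>

lemma card_error_plus:
  assumes V: "u \<in> V" "v \<in> V" and vN: "v \<in> N u"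
  shows "real (card {f \<in> rankings V M. \<not> together f u v}) \<le> real (card (rankings V M)) * error_weight u v"
proof -
  let ?R = "real (card (rankings V M))"
  let ?S = "N u \<union> N v"
  let ?L = "\<lambda>x. {f \<in> rankings V M. lowest f ?S x}"
  let ?C = "\<lambda>x. {f \<in> rankings V M. lowest f ?S x \<and> \<not> lowest f (?S \<union> N x) x}"
  let ?A1 = "\<Union>x\<in>N u - N v. ?L x" and ?A2 = "\<Union>x\<in>N v - N u. ?L x" and ?A3 = "\<Union>x\<in>N u \<inter> N v. ?C x"
  let ?i = "1 / real (card (N u))"
  have S: "?S \<subseteq> V" "finite ?S" using V N_sub by auto
  have uN: "u \<in> N v" using N_sym V vN by blast
  have "{f \<in> rankings V M. \<not> together f u v} \<subseteq> ?A1 \<union> ?A2 \<union> ?A3"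
  proof
    fix f assume f: "f \<in> {f \<in> rankings V M. \<not> together f u v}"
    then have "\<not> together f u v" by simp
    from not_together_cases[OF V this] show "f \<in> ?A1 \<union> ?A2 \<union> ?A3"
      using f by cases auto
  qed
  then have "card {f \<in> rankings V M. \<not> together f u v} \<le> card (?A1 \<union> ?A2 \<union> ?A3)"
    using V finite_V by (intro card_mono) auto
  also have "\<dots> \<le> card ?A1 + card ?A2 + card ?A3"
    using card_Un_le[of "?A1 \<union> ?A2" ?A3] card_Un_le[of ?A1 ?A2] by linarith
  finally have main: "real (card {f \<in> rankings V M. \<not> together f u v})
      \<le> real (card ?A1) + real (card ?A2) + real (card ?A3)"
    by (simp only: of_nat_add[symmetric] of_nat_le_iff)
  have L: "real (card (?L x)) \<le> ?R * pair_weight u v" if "x \<in> ?S" for x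
  proof -
    have "real (card (?L x)) = ?R * (1 / real (card ?S))"
      unfolding card_lowest[OF finite_V S(1) that, of M] by simp
    also have "\<dots> \<le> ?R * pair_weight u v"
      using inverse_card_le_pair_weight[OF V S(2)] by (intro mult_left_mono) auto
    finally show ?thesis .
  qed
  have "real (card ?A1) \<le> (\<Sum>x\<in>N u - N v. ?R * pair_weight u v)"
    using V L by (intro card_UN_le_sum) auto
  also have "\<dots> = (\<Sum>x\<in>V. ?R * (of_bool ((v, u, x) \<in> bad_triples) * pair_weight v u))"
    using V vN N_sub[OF V(1)] finite_V
    by (intro sum.mono_neutral_cong_left) (auto simp: bad_triples_def pair_weight_def max.commute)
  finally have A1: "real (card ?A1) \<le> ?R * (\<Sum>x\<in>V. of_bool ((v, u, x) \<in> bad_triples) * pair_weight v u)"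
    by (simp only: sum_distrib_left)
  have "real (card ?A2) \<le> (\<Sum>x\<in>N v - N u. ?R * pair_weight u v)"
    using V L by (intro card_UN_le_sum) auto
  also have "\<dots> = (\<Sum>x\<in>V. ?R * (of_bool ((u, v, x) \<in> bad_triples) * pair_weight u v))"
    using V uN N_sub[OF V(2)] finite_V
    by (intro sum.mono_neutral_cong_left) (auto simp: bad_triples_def)
  finally have A2: "real (card ?A2) \<le> ?R * (\<Sum>x\<in>V. of_bool ((u, v, x) \<in> bad_triples) * pair_weight u v)"
    by (simp only: sum_distrib_left)
  have C: "real (card (?C x)) \<le> ?R * (\<Sum>z\<in>N x - ?S. pair_weight u x * ?i)" if x: "x \<in> N u \<inter> N v" for x
  proof -
    have xV: "x \<in> V" using x N_in_V V by blast
    \<comment> \<open>The larger set pays for the weight of the triple \<open>u, x, z\<close>; the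
      factor \<open>1 / card ?S\<close> pays for the share that falls to this particular
      \<open>v \<in> N u\<close>.\<close>
    have "1 / (real (card ?S) * real (card (?S \<union> N x))) \<le> pair_weight u x * ?i"
    proof -
      have "1 / real (card (?S \<union> N x)) \<le> pair_weight u x"
        using V xV by (intro inverse_card_le_pair_weight) auto
      moreover have "1 / real (card ?S) \<le> ?i"
        using V card_N_pos[OF V(1)] by (intro divide_left_mono) (auto intro: card_mono simp: card_gt_0_iff)
      ultimately have "1 / real (card (?S \<union> N x)) * (1 / real (card ?S)) \<le> pair_weight u x * ?i"
        using pair_weight_nonneg by (intro mult_mono) auto
      then show ?thesis by (simp add: mult.commute)
    qed
    then have "(\<Sum>z\<in>N x - ?S. 1 / (real (card ?S) * real (card (?S \<union> N x)))) \<le> (\<Sum>z\<in>N x - ?S. pair_weight u x * ?i)"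
      by (intro sum_mono)
    then show ?thesis
      unfolding card_lowest_not_lowest[OF finite_V S(1) N_sub[OF xV] UnI1[OF IntD1[OF x]]]
      by (rule mult_left_mono) simp
  qed
  have "real (card ?A3) \<le> (\<Sum>x\<in>N u \<inter> N v. ?R * (\<Sum>z\<in>N x - ?S. pair_weight u x * ?i))"
    using V C by (intro card_UN_le_sum) auto
  also have "\<dots> = ?R * (\<Sum>x\<in>N u \<inter> N v. \<Sum>z\<in>N x - ?S. pair_weight u x * ?i)"
    by (simp only: sum_distrib_left)
  also have "\<dots> \<le> ?R * (\<Sum>x\<in>V. \<Sum>z\<in>V. of_bool ((u, x, z) \<in> bad_triples) * pair_weight u x * (of_bool (v \<in> N u) * ?i))"
  proof (rule mult_left_mono)
    have "(\<Sum>x\<in>N u \<inter> N v. \<Sum>z\<in>N x - ?S. pair_weight u x * ?i)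
        \<le> (\<Sum>x\<in>N u \<inter> N v. \<Sum>z\<in>V. of_bool ((u, x, z) \<in> bad_triples) * pair_weight u x * (of_bool (v \<in> N u) * ?i))"
    proof (rule sum_mono)
      fix x assume x: "x \<in> N u \<inter> N v"
      then have xV: "x \<in> V" using N_in_V V by blast
      have "(\<Sum>z\<in>N x - ?S. pair_weight u x * ?i)
          = (\<Sum>z\<in>N x - ?S. of_bool ((u, x, z) \<in> bad_triples) * pair_weight u x * (of_bool (v \<in> N u) * ?i))"
        using x xV vN V N_sym by (intro sum.cong) (auto simp: bad_triples_def)
      also have "\<dots> \<le> (\<Sum>z\<in>V. of_bool ((u, x, z) \<in> bad_triples) * pair_weight u x * (of_bool (v \<in> N u) * ?i))"
        using N_sub[OF xV] finite_V
        by (intro sum_mono2) (auto simp: pair_weight_nonneg)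
      finally show "(\<Sum>z\<in>N x - ?S. pair_weight u x * ?i)
          \<le> (\<Sum>z\<in>V. of_bool ((u, x, z) \<in> bad_triples) * pair_weight u x * (of_bool (v \<in> N u) * ?i))" .
    qed
    also have "\<dots> \<le> (\<Sum>x\<in>V. \<Sum>z\<in>V. of_bool ((u, x, z) \<in> bad_triples) * pair_weight u x * (of_bool (v \<in> N u) * ?i))"
      using N_sub[OF V(1)] finite_V
      by (intro sum_mono2) (auto intro!: sum_nonneg simp: pair_weight_nonneg)
    finally show "(\<Sum>x\<in>N u \<inter> N v. \<Sum>z\<in>N x - ?S. pair_weight u x * ?i)
      \<le> (\<Sum>x\<in>V. \<Sum>z\<in>V. of_bool ((u, x, z) \<in> bad_triples) * pair_weight u x * (of_bool (v \<in> N u) * ?i))" .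
  qed simp
  finally have A3: "real (card ?A3) \<le> ?R * (\<Sum>x\<in>V. \<Sum>z\<in>V. of_bool ((u, x, z) \<in> bad_triples)
      * pair_weight u x * (of_bool (v \<in> N u) * ?i))" .
  have "real (card {f \<in> rankings V M. \<not> together f u v}) \<le>
     ?R * ((\<Sum>x\<in>V. of_bool ((v, u, x) \<in> bad_triples) * pair_weight v u)
      + (\<Sum>x\<in>V. of_bool ((u, v, x) \<in> bad_triples) * pair_weight u v)
      + (\<Sum>x\<in>V. \<Sum>z\<in>V. of_bool ((u, x, z) \<in> bad_triples) * pair_weight u x * (of_bool (v \<in> N u) * ?i)))"
    unfolding distrib_left using main A1 A2 A3 by (rule order_trans[OF _ add_mono[OF add_mono]])
  also have "\<dots> \<le> ?R * error_weight u v"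
    by (intro mult_left_mono error_weight_ge(2)[OF V]) simp
  finally show ?thesis .
qed

text \<open>The error probabilities of all ordered pairs add up to at most
  \<open>4 * triple_weight\<close>, and \<open>triple_weight\<close> is at most 3 times the distance
  of any symmetric and transitive \<open>R\<close>.\<close>

lemma sum_rel_dist_together:
  assumes trans: "\<And>a b c. R a b \<Longrightarrow> R b c \<Longrightarrow> R a c" and sym: "\<And>a b. R a b \<Longrightarrow> R b a"
  shows "(\<Sum>f\<in>rankings V M. rel_dist V (together f) (\<lambda>u v. v \<in> N u))
    \<le> 12 * rel_dist V R (\<lambda>u v. v \<in> N u) * card (rankings V M)"
proof -
  let ?R = "real (card (rankings V M))"
  have tw: "triple_weight \<le> 3 * real (rel_dist V R (\<lambda>u v. v \<in> N u))"
    by (rule triple_weight_le) (erule (1) trans, erule sym)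
  have "(\<Sum>f\<in>rankings V M. real (rel_dist V (together f) (\<lambda>u v. v \<in> N u)))
     = (\<Sum>u\<in>V. \<Sum>v\<in>V. real (card {f \<in> rankings V M. together f u v \<noteq> (v \<in> N u)}))"
  proof -
    have "(\<Sum>f\<in>rankings V M. real (rel_dist V (together f) (\<lambda>u v. v \<in> N u)))
      = (\<Sum>f\<in>rankings V M. \<Sum>u\<in>V. \<Sum>v\<in>V. of_bool (together f u v \<noteq> (v \<in> N u)))"
      by (simp add: rel_dist_sum[OF finite_V])
    also have "\<dots> = (\<Sum>u\<in>V. \<Sum>f\<in>rankings V M. \<Sum>v\<in>V. of_bool (together f u v \<noteq> (v \<in> N u)))"
      by (rule sum.swap)
    also have "\<dots> = (\<Sum>u\<in>V. \<Sum>v\<in>V. \<Sum>f\<in>rankings V M. of_bool (together f u v \<noteq> (v \<in> N u)))"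
      by (rule sum.cong[OF refl], rule sum.swap)
    finally show ?thesis using finite_V
      by (simp add: of_bool_def sum.If_cases Int_def)
  qed
  also have "\<dots> \<le> (\<Sum>u\<in>V. \<Sum>v\<in>V. ?R * error_weight u v)"
  proof (intro sum_mono)
    fix u v assume "u \<in> V" "v \<in> V"
    then show "real (card {f \<in> rankings V M. together f u v \<noteq> (v \<in> N u)}) \<le> ?R * error_weight u v"
      using card_error_minus card_error_plus by (cases "v \<in> N u") auto
  qed
  also have "\<dots> = ?R * (4 * triple_weight)"
    unfolding sum_error_weight[symmetric] sum_distrib_left ..
  also have "\<dots> \<le> ?R * (4 * (3 * real (rel_dist V R (\<lambda>u v. v \<in> N u))))"
    using tw by (intro mult_left_mono) auto
  finally have "real (\<Sum>f\<in>rankings V M. rel_dist V (together f) (\<lambda>u v. v \<in> N u))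
    \<le> real (12 * rel_dist V R (\<lambda>u v. v \<in> N u) * card (rankings V M))"
    by (simp add: mult_ac)
  then show ?thesis by (simp only: of_nat_le_iff)
qed

text \<open>Markov's inequality, multiplied out to stay within the natural numbers.\<close>

lemma card_far_rankings:
  assumes trans: "\<And>a b c. R a b \<Longrightarrow> R b c \<Longrightarrow> R a c" and sym: "\<And>a b. R a b \<Longrightarrow> R b a"
  shows "k * card {f \<in> rankings V M. rel_dist V (together f) (\<lambda>u v. v \<in> N u)
      > 12 * k * rel_dist V R (\<lambda>u v. v \<in> N u)} \<le> card (rankings V M)"
proof -
  let ?d = "\<lambda>f. rel_dist V (together f) (\<lambda>u v. v \<in> N u)"
  let ?r = "rel_dist V R (\<lambda>u v. v \<in> N u)"
  let ?F = "{f \<in> rankings V M. ?d f > 12 * k * ?r}"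
  have fin: "finite ?F" using finite_V by simp
  have "(\<Sum>f\<in>?F. ?d f) \<le> (\<Sum>f\<in>rankings V M. ?d f)"
    using finite_V by (intro sum_mono2) auto
  also have "\<dots> \<le> 12 * ?r * card (rankings V M)"
    by (rule sum_rel_dist_together) (erule (1) trans, erule sym)
  finally have sum: "(\<Sum>f\<in>?F. ?d f) \<le> 12 * ?r * card (rankings V M)" .
  show ?thesis
  \<comment> \<open>The distance of \<open>R\<close> is cancelled below, which fails for a perfect
    \<open>R\<close>; then the sum of the distances vanishes and no ranking is far.\<close>
  proof (cases "?r = 0")
    case True
    then have empty: "?F = {}" using sum fin by auto
    show ?thesis unfolding empty by simp
  next
    case False
    have "12 * ?r * (k * card ?F) = (\<Sum>f\<in>?F. 12 * k * ?r)" by simp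
    also have "\<dots> \<le> (\<Sum>f\<in>?F. ?d f)" by (intro sum_mono) auto
    also note sum
    finally have "12 * ?r * (k * card ?F) \<le> 12 * ?r * card (rankings V M)" .
    then show ?thesis using False by simp
  qed
qed

end

section \<open>Ties among ranks and independent copies\<close>

text \<open>Union bound over ordered pairs: a function with \<open>f u = f v\<close> is determined
  by its restriction to \<open>V - {u}\<close>, so a fixed pair collides with frequency at most
  \<open>1 / M\<close>.\<close>

lemma card_not_inj_le:
  assumes "finite V"
  shows "M * card {f \<in> V \<rightarrow>\<^sub>E {..<M}. \<not> inj_on f V} \<le> (card V)\<^sup>2 * M ^ card V"
proof -
  let ?C = "\<lambda>(u, v). {f \<in> V \<rightarrow>\<^sub>E {..<M}. f u = f v}"
  let ?P = "{(u, v) \<in> V \<times> V. u \<noteq> v}"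
  have finP: "finite ?P" using assms by (auto intro: finite_subset[of _ "V \<times> V"])
  have fin: "finite (V \<rightarrow>\<^sub>E {..<M})" using assms by (simp add: finite_PiE)
  have one: "M * card (?C (u, v)) \<le> M ^ card V" if uv: "u \<in> V" "v \<in> V" "u \<noteq> v" for u v
  proof -
    have "card (?C (u, v)) \<le> card ((V - {u}) \<rightarrow>\<^sub>E {..<M})"
    proof (rule card_inj_on_le[of "\<lambda>f. restrict f (V - {u})"])
      show "inj_on (\<lambda>f. restrict f (V - {u})) (?C (u, v))"
      proof (rule inj_onI)
        fix f g assume fg: "f \<in> ?C (u, v)" "g \<in> ?C (u, v)" "restrict f (V - {u}) = restrict g (V - {u})"
        have eq: "f x = g x" if "x \<in> V - {u}" for x using fun_cong[OF fg(3), of x] that by simp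
        moreover have "f u = g u" using fg(1,2) eq[of v] uv by simp
        ultimately have "f x = g x" if "x \<in> V" for x using that by (cases "x = u") auto
        then show "f = g" using fg(1,2) by (intro PiE_ext[of f V "\<lambda>_. {..<M}" g]) auto
      qed
      show "(\<lambda>f. restrict f (V - {u})) ` ?C (u, v) \<subseteq> (V - {u}) \<rightarrow>\<^sub>E {..<M}"
        by (auto simp: PiE_def Pi_def)
      show "finite ((V - {u}) \<rightarrow>\<^sub>E {..<M})" using assms by (simp add: finite_PiE)
    qed
    also have "\<dots> = M ^ (card V - 1)" using assms uv by (simp add: card_PiE)
    finally have "M * card (?C (u, v)) \<le> M * M ^ (card V - 1)" by simp
    also have "\<dots> = M ^ card V"
    proof -
      have "card V > 0" using assms uv(1) by (auto simp: card_gt_0_iff)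
      then show ?thesis by (cases "card V") auto
    qed
    finally show ?thesis .
  qed
  have "{f \<in> V \<rightarrow>\<^sub>E {..<M}. \<not> inj_on f V} \<subseteq> (\<Union>p\<in>?P. ?C p)"
    by (auto simp: inj_on_def)
  then have "card {f \<in> V \<rightarrow>\<^sub>E {..<M}. \<not> inj_on f V} \<le> card (\<Union>p\<in>?P. ?C p)"
    using fin finP by (intro card_mono) auto
  also have "\<dots> \<le> (\<Sum>p\<in>?P. card (?C p))" by (rule card_UN_le[OF finP])
  finally have "M * card {f \<in> V \<rightarrow>\<^sub>E {..<M}. \<not> inj_on f V} \<le> (\<Sum>p\<in>?P. M * card (?C p))"
    by (simp add: sum_distrib_left[symmetric])
  also have "\<dots> \<le> (\<Sum>p\<in>?P. M ^ card V)" using one by (intro sum_mono) auto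
  also have "\<dots> = card ?P * M ^ card V" by simp
  also have "card ?P \<le> card (V \<times> V)" using assms by (intro card_mono) auto
  finally show ?thesis by (simp add: card_cartesian_product power2_eq_square)
qed

text \<open>Ties among \<open>512 n\<^sup>2\<close> possible ranks and, by Markov, costs above \<open>512 * 12\<close> times the optimum
  each have probability at most \<open>1/512\<close>.\<close>

lemma (in plus_graph) card_unlucky:
  assumes trans: "\<And>a b c. R a b \<Longrightarrow> R b c \<Longrightarrow> R a c" and sym: "\<And>a b. R a b \<Longrightarrow> R b a"
    and M: "M = 512 * (card V)\<^sup>2" and V: "V \<noteq> {}"
  shows "256 * card {f \<in> V \<rightarrow>\<^sub>E {..<M}. inj_on f V \<longrightarrow> rel_dist V (together f) (\<lambda>u v. v \<in> N u)
      > 6144 * rel_dist V R (\<lambda>u v. v \<in> N u)} \<le> M ^ card V"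
proof -
  let ?B = "\<lambda>f. rel_dist V (together f) (\<lambda>u v. v \<in> N u) > 6144 * rel_dist V R (\<lambda>u v. v \<in> N u)"
  let ?I = "{f \<in> V \<rightarrow>\<^sub>E {..<M}. \<not> inj_on f V}" and ?F = "{f \<in> rankings V M. ?B f}"
  have fin: "finite (V \<rightarrow>\<^sub>E {..<M})" using finite_V by (simp add: finite_PiE)
  \<comment> \<open>The implication makes every tied function count as unlucky, whatever its
    distance.\<close>
  have "{f \<in> V \<rightarrow>\<^sub>E {..<M}. inj_on f V \<longrightarrow> ?B f} \<subseteq> ?I \<union> ?F" by (auto simp: rankings_def)
  then have "card {f \<in> V \<rightarrow>\<^sub>E {..<M}. inj_on f V \<longrightarrow> ?B f} \<le> card (?I \<union> ?F)"
    using fin finite_V by (intro card_mono) auto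
  also have "\<dots> \<le> card ?I + card ?F" by (rule card_Un_le)
  finally have 1: "card {f \<in> V \<rightarrow>\<^sub>E {..<M}. inj_on f V \<longrightarrow> ?B f} \<le> card ?I + card ?F" .
  have "(card V)\<^sup>2 * (512 * card ?I) \<le> (card V)\<^sup>2 * M ^ card V"
    using card_not_inj_le[OF finite_V, of M] M by (simp add: mult_ac)
  then have 2: "512 * card ?I \<le> M ^ card V" using V finite_V by (simp add: card_gt_0_iff)
  have "512 * card {f \<in> rankings V M. rel_dist V (together f) (\<lambda>u v. v \<in> N u)
      > 12 * 512 * rel_dist V R (\<lambda>u v. v \<in> N u)} \<le> card (rankings V M)"
    by (rule card_far_rankings) (erule (1) trans, erule sym)
  then have "512 * card ?F \<le> card (rankings V M)" by simp
  also have "\<dots> \<le> card (V \<rightarrow>\<^sub>E {..<M})" using fin by (intro card_mono) (auto simp: rankings_def)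
  also have "\<dots> = M ^ card V" using finite_V by (simp add: card_PiE)
  finally show ?thesis using 1 2 by simp
qed

text \<open>Row \<open>Suc i\<close> holds the ranks of copy \<open>i\<close>, as row 0 is the
  output. The restriction to \<open>{..<n}\<close> puts the copy into the function space in which
  single copies are counted.\<close>

definition copy_of :: "nat \<Rightarrow> (nat \<Rightarrow> nat) \<Rightarrow> nat \<Rightarrow> nat \<Rightarrow> nat" where
  "copy_of n f i = (\<lambda>v\<in>{..<n}. f (Suc i * n + v))"

text \<open>A table of ranks is a tuple of \<open>L\<close> independent copies. A set
  \<open>J\<close> of more than \<open>L / 4\<close> copies is unlucky throughout with probability
  at most 1 in \<open>256 ^ card J\<close>, hence 1 in \<open>4 ^ L\<close>, and there are at most
  \<open>2 ^ L\<close> such sets.\<close>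

lemma card_many_unlucky:
  fixes M n L :: nat
  assumes "B \<subseteq> {..<n} \<rightarrow>\<^sub>E {..<M}" "256 * card B \<le> M ^ n"
  defines "\<Omega> \<equiv> {n..<Suc L * n} \<rightarrow>\<^sub>E {..<M}"
  shows "2 ^ L * card {f \<in> \<Omega>. L < 4 * card {i. i < L \<and> copy_of n f i \<in> B}} \<le> card \<Omega>"
proof -
  let ?\<Omega> = "{..<n} \<rightarrow>\<^sub>E {..<M}"
  have fin: "finite \<Omega>" "finite ?\<Omega>" unfolding \<Omega>_def by (simp_all add: finite_PiE)
  have card\<Omega>: "card \<Omega> = (M ^ n) ^ L"
    unfolding \<Omega>_def by (simp add: card_PiE power_mult[symmetric] mult.commute)
  define E where "E J = {f \<in> \<Omega>. \<forall>i\<in>J. copy_of n f i \<in> B}" for J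
  have E: "4 ^ L * card (E J) \<le> card \<Omega>" if J: "J \<subseteq> {..<L}" "L < 4 * card J" for J
  proof -
    have finJ: "finite J" using J(1) finite_subset by blast
    let ?X = "\<lambda>i. if i \<in> J then B else ?\<Omega>"
    have addr: "\<exists>i<L. \<exists>v<n. a = Suc i * n + v" if "a \<in> {n..<Suc L * n}" for a
    proof -
      have n: "n > 0" using that by (cases n) auto
      have "a div n < Suc L" using that by (simp add: less_mult_imp_div_less)
      moreover have "a div n \<ge> 1" using that n by (simp add: div_greater_zero_iff Suc_le_eq)
      ultimately show ?thesis using n
        by (intro exI[of _ "a div n - 1"] conjI exI[of _ "a mod n"]) auto
    qed
    \<comment> \<open>Splitting into copies is injective because by \<open>addr\<close> every
      address of the table belongs to some copy; at the coordinates in \<open>J\<close> the values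
      lie in \<open>B\<close>.\<close>
    have "card (E J) \<le> card (PiE {..<L} ?X)"
    proof (rule card_inj_on_le[of "\<lambda>f. \<lambda>i\<in>{..<L}. copy_of n f i"])
      show "inj_on (\<lambda>f. \<lambda>i\<in>{..<L}. copy_of n f i) (E J)"
      proof (rule inj_onI)
        fix f g assume fg: "f \<in> E J" "g \<in> E J"
          and eq: "(\<lambda>i\<in>{..<L}. copy_of n f i) = (\<lambda>i\<in>{..<L}. copy_of n g i)"
        have c: "copy_of n f i = copy_of n g i" if "i < L" for i
          using fun_cong[OF eq, of i] that by simp
        have "f a = g a" if a: "a \<in> {n..<Suc L * n}" for a
        proof -
          obtain i v where iv: "i < L" "v < n" "a = Suc i * n + v" using addr[OF a] by blast
          then show ?thesis using fun_cong[OF c[OF iv(1)], of v] by (simp add: copy_of_def)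
        qed
        then show "f = g" using fg unfolding E_def \<Omega>_def
          by (intro PiE_ext[of f "{n..<Suc L * n}" "\<lambda>_. {..<M}" g]) auto
      qed
      have c\<Omega>: "copy_of n f i \<in> ?\<Omega>" if "f \<in> \<Omega>" "i < L" for f i
      proof -
        have "Suc i * n + v < Suc L * n" if "v < n" for v
        proof -
          have "Suc i * n + v < Suc (Suc i) * n" using that by simp
          also have "\<dots> \<le> Suc L * n" using \<open>i < L\<close> by (intro mult_le_mono1) simp
          finally show ?thesis .
        qed
        then show ?thesis using \<open>f \<in> \<Omega>\<close> unfolding \<Omega>_def copy_of_def
          by (auto simp: PiE_def Pi_def)
      qed
      show "(\<lambda>f. \<lambda>i\<in>{..<L}. copy_of n f i) ` E J \<subseteq> PiE {..<L} ?X"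
        using c\<Omega> by (auto simp: E_def)
      show "finite (PiE {..<L} ?X)"
        using fin(2) assms(1) by (intro finite_PiE) (auto intro: finite_subset)
    qed
    also have "\<dots> = (\<Prod>i<L. card (?X i))" by (simp add: card_PiE)
    also have "\<dots> = card B ^ card J * (M ^ n) ^ (L - card J)"
    proof -
      have "(\<Prod>i<L. card (?X i)) = (\<Prod>i\<in>J. card (?X i)) * (\<Prod>i\<in>{..<L} - J. card (?X i))"
        using prod.subset_diff[OF J(1), of "\<lambda>i. card (?X i)"] by (simp only: finite_lessThan mult.commute)
      then show ?thesis using J(1) finJ by (simp add: card_PiE card_Diff_subset)
    qed
    finally have le: "card (E J) \<le> card B ^ card J * (M ^ n) ^ (L - card J)" .
    have "card J \<le> L" using J(1) card_mono[of "{..<L}" J] by simp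
    \<comment> \<open>As \<open>256 = 4 ^ 4\<close>, each member of \<open>J\<close> pays for four
      copies, and \<open>4 * card J\<close> exceeds \<open>L\<close>.\<close>
    have "(4::nat) ^ L \<le> 4 ^ (4 * card J)" using J(2) by (intro power_increasing) auto
    also have "\<dots> = 256 ^ card J" by (simp add: power_mult)
    finally have "4 ^ L * card (E J) \<le> 256 ^ card J * (card B ^ card J * (M ^ n) ^ (L - card J))"
      using le by (intro mult_le_mono) auto
    also have "\<dots> = (256 * card B) ^ card J * (M ^ n) ^ (L - card J)" by (simp add: power_mult_distrib)
    also have "\<dots> \<le> (M ^ n) ^ card J * (M ^ n) ^ (L - card J)"
      using assms(2) by (intro mult_le_mono power_mono) auto
    also have "\<dots> = card \<Omega>" unfolding card\<Omega> using \<open>card J \<le> L\<close> by (simp add: power_add[symmetric])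
    finally show ?thesis .
  qed
  let ?\<J> = "{J \<in> Pow {..<L}. L < 4 * card J}"
  have finJ: "finite ?\<J>" by simp
  have "{f \<in> \<Omega>. L < 4 * card {i. i < L \<and> copy_of n f i \<in> B}} \<subseteq> (\<Union>J\<in>?\<J>. E J)"
  proof
    fix f assume "f \<in> {f \<in> \<Omega>. L < 4 * card {i. i < L \<and> copy_of n f i \<in> B}}"
    then show "f \<in> (\<Union>J\<in>?\<J>. E J)"
      by (intro UN_I[of "{i. i < L \<and> copy_of n f i \<in> B}"]) (auto simp: E_def)
  qed
  then have "card {f \<in> \<Omega>. L < 4 * card {i. i < L \<and> copy_of n f i \<in> B}} \<le> card (\<Union>J\<in>?\<J>. E J)"
    using fin finJ by (intro card_mono) (auto simp: E_def)
  also have "\<dots> \<le> (\<Sum>J\<in>?\<J>. card (E J))" by (rule card_UN_le[OF finJ])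
  finally have "4 ^ L * card {f \<in> \<Omega>. L < 4 * card {i. i < L \<and> copy_of n f i \<in> B}} \<le> (\<Sum>J\<in>?\<J>. 4 ^ L * card (E J))"
    by (simp add: sum_distrib_left[symmetric])
  also have "\<dots> \<le> (\<Sum>J\<in>?\<J>. card \<Omega>)" using E by (intro sum_mono) auto
  also have "\<dots> = card ?\<J> * card \<Omega>" by simp
  also have "card ?\<J> \<le> card (Pow {..<L})" by (rule card_mono) auto
  also have "card (Pow {..<L}) * card \<Omega> = 2 ^ L * card \<Omega>" by (simp add: card_Pow)
  finally have "2 ^ L * (2 ^ L * card {f \<in> \<Omega>. L < 4 * card {i. i < L \<and> copy_of n f i \<in> B}}) \<le> 2 ^ L * card \<Omega>"
    by (simp add: power_mult_distrib[symmetric] mult.assoc[symmetric])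
  then show ?thesis by simp
qed

section \<open>Cost as a distance from the graph\<close>

text \<open>Forced reflexivity keeps the meaningless labels of singletons out and makes the diagonal
  agree with every clustering.\<close>

definition plus_rel :: "('a set \<Rightarrow> label) \<Rightarrow> 'a \<Rightarrow> 'a \<Rightarrow> bool" where
  "plus_rel lab u v \<longleftrightarrow> u = v \<or> lab {u, v} = Plus"

lemma same_cluster_iff:
  "same_cluster \<C> {u, v} \<longleftrightarrow> (\<exists>A\<in>\<C>. u \<in> A \<and> v \<in> A)"
  by (simp add: same_cluster_def)

text \<open>An edge of cost 1 appears as two ordered pairs, and the diagonal contributes nothing
  because a partition covers every vertex.\<close>

lemma twice_cost:
  assumes "finite V" "partition_on V \<C>"
  shows "2 * cost V lab \<C> = rel_dist V (\<lambda>u v. same_cluster \<C> {u, v}) (plus_rel lab)"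
proof -
  let ?D = "{(u, v) \<in> V \<times> V. same_cluster \<C> {u, v} \<noteq> plus_rel lab u v}"
  have finE: "finite (edges V)" using assms(1) by (simp add: edges_def)
  have finD: "finite ?D" using assms(1) by (auto intro: finite_subset[of _ "V \<times> V"])
  have diag: "same_cluster \<C> {u}" if "u \<in> V" for u
    using that assms(2) by (auto simp: same_cluster_def partition_on_def)
  have "card ?D = (\<Sum>e\<in>edges V. card {p \<in> ?D. (case p of (u, v) \<Rightarrow> {u, v}) = e})"
  proof -
    have "?D = (\<Union>e\<in>edges V. {p \<in> ?D. (case p of (u, v) \<Rightarrow> {u, v}) = e})"
      using diag by (auto simp: edges_def plus_rel_def card_insert_if split: if_splits)
    then have "card ?D = card (\<Union>e\<in>edges V. {p \<in> ?D. (case p of (u, v) \<Rightarrow> {u, v}) = e})" by (rule arg_cong)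
    also have "\<dots> = (\<Sum>e\<in>edges V. card {p \<in> ?D. (case p of (u, v) \<Rightarrow> {u, v}) = e})"
      using finE finD by (intro card_UN_disjoint) auto
    finally show ?thesis .
  qed
  also have "\<dots> = (\<Sum>e\<in>edges V. 2 * edge_cost lab \<C> e)"
  proof (rule sum.cong[OF refl])
    fix e assume "e \<in> edges V"
    then obtain a b where e: "e = {a, b}" "a \<noteq> b" "a \<in> V" "b \<in> V"
      by (auto simp: edges_def card_2_iff)
    have "{p \<in> ?D. (case p of (u, v) \<Rightarrow> {u, v}) = e}
       = (if same_cluster \<C> e \<noteq> (lab e = Plus) then {(a, b), (b, a)} else {})"
      using e by (auto simp: doubleton_eq_iff plus_rel_def insert_commute)
    then show "card {p \<in> ?D. (case p of (u, v) \<Rightarrow> {u, v}) = e} = 2 * edge_cost lab \<C> e"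
      using e(2) by (auto simp: edge_cost_def split: label.splits)
  qed
  finally show ?thesis by (simp add: cost_def rel_dist_def sum_distrib_left)
qed

lemma opt_cost_attained:
  obtains \<C> where "partition_on V \<C>" "cost V lab \<C> = opt_cost V lab"
proof -
  have "\<exists>\<C>. partition_on V \<C>"
    by (cases "V = {}") (auto intro: partition_on_space simp: partition_on_def)
  then have "cost V lab ` {\<C>. partition_on V \<C>} \<noteq> {}" by blast
  from Inf_nat_def1[OF this] show ?thesis
    using that unfolding opt_cost_def by (metis (mono_tags, lifting) imageE mem_Collect_eq)
qed

section \<open>Deterministic time-bounded execution\<close>

text \<open>Quantifying over the rest \<open>K\<close> of the control stack and over all sufficient
  budgets \<open>t\<close> makes these facts composable. The step count is exact and the result is a
  single state, so the computation is deterministic.\<close>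

definition runs :: "nat \<Rightarrow> nat \<Rightarrow> com \<Rightarrow> state \<Rightarrow> nat \<Rightarrow> state \<Rightarrow> bool" where
  "runs s w c \<sigma> k \<sigma>' \<longleftrightarrow> (\<forall>K t. k \<le> t \<longrightarrow> exec s w t (c # K) \<sigma> = exec s w (t - k) K \<sigma>')"

definition wp :: "nat \<Rightarrow> nat \<Rightarrow> com \<Rightarrow> nat \<Rightarrow> (state \<Rightarrow> bool) \<Rightarrow> state \<Rightarrow> bool" where
  "wp s w c k Q \<sigma> \<longleftrightarrow> (\<exists>k' \<sigma>'. k' \<le> k \<and> runs s w c \<sigma> k' \<sigma>' \<and> Q \<sigma>')"

text \<open>The postcondition takes the number of time steps that are left.\<close>

fun vc :: "nat \<Rightarrow> nat \<Rightarrow> com \<Rightarrow> (nat \<Rightarrow> state \<Rightarrow> bool) \<Rightarrow> nat \<Rightarrow> state \<Rightarrow> bool" where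
  "vc s w Skip Q k \<sigma> \<longleftrightarrow> 1 \<le> k \<and> Q (k - 1) \<sigma>"
| "vc s w (Compute r f x y) Q k \<sigma> \<longleftrightarrow> 1 \<le> k \<and>
     binop_val f (operand_val x \<sigma>) (operand_val y \<sigma>) < 2 ^ w \<and>
     Q (k - 1) (\<sigma>\<lparr>regs := (regs \<sigma>)(r := binop_val f (operand_val x \<sigma>) (operand_val y \<sigma>))\<rparr>)"
| "vc s w (Load r x) Q k \<sigma> \<longleftrightarrow> 1 \<le> k \<and> operand_val x \<sigma> < s \<and> mem \<sigma> (operand_val x \<sigma>) < 2 ^ w \<and>
     Q (k - 1) (\<sigma>\<lparr>regs := (regs \<sigma>)(r := mem \<sigma> (operand_val x \<sigma>))\<rparr>)"
| "vc s w (Store x y) Q k \<sigma> \<longleftrightarrow> 1 \<le> k \<and> operand_val x \<sigma> < s \<and> operand_val y \<sigma> < 2 ^ w \<and>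
     Q (k - 1) (\<sigma>\<lparr>mem := (mem \<sigma>)(operand_val x \<sigma> := operand_val y \<sigma>)\<rparr>)"
| "vc s w (Random r x) Q k \<sigma> \<longleftrightarrow> False"
| "vc s w (Seq c d) Q k \<sigma> \<longleftrightarrow> 1 \<le> k \<and> vc s w c (vc s w d Q) (k - 1) \<sigma>"
| "vc s w (Branch p x y c d) Q k \<sigma> \<longleftrightarrow> 1 \<le> k \<and>
     (if cmpop_val p (operand_val x \<sigma>) (operand_val y \<sigma>) then vc s w c Q (k - 1) \<sigma> else vc s w d Q (k - 1) \<sigma>)"
| "vc s w (While p x y c) Q k \<sigma> \<longleftrightarrow> (\<exists>k'\<le>k. wp s w (While p x y c) k' (Q (k - k')) \<sigma>)"

lemma runs_one_step:
  assumes "\<And>K. step s w c K \<sigma> = return_spmf (K, \<sigma>')"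
  shows "runs s w c \<sigma> 1 \<sigma>'"
  unfolding runs_def
proof (intro allI impI)
  fix K :: "com list" and t :: nat assume "1 \<le> t"
  then show "exec s w t (c # K) \<sigma> = exec s w (t - 1) K \<sigma>'"
    by (cases t) (simp_all add: assms)
qed

lemma runs_then:
  assumes "\<And>K. step s w c K \<sigma> = return_spmf (d # K, \<sigma>)" "runs s w d \<sigma> k \<sigma>'"
  shows "runs s w c \<sigma> (Suc k) \<sigma>'"
  unfolding runs_def
proof (intro allI impI)
  fix K :: "com list" and t :: nat assume "Suc k \<le> t"
  then show "exec s w t (c # K) \<sigma> = exec s w (t - Suc k) K \<sigma>'"
    using assms(2) by (cases t) (simp_all add: assms(1) runs_def)
qed

text \<open>Covers both \<open>Seq\<close> and an entered \<open>While\<close>: each spends one step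
  on pushing two commands.\<close>

lemma runs_then2:
  assumes "\<And>K. step s w c K \<sigma> = return_spmf (d # e # K, \<sigma>)"
    "runs s w d \<sigma> k \<sigma>'" "runs s w e \<sigma>' l \<sigma>''"
  shows "runs s w c \<sigma> (Suc (k + l)) \<sigma>''"
  unfolding runs_def
proof (intro allI impI)
  fix K :: "com list" and t :: nat assume "Suc (k + l) \<le> t"
  then show "exec s w t (c # K) \<sigma> = exec s w (t - Suc (k + l)) K \<sigma>''"
    using assms(2,3) by (cases t) (simp_all add: assms(1) runs_def)
qed

text \<open>Soundness of the verification conditions. The slack in \<open>k' + l \<le> k\<close> is
  there because the time of a loop is known only by an upper bound.\<close>

lemma vc_runs:
  "vc s w c Q k \<sigma> \<Longrightarrow> \<exists>k' l \<sigma>'. runs s w c \<sigma> k' \<sigma>' \<and> k' + l \<le> k \<and> Q l \<sigma>'"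
proof (induction c arbitrary: Q k \<sigma>)
  case (Seq c d)
  then obtain k1 l1 \<sigma>1 where 1: "runs s w c \<sigma> k1 \<sigma>1" "k1 + l1 \<le> k - 1" "vc s w d Q l1 \<sigma>1" "1 \<le> k"
    by fastforce
  then obtain k2 l2 \<sigma>2 where "runs s w d \<sigma>1 k2 \<sigma>2" "k2 + l2 \<le> l1" "Q l2 \<sigma>2"
    using Seq.IH(2) by blast
  then show ?case using 1 by (intro exI[of _ "Suc (k1 + k2)"] exI[of _ l2] exI[of _ \<sigma>2]) (auto intro: runs_then2)
next
  case (Branch p x y c d)
  let ?c = "if cmpop_val p (operand_val x \<sigma>) (operand_val y \<sigma>) then c else d"
  have "\<exists>k' l \<sigma>'. runs s w ?c \<sigma> k' \<sigma>' \<and> k' + l \<le> k - 1 \<and> Q l \<sigma>'"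
    using Branch.prems Branch.IH(1)[of Q "k - 1" \<sigma>] Branch.IH(2)[of Q "k - 1" \<sigma>] by (auto split: if_splits)
  then obtain k' l \<sigma>' where "runs s w ?c \<sigma> k' \<sigma>'" "k' + l \<le> k - 1" "Q l \<sigma>'" by blast
  then show ?case using Branch.prems
    by (intro exI[of _ "Suc k'"] exI[of _ l] exI[of _ \<sigma>'] conjI runs_then[where d = ?c]) auto
next
  case (While p x y c)
  then obtain k0 k' \<sigma>' where "k0 \<le> k" "k' \<le> k0" "runs s w (While p x y c) \<sigma> k' \<sigma>'" "Q (k - k0) \<sigma>'"
    by (auto simp: wp_def)
  then show ?case by (intro exI[of _ k'] exI[of _ "k - k0"] exI[of _ \<sigma>']) auto
next
  case Skip
  then show ?case by (intro exI[of _ 1] exI[of _ "k - 1"] exI conjI runs_one_step) auto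
next
  case (Compute r f x y)
  then show ?case
    by (intro exI[of _ 1] exI[of _ "k - 1"] exI conjI runs_one_step) (auto simp: set_reg_def)
next
  case (Load r x)
  then show ?case
    by (intro exI[of _ 1] exI[of _ "k - 1"] exI conjI runs_one_step) (auto simp: set_reg_def load_def)
next
  case (Store x y)
  then show ?case
    by (intro exI[of _ 1] exI[of _ "k - 1"] exI conjI runs_one_step) (auto simp: store_def)
qed auto

lemma wp_vc: "vc s w c (\<lambda>_. Q) k \<sigma> \<Longrightarrow> wp s w c k Q \<sigma>"
  unfolding wp_def using vc_runs[of s w c "\<lambda>_. Q" k \<sigma>] by (meson add_leD1)

lemma wp_mono:
  assumes "wp s w c k Q \<sigma>" "k \<le> k'" "\<And>\<sigma>. Q \<sigma> \<Longrightarrow> Q' \<sigma>"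
  shows "wp s w c k' Q' \<sigma>"
  using assms unfolding wp_def by (meson order_trans)

lemma wp_While_exit:
  assumes "\<not> cmpop_val p (operand_val x \<sigma>) (operand_val y \<sigma>)" "Q \<sigma>" "1 \<le> k"
  shows "wp s w (While p x y c) k Q \<sigma>"
  unfolding wp_def using assms by (intro exI[of _ 1] exI[of _ \<sigma>]) (auto intro!: runs_one_step simp del: One_nat_def)

lemma wp_While_step:
  assumes "cmpop_val p (operand_val x \<sigma>) (operand_val y \<sigma>)"
    and "wp s w c k (wp s w (While p x y c) l Q) \<sigma>"
  shows "wp s w (While p x y c) (Suc (k + l)) Q \<sigma>"
proof -
  obtain k1 \<sigma>1 k2 \<sigma>2 where "k1 \<le> k" "runs s w c \<sigma> k1 \<sigma>1" "k2 \<le> l" "runs s w (While p x y c) \<sigma>1 k2 \<sigma>2" "Q \<sigma>2"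
    using assms(2) by (auto simp: wp_def)
  then show ?thesis unfolding wp_def using assms(1)
    by (intro exI[of _ "Suc (k1 + k2)"] exI[of _ \<sigma>2]) (auto intro!: runs_then2)
qed

text \<open>The number \<open>m\<close> of rounds is fixed in advance, but the cost
  \<open>b i\<close> may vary with the round, which permits amortized bounds over lists of different
  lengths. Each round pays one step for its test; the failing test is the
  \<open>+ 1\<close>.\<close>

lemma wp_for:
  assumes init: "I 0 \<sigma>"
    and body: "\<And>i \<sigma>. i < m \<Longrightarrow> I i \<sigma> \<Longrightarrow>
      cmpop_val p (operand_val x \<sigma>) (operand_val y \<sigma>) \<and> wp s w c (b i) (I (Suc i)) \<sigma>"
    and exit: "\<And>\<sigma>. I m \<sigma> \<Longrightarrow> \<not> cmpop_val p (operand_val x \<sigma>) (operand_val y \<sigma>) \<and> Q \<sigma>"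
    and time: "(\<Sum>i<m. Suc (b i)) + 1 \<le> k"
  shows "wp s w (While p x y c) k Q \<sigma>"
proof -
  have "I j \<sigma> \<Longrightarrow> wp s w (While p x y c) ((\<Sum>i\<in>{j..<m}. Suc (b i)) + 1) Q \<sigma>" if "j \<le> m" for j \<sigma>
    using that
  proof (induction j arbitrary: \<sigma> rule: inc_induct)
    case base
    then show ?case using exit by (auto intro: wp_While_exit)
  next
    case (step j)
    have "wp s w c (b j) (wp s w (While p x y c) ((\<Sum>i\<in>{Suc j..<m}. Suc (b i)) + 1) Q) \<sigma>"
      using body[OF step.hyps(2) step.prems] step.IH by (auto intro: wp_mono)
    from wp_While_step[OF _ this] show ?case
      using body[OF step.hyps(2) step.prems] step.hyps(2) by (simp add: sum.atLeast_Suc_lessThan)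
  qed
  from this[of 0 \<sigma>] show ?thesis
    using init time by (auto simp: atLeast0LessThan intro: wp_mono)
qed

text \<open>With one \<open>Seq\<close> per command and the closing \<open>Skip\<close>, a block of
  \<open>m\<close> single-step commands takes \<open>2 * m + 1\<close> steps.\<close>

fun block :: "com list \<Rightarrow> com" where
  "block [] = Skip"
| "block (c # cs) = Seq c (block cs)"

lemma exec_wp:
  assumes "wp s w c k Q \<sigma>" "k \<le> t"
  obtains \<sigma>' where "exec s w t [c] \<sigma> = return_spmf \<sigma>'" "Q \<sigma>'"
  using assms unfolding wp_def runs_def by (metis exec.simps(1) order_trans)

section \<open>Filling memory with uniform ranks\<close>

text \<open>A uniform function on \<open>insert a A\<close> is a uniform value at \<open>a\<close>
  with an independent uniform function on \<open>A\<close>. This lets a loop of single draws be read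
  as one draw of a whole table.\<close>

lemma spmf_of_set_PiE_insert:
  fixes S :: "nat set"
  assumes "finite A" "a \<notin> A" "finite S" "S \<noteq> {}"
  shows "spmf_of_set (insert a A \<rightarrow>\<^sub>E S) =
    bind_spmf (spmf_of_set S) (\<lambda>x. map_spmf (\<lambda>f. f(a := x)) (spmf_of_set (A \<rightarrow>\<^sub>E S)))"
proof -
  have fin: "finite (A \<rightarrow>\<^sub>E S)" "A \<rightarrow>\<^sub>E S \<noteq> {}" using assms by (auto simp: finite_PiE PiE_eq_empty_iff)
  have "spmf_of_set (insert a A \<rightarrow>\<^sub>E S) = spmf_of_set ((\<lambda>(x, f). f(a := x)) ` (S \<times> (A \<rightarrow>\<^sub>E S)))"
    by (simp add: PiE_insert_eq)
  also have "\<dots> = map_spmf (\<lambda>(x, f). f(a := x)) (spmf_of_set (S \<times> (A \<rightarrow>\<^sub>E S)))"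
    using inj_combinator[OF assms(2), of "\<lambda>_. S"] by (simp add: map_spmf_of_set_inj_on)
  also have "spmf_of_set (S \<times> (A \<rightarrow>\<^sub>E S)) = pair_spmf (spmf_of_set S) (spmf_of_set (A \<rightarrow>\<^sub>E S))"
  proof (rule spmf_eqI)
    fix p :: "nat \<times> ('a \<Rightarrow> nat)"
    obtain x f where p: "p = (x, f)" by (cases p)
    show "spmf (spmf_of_set (S \<times> (A \<rightarrow>\<^sub>E S))) p = spmf (pair_spmf (spmf_of_set S) (spmf_of_set (A \<rightarrow>\<^sub>E S))) p"
      unfolding p using fin assms by (simp add: spmf_of_set card_cartesian_product indicator_def)
  qed
  finally show ?thesis
    by (simp add: pair_spmf_alt_def map_spmf_bind_spmf map_spmf_conv_bind_spmf o_def fun_upd_def)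
qed

text \<open>Register 9 is cleared so that the final state depends on the drawn values only through memory.\<close>

definition random_fill :: com where
  "random_fill = While Less (Reg 7) (Reg 5) (block [Random 9 (Reg 8), Store (Reg 7) (Reg 9),
     Compute 9 Add (Imm 0) (Imm 0), Compute 7 Add (Reg 7) (Imm 1)])"

definition filled :: "nat \<Rightarrow> nat \<Rightarrow> (nat \<Rightarrow> nat) \<Rightarrow> state \<Rightarrow> state" where
  "filled a e f \<sigma> = \<sigma>\<lparr>regs := (regs \<sigma>)(7 := e), mem := (\<lambda>x. if a \<le> x \<and> x < e then f x else mem \<sigma> x)\<rparr>"

text \<open>Induction on the number of words left: the first draw is merged with the table of the
  remaining addresses. The rest of the stack is then executed for a fixed \<open>f\<close>.\<close>

lemma exec_random_fill:
  assumes "a \<le> e" "regs \<sigma> 5 = e" "regs \<sigma> 7 = a" "regs \<sigma> 8 = M" "regs \<sigma> 9 = 0"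
    "0 < M" "M < 2 ^ w" "e \<le> s" "e < 2 ^ w" "10 * (e - a) + 1 \<le> t"
  shows "exec s w t (random_fill # K) \<sigma> = bind_spmf (spmf_of_set ({a..<e} \<rightarrow>\<^sub>E {..<M}))
    (\<lambda>f. exec s w (t - (10 * (e - a) + 1)) K (filled a e f \<sigma>))"
  using assms
proof (induction "e - a" arbitrary: a \<sigma> t)
  case 0
  then obtain t' where "t = Suc t'" by (cases t) auto
  moreover have "filled a e f \<sigma> = \<sigma>" for f
    using 0 by (auto simp: filled_def intro!: state.equality)
  moreover have "{a..<e} \<rightarrow>\<^sub>E {..<M} = {\<lambda>_. undefined}" using 0 by simp
  ultimately show ?case using 0 by (simp add: random_fill_def spmf_of_set_singleton)
next
  case (Suc d)
  then have ae: "a < e" "d = e - Suc a" by auto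
  \<comment> \<open>One round takes 10 steps: the test, four \<open>Seq\<close>, four commands and
    the closing \<open>Skip\<close>.\<close>
  then obtain t' where t: "t = t' + 10" "10 * d + 1 \<le> t'"
    using Suc.prems(10) by (intro that[of "t - 10"]) auto
  define \<tau> where "\<tau> x = \<sigma>\<lparr>mem := (mem \<sigma>)(a := x), regs := (regs \<sigma>)(7 := Suc a)\<rparr>" for x
  \<comment> \<open>Register 9 was 0 before the round, so clearing it leaves no trace of the
    draw.\<close>
  have r: "(regs \<sigma>)(9 := 0, 7 := Suc a) = (regs \<sigma>)(7 := Suc a)" using Suc.prems(5) by auto
  have "exec s w t (random_fill # K) \<sigma> =
      bind_spmf (spmf_of_set {..<M}) (\<lambda>x. exec s w t' (random_fill # K) (\<tau> x))"
  proof -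
    have "exec s w t (random_fill # K) \<sigma> = bind_spmf (spmf_of_set {..<M})
      (\<lambda>x. bind_spmf (set_reg w 9 x \<sigma>) (\<lambda>\<sigma>'. exec s w (t' + 7)
        (block [Store (Reg 7) (Reg 9), Compute 9 Add (Imm 0) (Imm 0), Compute 7 Add (Reg 7) (Imm 1)] # random_fill # K) \<sigma>'))"
      using ae Suc.prems unfolding t random_fill_def
      by (simp add: numeral_eq_Suc map_spmf_conv_bind_spmf)
    also have "\<dots> = bind_spmf (spmf_of_set {..<M}) (\<lambda>x. exec s w t' (random_fill # K) (\<tau> x))"
      using ae Suc.prems r
      by (intro bind_spmf_cong refl)
        (simp add: numeral_eq_Suc set_reg_def store_def map_spmf_conv_bind_spmf \<tau>_def fun_upd_twist)
    finally show ?thesis .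
  qed
  also have "\<dots> = bind_spmf (spmf_of_set {..<M}) (\<lambda>x. bind_spmf (spmf_of_set ({Suc a..<e} \<rightarrow>\<^sub>E {..<M}))
      (\<lambda>f. exec s w (t' - (10 * d + 1)) K (filled (Suc a) e f (\<tau> x))))"
    using Suc.hyps(1)[OF ae(2)] Suc.prems t ae by (simp add: \<tau>_def)
  also have "\<dots> = bind_spmf (spmf_of_set {..<M}) (\<lambda>x. bind_spmf (spmf_of_set ({Suc a..<e} \<rightarrow>\<^sub>E {..<M}))
      (\<lambda>f. exec s w (t' - (10 * d + 1)) K (filled a e (f(a := x)) \<sigma>)))"
  proof -
    have "filled (Suc a) e f (\<tau> x) = filled a e (f(a := x)) \<sigma>" for f x
      using ae by (auto simp: filled_def \<tau>_def fun_eq_iff intro!: state.equality)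
    then show ?thesis by simp
  qed
  also have "\<dots> = bind_spmf (spmf_of_set ({a..<e} \<rightarrow>\<^sub>E {..<M}))
    (\<lambda>f. exec s w (t' - (10 * d + 1)) K (filled a e f \<sigma>))"
  proof -
    have "{a..<e} = insert a {Suc a..<e}" using ae by auto
    then show ?thesis using Suc.prems(6)
      by (simp add: spmf_of_set_PiE_insert map_spmf_conv_bind_spmf lessThan_empty_iff)
  qed
  also have "t' - (10 * d + 1) = t - (10 * (e - a) + 1)" using t ae by simp
  finally show ?case .
qed

lemma wp_Seq:
  assumes "wp s w c k (wp s w d l Q) \<sigma>" "Suc (k + l) \<le> m"
  shows "wp s w (Seq c d) m Q \<sigma>"
proof -
  obtain k1 \<sigma>1 k2 \<sigma>2 where "k1 \<le> k" "runs s w c \<sigma> k1 \<sigma>1" "k2 \<le> l" "runs s w d \<sigma>1 k2 \<sigma>2" "Q \<sigma>2"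
    using assms(1) by (auto simp: wp_def)
  then show ?thesis unfolding wp_def using assms(2)
    by (intro exI[of _ "Suc (k1 + k2)"] exI[of _ \<sigma>2]) (auto intro!: runs_then2)
qed

lemma wp_block_Cons:
  assumes "wp s w c k (wp s w (block cs) l Q) \<sigma>" "Suc (k + l) \<le> m"
  shows "wp s w (block (c # cs)) m Q \<sigma>"
  using wp_Seq[OF assms] by simp

lemma wp_block_Nil: "Q \<sigma> \<Longrightarrow> 1 \<le> m \<Longrightarrow> wp s w (block []) m Q \<sigma>"
  by (rule wp_vc) simp

lemma wp_block_Compute:
  assumes "wp s w (block cs) (m - 2) Q
      (\<sigma>\<lparr>regs := (regs \<sigma>)(r := binop_val f (operand_val x \<sigma>) (operand_val y \<sigma>))\<rparr>)"
    and "binop_val f (operand_val x \<sigma>) (operand_val y \<sigma>) < 2 ^ w" "2 \<le> m"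
  shows "wp s w (block (Compute r f x y # cs)) m Q \<sigma>"
  by (rule wp_block_Cons[where k = 1 and l = "m - 2"], rule wp_vc) (use assms in auto)

lemma wp_block_last: "wp s w c k Q \<sigma> \<Longrightarrow> k + 2 \<le> m \<Longrightarrow> wp s w (block [c]) m Q \<sigma>"
  by (rule wp_block_Cons[where l = 1], erule wp_mono[OF _ order.refl], rule wp_block_Nil) auto

text \<open>\<open>wp\<close> bounds time only from above, so the remaining budget \<open>t'\<close>
  is known only from below. This handles a deterministic prefix of a computation that goes on with
  random draws.\<close>

lemma exec_Seq_wp:
  assumes "wp s w c k Q \<sigma>" "Suc k \<le> t"
  obtains t' \<sigma>' where "t - Suc k \<le> t'" "Q \<sigma>'" "exec s w t (Seq c d # K) \<sigma> = exec s w t' (d # K) \<sigma>'"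
proof -
  obtain k' \<sigma>' where k: "k' \<le> k" "runs s w c \<sigma> k' \<sigma>'" "Q \<sigma>'" using assms(1) by (auto simp: wp_def)
  obtain u where u: "t = Suc u" using assms(2) by (cases t) auto
  show ?thesis
    using k u assms(2) by (intro that[of "u - k'" \<sigma>']) (auto simp: runs_def)
qed

text \<open>The update rule for pointers: on a tie the old pointer stays, which is still
  lowest.\<close>

lemma lowest_insert:
  assumes "lowest r S p"
  shows "lowest r (insert v S) (if r v < r p then v else p)"
  using assms by (auto simp: lowest_def)

section \<open>Initialization and stream processing\<close>

text \<open>Memory is a matrix of rows of \<open>n\<close> words, \<open>adr b v\<close> being the address of entry \<open>v\<close> of row \<open>b\<close>.
  Row 0 receives the output; for \<open>i < L\<close>, row \<open>1 + i\<close> holds the ranks and later the labels of copy \<open>i\<close>, row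
  \<open>1 + i + L\<close> its pointers, and rows \<open>1 + i + 2L\<close> and \<open>1 + i + 3L\<close> the heads and links of the lists of
  equally labelled vertices, where \<open>v + 1\<close> encodes \<open>v\<close> and 0 the empty list; row \<open>1 + 4L\<close> holds counters.
  Registers 3, 4, 5, 14, 20 hold \<open>n\<close>, \<open>L n\<close>, \<open>(L + 1) n\<close> and, after the stream, the address of the counters
  and \<open>3 L n\<close>.\<close>

locale layout =
  fixes n L s w :: nat
  assumes n_pos: "0 < n" and L_pos: "0 < L"
    and memory: "(4 * L + 2) * n \<le> s"
    and word: "1024 * ((L + 1)\<^sup>2 * (n + 1)\<^sup>2) \<le> 2 ^ w"
begin

definition adr :: "nat \<Rightarrow> nat \<Rightarrow> nat" where
  "adr b v = b * n + v"

text \<open>One polynomial inequality behind the overflow checks: \<open>L * L * n * n\<close> is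
  for the tags of the counters, \<open>L * n * n\<close> for the scores, \<open>L * n\<close> for
  the addresses and \<open>n * n\<close> for the ranks.\<close>

lemma word_bounds:
  "8 * (L * L * n * n) + 8 * (L * n * n) + 8 * (L * n) + 1000 * (n * n) + 8 * n + 8 * L + 8 < 2 ^ w"
proof -
  have "8 * (L * L * n * n) + 8 * (L * n * n) + 8 * (L * n) + 1000 * (n * n) + 8 * n + 8 * L + 8
     < 1024 * ((L + 1)\<^sup>2 * (n + 1)\<^sup>2)"
    by (simp add: power2_eq_square algebra_simps)
  then show ?thesis using word by linarith
qed

lemma adr_simps [simp]:
  "adr b v + L * n = adr (b + L) v"
  "adr b v + n = adr (Suc b) v"
  "adr b 0 + v = adr b v"
  "adr b v + L * n * 3 = adr (b + 3 * L) v"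
  by (simp_all add: adr_def algebra_simps)

text \<open>Row and column are quotient and remainder modulo \<open>n\<close>. As a simp rule this
  settles aliasing between rows.\<close>

lemma adr_eq_iff [simp]: "u < n \<Longrightarrow> v < n \<Longrightarrow> adr a u = adr b v \<longleftrightarrow> a = b \<and> u = v"
proof
  assume "u < n" "v < n" "adr a u = adr b v"
  then have "(u + a * n) div n = (v + b * n) div n" "(u + a * n) mod n = (v + b * n) mod n"
    by (simp_all add: adr_def add.commute)
  then show "a = b \<and> u = v" using \<open>u < n\<close> \<open>v < n\<close> by simp
qed auto

lemma adr_less: "u < n \<Longrightarrow> a < b \<Longrightarrow> adr a u < adr b v"
proof -
  assume "u < n" "a < b"
  then have "adr a u < Suc a * n" by (simp add: adr_def)
  also have "\<dots> \<le> b * n" using \<open>a < b\<close> by (intro mult_le_mono1) simp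
  also have "\<dots> \<le> adr b v" by (simp add: adr_def)
  finally show ?thesis .
qed

lemma adr_0_less_iff [simp]: "adr a 0 < adr b 0 \<longleftrightarrow> a < b"
  using n_pos by (simp add: adr_def)

lemma adr_less_s [simp]: "v < n \<Longrightarrow> b \<le> 4 * L + 1 \<Longrightarrow> adr b v < s"
  using adr_less[of v b "4 * L + 2" 0] memory by (simp add: adr_def)

lemma adr_less_word [simp]: "v \<le> n \<Longrightarrow> b \<le> 4 * L + 1 \<Longrightarrow> adr b v < 2 ^ w"
proof -
  assume "v \<le> n" "b \<le> 4 * L + 1"
  then have "adr b v \<le> (4 * L + 1) * n + n" unfolding adr_def by (intro add_mono mult_le_mono1) auto
  then show ?thesis using word_bounds by (simp add: algebra_simps)
qed

lemma less_n_word [simp]: "v \<le> n \<Longrightarrow> v < 2 ^ w" "v < n \<Longrightarrow> v < 2 ^ w" "v < n \<Longrightarrow> Suc v < 2 ^ w" 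
  using word_bounds by simp_all

lemma Ln_word [simp]: "L * n < 2 ^ w" "L * n * 3 < 2 ^ w" "L * n * 4 < 2 ^ w" "L < 2 ^ w"
  using word_bounds by simp_all

definition regs_ok :: "state \<Rightarrow> bool" where
  "regs_ok \<sigma> \<longleftrightarrow> regs \<sigma> 3 = n \<and> regs \<sigma> 4 = L * n \<and> regs \<sigma> 5 = adr (Suc L) 0"

text \<open>\<open>Nb i v\<close> is the part of the closed neighbourhood of \<open>v\<close> that
  copy \<open>i\<close> has seen; it depends on \<open>i\<close> because within one edge the copies
  are updated one after another. The zero region later serves as empty lists and zero
  counters.\<close>

definition stream_inv :: "(nat \<Rightarrow> nat) \<Rightarrow> (nat \<Rightarrow> nat \<Rightarrow> nat set) \<Rightarrow> state \<Rightarrow> bool" where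
  "stream_inv f Nb \<sigma> \<longleftrightarrow> regs_ok \<sigma> \<and>
     (\<forall>i<L. \<forall>v<n. mem \<sigma> (adr (Suc i) v) = f (adr (Suc i) v) \<and>
        lowest (\<lambda>u. f (adr (Suc i) u)) (Nb i v) (mem \<sigma> (adr (Suc (i + L)) v))) \<and>
     (\<forall>x. adr (Suc (2 * L)) 0 \<le> x \<longrightarrow> mem \<sigma> x = 0)"

end

section \<open>Programs for the start and for one edge\<close>

text \<open>An address modulo \<open>n\<close> is its vertex, so every pointer starts at its own
  vertex.\<close>

definition init_com :: com where
  "init_com = While Less (Reg 7) (Reg 5) (block
     [Compute 9 Mod (Reg 7) (Reg 3), Compute 10 Add (Reg 7) (Reg 4), Store (Reg 10) (Reg 9),
      Compute 7 Add (Reg 7) (Imm 1)])"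

text \<open>The machine has no logarithm, so \<open>L = 1 + c * log_ceil n\<close> is obtained by
  repeated doubling; \<open>c\<close> enters as a constant of the program.\<close>

definition prep_com :: "nat \<Rightarrow> com" where
  "prep_com c = block
    [Compute 3 Add (Reg 0) (Imm 0), Compute 7 Add (Imm 1) (Imm 0), Compute 6 Add (Imm 1) (Imm 0),
     While Less (Reg 7) (Reg 3) (block [Compute 7 Add (Reg 7) (Reg 7), Compute 6 Add (Reg 6) (Imm c)]),
     Compute 4 Mul (Reg 6) (Reg 3), Compute 5 Add (Reg 4) (Reg 3),
     Compute 8 Mul (Reg 3) (Reg 3), Compute 8 Mul (Reg 8) (Imm 512), Compute 7 Add (Reg 3) (Imm 0)]"

definition start_com :: "nat \<Rightarrow> com" where
  "start_com c = Seq (prep_com c) (Seq random_fill (block [Compute 7 Add (Reg 3) (Imm 0), init_com]))"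

text \<open>Register 7 holds the start of the rank row of the current copy, \<open>L\<close> rows
  before its pointer row. The pointer of the vertex in register \<open>r\<close> is compared with
  the vertex in register \<open>q\<close>.\<close>

definition half_edge :: "nat \<Rightarrow> nat \<Rightarrow> com" where
  "half_edge r q = block
    [Compute 9 Add (Reg 7) (Reg r), Compute 9 Add (Reg 9) (Reg 4), Load 10 (Reg 9),
     Compute 10 Add (Reg 7) (Reg 10), Load 10 (Reg 10),
     Compute 11 Add (Reg 7) (Reg q), Load 11 (Reg 11),
     Branch Less (Reg 11) (Reg 10) (Store (Reg 9) (Reg q)) Skip]"

definition edge_com :: com where
  "edge_com = Branch Equal (Reg 2) (Imm 1)
     (block [Compute 7 Add (Reg 3) (Imm 0), While Less (Reg 7) (Reg 5)
       (block [half_edge 0 1, half_edge 1 0, Compute 7 Add (Reg 7) (Reg 3)])])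
     Skip"

definition log_ceil :: "nat \<Rightarrow> nat" where
  "log_ceil n = (LEAST k. n \<le> 2 ^ k)"

lemma log_ceil: "n \<le> 2 ^ log_ceil n" "k < log_ceil n \<Longrightarrow> 2 ^ k < n" "log_ceil n \<le> n"
proof -
  have "n \<le> 2 ^ n" by (simp add: less_exp less_imp_le)
  then show "n \<le> 2 ^ log_ceil n" "log_ceil n \<le> n"
    unfolding log_ceil_def by (rule LeastI, rule Least_le)
  show "k < log_ceil n \<Longrightarrow> 2 ^ k < n"
    unfolding log_ceil_def using not_less_Least by force
qed

text \<open>The summand 1 keeps \<open>L\<close> positive for \<open>n = 1\<close> or
  \<open>c = 0\<close>; the other one gives \<open>n ^ c \<le> 2 ^ L\<close>.\<close>

definition copies :: "nat \<Rightarrow> nat \<Rightarrow> nat" where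
  "copies c n = 1 + c * log_ceil n"

context layout
begin

lemma wp_prep:
  assumes "L = copies c n"
  shows "wp s w (prep_com c) (5 + 6 * n + 40) (\<lambda>\<sigma>. regs_ok \<sigma> \<and> regs \<sigma> 7 = n \<and> regs \<sigma> 8 = 512 * n\<^sup>2 \<and>
    regs \<sigma> 9 = 0 \<and> mem \<sigma> = (\<lambda>_. 0)) (start_state n)"
proof -
  let ?I = "\<lambda>k (\<sigma>::state). regs \<sigma> 3 = n \<and> regs \<sigma> 7 = 2 ^ k \<and> regs \<sigma> 6 = 1 + c * k \<and> regs \<sigma> 9 = 0 \<and> mem \<sigma> = (\<lambda>_. 0)"
  let ?B = "block [Compute 7 Add (Reg 7) (Reg 7), Compute 6 Add (Reg 6) (Imm c)]"
  let ?E = "block [Compute 4 Mul (Reg 6) (Reg 3), Compute 5 Add (Reg 4) (Reg 3),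
     Compute 8 Mul (Reg 3) (Reg 3), Compute 8 Mul (Reg 8) (Imm 512), Compute 7 Add (Reg 3) (Imm 0)]"
  let ?Q = "\<lambda>\<sigma>::state. regs_ok \<sigma> \<and> regs \<sigma> 7 = n \<and> regs \<sigma> 8 = 512 * n\<^sup>2 \<and> regs \<sigma> 9 = 0 \<and> mem \<sigma> = (\<lambda>_. 0)"
  have E: "wp s w ?E 15 ?Q \<sigma>" if "?I (log_ceil n) \<sigma>" for \<sigma>
  proof -
    have "regs \<sigma> 6 = L" "regs \<sigma> 3 = n" "regs \<sigma> 9 = 0" "mem \<sigma> = (\<lambda>_. 0)"
      using that assms by (simp_all add: copies_def)
    then show ?thesis using word_bounds
      by (intro wp_vc) (simp add: regs_ok_def adr_def power2_eq_square)
  qed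
  have loop: "wp s w (While Less (Reg 7) (Reg 3) ?B) (6 * n + 1) (wp s w ?E 15 ?Q) \<sigma>" if "?I 0 \<sigma>" for \<sigma>
  proof (rule wp_for[where I = ?I and m = "log_ceil n" and b = "\<lambda>_. 5"])
    fix k \<sigma> assume k: "k < log_ceil n" "?I k \<sigma>"
    \<comment> \<open>The register is below \<open>n\<close> before it is doubled, so it stays below
      \<open>2 * n\<close>.\<close>
    have "2 * 2 ^ k < (2::nat) ^ w" using log_ceil(2)[OF k(1)] word_bounds by linarith
    moreover have "1 + c * Suc k \<le> L" unfolding assms copies_def using k(1)
      by (intro add_left_mono mult_le_mono2) simp
    then have "1 + c * Suc k < 2 ^ w" using word_bounds by linarith
    ultimately show "cmpop_val Less (operand_val (Reg 7) \<sigma>) (operand_val (Reg 3) \<sigma>) \<and> wp s w ?B 5 (?I (Suc k)) \<sigma>"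
      using k(2) log_ceil(2)[OF k(1)] by (intro conjI wp_vc) (simp_all add: algebra_simps mult_2)
  next
    fix \<sigma> assume "?I (log_ceil n) \<sigma>"
    then show "\<not> cmpop_val Less (operand_val (Reg 7) \<sigma>) (operand_val (Reg 3) \<sigma>) \<and> wp s w ?E 15 ?Q \<sigma>"
      using log_ceil(1)[of n] E by simp
  qed (use that log_ceil(3)[of n] in auto)
  have one: "Suc 0 < 2 ^ w" using word_bounds by linarith
  show ?thesis unfolding prep_com_def
    by (intro wp_block_Compute wp_block_Cons[OF loop]) (auto simp: start_state_def one)
qed

lemma wp_init:
  assumes "regs_ok \<sigma>" and f: "\<And>x. n \<le> x \<Longrightarrow> x < adr (Suc L) 0 \<Longrightarrow> mem \<sigma> x = f x"
    and zero: "\<And>x. adr (Suc L) 0 \<le> x \<Longrightarrow> mem \<sigma> x = 0"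
  shows "wp s w (block [Compute 7 Add (Reg 3) (Imm 0), init_com]) (10 * (L * n) + 10)
    (stream_inv f (\<lambda>i v. {v})) \<sigma>"
proof -
  let ?I = "\<lambda>k (\<sigma>::state). regs_ok \<sigma> \<and> regs \<sigma> 7 = n + k \<and> (\<forall>x. n \<le> x \<and> x < adr (Suc L) 0 \<longrightarrow> mem \<sigma> x = f x) \<and>
    (\<forall>x<k. mem \<sigma> (n + x + L * n) = x mod n) \<and> (\<forall>x. adr (Suc (2 * L)) 0 \<le> x \<longrightarrow> mem \<sigma> x = 0)"
  have done_inv: "stream_inv f (\<lambda>i v. {v}) \<sigma>" if I: "?I (L * n) \<sigma>" for \<sigma>
    unfolding stream_inv_def
  proof (intro conjI allI impI)
    fix i v assume iv: "i < L" "v < n"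
    have "adr (Suc i) v < adr (Suc L) 0" using iv by (intro adr_less) auto
    moreover have "n \<le> adr (Suc i) v" by (simp add: adr_def)
    ultimately show "mem \<sigma> (adr (Suc i) v) = f (adr (Suc i) v)" using I by blast
    have "adr i v < adr L 0" using iv by (intro adr_less) auto
    then have "mem \<sigma> (n + adr i v + L * n) = adr i v mod n" using I by (simp add: adr_def)
    moreover have "n + adr i v + L * n = adr (Suc (i + L)) v" by (simp add: adr_def algebra_simps)
    moreover have "adr i v mod n = v" using iv by (simp add: adr_def)
    ultimately show "lowest (\<lambda>u. f (adr (Suc i) u)) {v} (mem \<sigma> (adr (Suc (i + L)) v))"
      by (simp add: lowest_def)
  qed (use I in auto)
  have "wp s w init_com (10 * (L * n) + 1) (stream_inv f (\<lambda>i v. {v})) \<sigma>" if "?I 0 \<sigma>" for \<sigma>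
    unfolding init_com_def
  proof (rule wp_for[where I = ?I and m = "L * n" and b = "\<lambda>_. 9"])
    fix k \<sigma> assume k: "k < L * n" "?I k \<sigma>"
    have 1: "adr (Suc L) 0 = n + L * n" "adr (Suc (2 * L)) 0 = n + L * n + L * n" by (simp_all add: adr_def algebra_simps)
    have 2: "n + k + L * n < s" "n + k + L * n < 2 ^ w" "(n + k) mod n = k mod n" "k mod n < 2 ^ w"
      "n + k < 2 ^ w" "Suc (n + k) < 2 ^ w"
      using k(1) memory word_bounds n_pos mod_less_divisor[OF n_pos, of k]
      by (auto simp: algebra_simps)
    show "cmpop_val Less (operand_val (Reg 7) \<sigma>) (operand_val (Reg 5) \<sigma>) \<and> wp s w (block
     [Compute 9 Mod (Reg 7) (Reg 3), Compute 10 Add (Reg 7) (Reg 4), Store (Reg 10) (Reg 9),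
      Compute 7 Add (Reg 7) (Imm 1)]) 9 (?I (Suc k)) \<sigma>"
      using k 2 by (intro conjI wp_vc) (auto simp: regs_ok_def 1 less_Suc_eq)
  qed (use that done_inv in \<open>auto simp: regs_ok_def adr_def\<close>)
  note loop = this
  have "?I 0 (\<sigma>\<lparr>regs := (regs \<sigma>)(7 := n)\<rparr>)"
  proof -
    have "adr (Suc L) 0 \<le> adr (Suc (2 * L)) 0" by (simp add: adr_def)
    then show ?thesis using assms by (auto simp: regs_ok_def)
  qed
  note L0 = loop[OF this]
  show ?thesis
    by (rule wp_block_Compute, rule wp_block_last)
      (use L0 assms(1) in \<open>auto simp: regs_ok_def\<close>)
qed

lemma wp_half_edge:
  assumes "regs_ok \<sigma>" "regs \<sigma> 7 = adr (Suc k) 0" "k < L" "r < 3" "q < 3"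
    "regs \<sigma> r = u" "regs \<sigma> q = v" "u < n" "v < n"
    "mem \<sigma> (adr (Suc (k + L)) u) = p" "p < n"
    "\<And>x. x < n \<Longrightarrow> mem \<sigma> (adr (Suc k) x) < 2 ^ w"
  shows "wp s w (half_edge r q) 30 (\<lambda>\<sigma>'. (\<forall>r. r \<notin> {9, 10, 11} \<longrightarrow> regs \<sigma>' r = regs \<sigma> r) \<and>
     mem \<sigma>' = (mem \<sigma>)(adr (Suc (k + L)) u :=
       if mem \<sigma> (adr (Suc k) v) < mem \<sigma> (adr (Suc k) p) then v else p)) \<sigma>"
  unfolding half_edge_def using assms
  by (intro wp_vc) (auto simp: regs_ok_def)

lemma wp_edge_plus:
  assumes inv: "stream_inv f Nb \<sigma>" and f: "\<And>x. n \<le> x \<Longrightarrow> x < adr (Suc L) 0 \<Longrightarrow> f x < 2 ^ w"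
    and Nb: "\<And>i x. x < n \<Longrightarrow> Nb i x \<subseteq> {..<n}"
    and uv: "regs \<sigma> 0 = u" "regs \<sigma> 1 = v" "u < n" "v < n" "u \<noteq> v"
  defines "Nb' \<equiv> \<lambda>i. (Nb i)(u := insert v (Nb i u), v := insert u (Nb i v))"
  shows "wp s w (block [Compute 7 Add (Reg 3) (Imm 0), While Less (Reg 7) (Reg 5)
       (block [half_edge 0 1, half_edge 1 0, Compute 7 Add (Reg 7) (Reg 3)])]) (80 * L + 10) (stream_inv f Nb') \<sigma>"
proof -
  let ?B = "block [half_edge 0 1, half_edge 1 0, Compute 7 Add (Reg 7) (Reg 3)]"
  \<comment> \<open>Copies before \<open>k\<close> already know the new edge, the others do
    not.\<close>
  let ?N = "\<lambda>k i. if i < k then Nb' i else Nb i"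
  let ?I = "\<lambda>k (\<sigma>::state). stream_inv f (?N k) \<sigma> \<and> regs \<sigma> 7 = adr (Suc k) 0 \<and> regs \<sigma> 0 = u \<and> regs \<sigma> 1 = v"
  have loop: "wp s w (While Less (Reg 7) (Reg 5) ?B) (80 * L + 1) (stream_inv f Nb') \<sigma>" if "?I 0 \<sigma>" for \<sigma>
  proof (rule wp_for[where I = ?I and m = L and b = "\<lambda>_. 79"])
    fix k \<sigma> assume k: "k < L" "?I k \<sigma>"
    define r where "r = (\<lambda>x. f (adr (Suc k) x))"
    define pu where "pu = mem \<sigma> (adr (Suc (k + L)) u)"
    define pv where "pv = mem \<sigma> (adr (Suc (k + L)) v)"
    have R: "mem \<sigma> (adr (Suc k) x) = r x" "r x < 2 ^ w" if "x < n" for x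
    proof -
      show "mem \<sigma> (adr (Suc k) x) = r x" using k that by (simp add: stream_inv_def r_def)
      show "r x < 2 ^ w" unfolding r_def
        by (rule f) (use k that adr_less[of x "Suc k" "Suc L" 0] in \<open>auto simp: adr_def\<close>)
    qed
    have low: "lowest r (Nb k u) pu" "lowest r (Nb k v) pv"
      using k uv by (auto simp: stream_inv_def r_def pu_def pv_def)
    then have p: "pu < n" "pv < n" using Nb[OF uv(3), of k] Nb[OF uv(4), of k] by (auto simp: lowest_def)
    define pu' where "pu' = (if r v < r pu then v else pu)"
    define pv' where "pv' = (if r u < r pv then u else pv)"
    have low': "lowest r (insert v (Nb k u)) pu'" "lowest r (insert u (Nb k v)) pv'"
      unfolding pu'_def pv'_def by (rule lowest_insert[OF low(1)], rule lowest_insert[OF low(2)])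
    let ?S1 = "\<lambda>\<sigma>'. (\<forall>r. r \<notin> {9, 10, 11} \<longrightarrow> regs \<sigma>' r = regs \<sigma> r) \<and>
       mem \<sigma>' = (mem \<sigma>)(adr (Suc (k + L)) u := pu')"
    let ?S2 = "\<lambda>\<sigma>'. (\<forall>r. r \<notin> {9, 10, 11} \<longrightarrow> regs \<sigma>' r = regs \<sigma> r) \<and>
       mem \<sigma>' = (mem \<sigma>)(adr (Suc (k + L)) u := pu', adr (Suc (k + L)) v := pv')"
    have reg: "regs_ok \<sigma>" "regs \<sigma> 7 = adr (Suc k) 0" "regs \<sigma> 0 = u" "regs \<sigma> 1 = v"
      using k(2) by (auto simp: stream_inv_def)
    have S1: "wp s w (half_edge 0 1) 30 ?S1 \<sigma>"
      using wp_half_edge[of \<sigma> k 0 1 u v pu] reg k(1) uv R p by (simp add: pu_def[symmetric] pu'_def)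
    \<comment> \<open>The second half finds the pointer of \<open>v\<close> untouched, since
      \<open>u \<noteq> v\<close> have separate words.\<close>
    have S2: "wp s w (half_edge 1 0) 30 ?S2 \<sigma>'" if "?S1 \<sigma>'" for \<sigma>'
    proof -
      have m: "mem \<sigma>' (adr (Suc k) x) = r x" if "x < n" for x
        using \<open>?S1 \<sigma>'\<close> that uv L_pos R(1) by simp
      have "mem \<sigma>' (adr (Suc (k + L)) v) = pv" using that uv by (simp add: pv_def)
      then have "wp s w (half_edge 1 0) 30 (\<lambda>\<tau>. (\<forall>r. r \<notin> {9, 10, 11} \<longrightarrow> regs \<tau> r = regs \<sigma>' r) \<and>
          mem \<tau> = (mem \<sigma>')(adr (Suc (k + L)) v := pv')) \<sigma>'"
        using wp_half_edge[of \<sigma>' k 1 0 v u pv] that reg k(1) uv R(2) p m by (simp add: pv'_def regs_ok_def)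
      then show ?thesis by (rule wp_mono) (use that in auto)
    qed
    have S3: "wp s w (block [Compute 7 Add (Reg 7) (Reg 3)]) 5 (?I (Suc k)) \<sigma>'" if S: "?S2 \<sigma>'" for \<sigma>'
    proof -
      have "stream_inv f (?N (Suc k)) \<sigma>'"
        unfolding stream_inv_def
      proof (intro conjI allI impI)
        show "regs_ok \<sigma>'" using S reg by (simp add: regs_ok_def)
      next
        fix x assume "adr (Suc (2 * L)) 0 \<le> x"
        moreover have "adr (Suc (k + L)) u < adr (Suc (2 * L)) 0" "adr (Suc (k + L)) v < adr (Suc (2 * L)) 0"
          using uv k by (auto intro!: adr_less)
        ultimately show "mem \<sigma>' x = 0" using S k(2) by (auto simp: stream_inv_def)
      next
        fix i x assume ix: "i < L" "x < n"
        show "mem \<sigma>' (adr (Suc i) x) = f (adr (Suc i) x)" using S k ix uv by (auto simp: stream_inv_def)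
        show "lowest (\<lambda>u. f (adr (Suc i) u)) (?N (Suc k) i x) (mem \<sigma>' (adr (Suc (i + L)) x))"
        proof (cases "i = k")
          case True
          then show ?thesis using S k ix uv low' by (auto simp: Nb'_def r_def[symmetric] stream_inv_def)
        next
          case False
          then have "lowest (\<lambda>u. f (adr (Suc i) u)) (?N k i x) (mem \<sigma> (adr (Suc (i + L)) x))"
            using k(2) ix by (simp only: stream_inv_def)
          moreover have "mem \<sigma>' (adr (Suc (i + L)) x) = mem \<sigma> (adr (Suc (i + L)) x)"
            using S False ix uv by simp
          moreover have "?N (Suc k) i = ?N k i" using False by auto
          ultimately show ?thesis by simp
        qed
      qed
      then show ?thesis using S reg k(1) by (intro wp_vc) (simp add: stream_inv_def regs_ok_def)
    qed
    have "wp s w ?B 79 (?I (Suc k)) \<sigma>"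
      by (rule wp_block_Cons[OF wp_mono[OF S1 order.refl]], rule wp_block_Cons[OF wp_mono[OF S2 order.refl]],
          assumption, rule S3, assumption, rule order.refl, simp)
    then show "cmpop_val Less (operand_val (Reg 7) \<sigma>) (operand_val (Reg 5) \<sigma>) \<and> wp s w ?B 79 (?I (Suc k)) \<sigma>"
      using k by (simp add: stream_inv_def regs_ok_def)
  next
    fix \<sigma> assume I: "?I L \<sigma>"
    then have "stream_inv f Nb' \<sigma>" by (simp add: stream_inv_def)
    then show "\<not> cmpop_val Less (operand_val (Reg 7) \<sigma>) (operand_val (Reg 5) \<sigma>) \<and> stream_inv f Nb' \<sigma>"
      using I by (simp add: stream_inv_def regs_ok_def)
  qed (use that in auto)
  have n1: "n = adr (Suc 0) 0" by (simp add: adr_def)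
  have "?I 0 (\<sigma>\<lparr>regs := (regs \<sigma>)(7 := n)\<rparr>)"
    using inv uv n1 by (simp add: stream_inv_def regs_ok_def)
  note L0 = loop[OF this]
  show ?thesis
    by (rule wp_block_Compute, rule wp_block_last)
      (use L0 inv in \<open>auto simp: stream_inv_def regs_ok_def\<close>)
qed

end

section \<open>Post-processing\<close>

fun linked :: "(nat \<Rightarrow> nat) \<Rightarrow> nat \<Rightarrow> nat list \<Rightarrow> bool" where
  "linked nx h [] \<longleftrightarrow> h = 0"
| "linked nx h (v # vs) \<longleftrightarrow> h = Suc v \<and> linked nx (nx v) vs"

lemma linked_cong: "(\<And>v. v \<in> set vs \<Longrightarrow> nx v = nx' v) \<Longrightarrow> linked nx h vs \<longleftrightarrow> linked nx' h vs"
  by (induction vs arbitrary: h) auto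

text \<open>Labels of different clusters do not collide: a vertex left alone does not point to
  itself, so it is not the pivot of any other vertex.\<close>

definition cluster_label :: "(nat \<Rightarrow> nat) \<Rightarrow> nat \<Rightarrow> nat" where
  "cluster_label F v = (if F (F v) = F v then F v else v)"

text \<open>Reversed because each vertex is pushed onto the front of its list.\<close>

definition group_list :: "(nat \<Rightarrow> nat) \<Rightarrow> nat \<Rightarrow> nat \<Rightarrow> nat list" where
  "group_list l m p = rev (filter (\<lambda>v. l v = p) [0..<m])"

lemma set_group_list [simp]: "set (group_list l m p) = {v. v < m \<and> l v = p}"
  by (auto simp: group_list_def)

lemma group_list_Suc: "group_list l (Suc m) p = (if l m = p then m # group_list l m p else group_list l m p)"
  by (simp add: group_list_def)

lemma distinct_group_list [simp]: "distinct (group_list l m p)"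
  by (simp add: group_list_def)

lemma length_group_list: "length (group_list l m p) = card {v. v < m \<and> l v = p}"
  by (metis distinct_card distinct_group_list set_group_list)

text \<open>The summand \<open>n\<close> keeps the truncated subtraction exact; summed over all vertices it is a constant.\<close>

fun walk_score :: "nat \<Rightarrow> (nat \<Rightarrow> nat) \<Rightarrow> (nat \<Rightarrow> nat) \<Rightarrow> nat \<Rightarrow> nat list \<Rightarrow> nat" where
  "walk_score n l c k [] = 0"
| "walk_score n l c k (v # vs) = (n + 2 * c (l v) - k) + walk_score n l (c(l v := Suc (c (l v)))) (Suc k) vs"

lemma walk_score_le:
  "(\<And>b. b \<in> l ` set vs \<Longrightarrow> c b + length vs \<le> n) \<Longrightarrow> walk_score n l c k vs \<le> 3 * n * length vs"
proof (induction vs arbitrary: c k)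
  case (Cons v vs)
  have "walk_score n l (c(l v := Suc (c (l v)))) (Suc k) vs \<le> 3 * n * length vs"
    using Cons.prems by (intro Cons.IH) fastforce
  moreover have "c (l v) \<le> n" using Cons.prems[of "l v"] by simp
  ultimately show ?case by simp
qed simp

text \<open>Starting from zero counters, \<open>c\<close> counts the earlier vertices of each label
  and \<open>k\<close> all earlier ones, so the total counts every pair with equal label twice and
  subtracts every pair once. The additive form avoids subtraction;
  \<open>k + length vs \<le> n\<close> keeps the one in \<open>walk_score\<close> exact.\<close>

lemma walk_score_eq:
  assumes "distinct vs" "k + length vs \<le> n"
  shows "2 * walk_score n l c k vs + 2 * k * length vs + (length vs)\<^sup>2 + length vs
    = 2 * n * length vs + 4 * (\<Sum>v\<in>set vs. c (l v)) + 2 * (\<Sum>u\<in>set vs. \<Sum>v\<in>set vs. of_bool (l u = l v))"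
  using assms
proof (induction vs arbitrary: c k)
  case (Cons v vs)
  define q :: nat where "q = (\<Sum>u\<in>set vs. of_bool (l u = l v))"
  have v: "v \<notin> set vs" using Cons.prems by simp
  let ?c = "c(l v := Suc (c (l v)))"
  have "?c b = c b + of_bool (b = l v)" for b by simp
  then have c: "(\<Sum>u\<in>set vs. ?c (l u)) = (\<Sum>u\<in>set vs. c (l u)) + q"
    by (simp only: sum.distrib q_def)
  have "(\<Sum>u\<in>set vs. of_bool (l v = l u)) = q" unfolding q_def by (simp only: eq_commute)
  \<comment> \<open>The \<open>q\<close> later vertices with the label of \<open>v\<close> form
    \<open>2 * q\<close> ordered pairs with it, besides the diagonal pair; the raised counter
    contributes the same \<open>q\<close>.\<close>
  then have same: "(\<Sum>u\<in>set (v # vs). \<Sum>x\<in>set (v # vs). of_bool (l u = l x) :: nat)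
      = 1 + 2 * q + (\<Sum>u\<in>set vs. \<Sum>x\<in>set vs. of_bool (l u = l x))"
    using v by (simp add: sum.distrib q_def del: sum_of_bool_eq)
  have "2 * walk_score n l ?c (Suc k) vs + 2 * Suc k * length vs + (length vs)\<^sup>2 + length vs
    = 2 * n * length vs + 4 * ((\<Sum>u\<in>set vs. c (l u)) + q) + 2 * (\<Sum>u\<in>set vs. \<Sum>x\<in>set vs. of_bool (l u = l x))"
  proof -
    have "distinct vs" "Suc k + length vs \<le> n" using Cons.prems by auto
    from Cons.IH[OF this, of ?c] show ?thesis unfolding c .
  qed
  moreover have "walk_score n l c k (v # vs) + k = n + 2 * c (l v) + walk_score n l ?c (Suc k) vs"
    using Cons.prems by simp
  ultimately show ?case unfolding same using v
    by (simp add: power2_eq_square algebra_simps)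
qed simp

definition same_pairs :: "nat \<Rightarrow> (nat \<Rightarrow> nat) \<Rightarrow> (nat \<Rightarrow> nat) \<Rightarrow> nat" where
  "same_pairs n l l' = (\<Sum>u<n. \<Sum>v<n. of_bool (l u = l v \<and> l' u = l' v))"

definition pair_score :: "nat \<Rightarrow> (nat \<Rightarrow> nat) \<Rightarrow> (nat \<Rightarrow> nat) \<Rightarrow> nat" where
  "pair_score n l l' = (\<Sum>p<n. walk_score n l' (\<lambda>_. 0) 0 (group_list l n p))"

lemma sum_group_pairs:
  fixes h :: "nat \<Rightarrow> nat \<Rightarrow> nat"
  assumes "\<And>v. v < n \<Longrightarrow> l v < n"
  shows "(\<Sum>p<n. \<Sum>u\<in>{v. v < n \<and> l v = p}. \<Sum>v\<in>{v. v < n \<and> l v = p}. h u v)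
    = (\<Sum>u<n. \<Sum>v<n. of_bool (l u = l v) * h u v)"
proof -
  have "(\<Sum>p<n. \<Sum>u\<in>{v. v < n \<and> l v = p}. \<Sum>v\<in>{v. v < n \<and> l v = p}. h u v)
      = (\<Sum>p<n. \<Sum>u\<in>{v \<in> {..<n}. l v = p}. \<Sum>v<n. of_bool (l u = l v) * h u v)"
    by (intro sum.cong refl sum.mono_neutral_cong_left) auto
  also have "\<dots> = (\<Sum>u<n. \<Sum>v<n. of_bool (l u = l v) * h u v)"
    using assms by (intro sum.group) auto
  finally show ?thesis .
qed

lemma sum_length_group_list:
  assumes "\<And>v. v < n \<Longrightarrow> l v < n"
  shows "(\<Sum>p<n. length (group_list l n p)) = n"
proof -
  have "(\<Sum>p<n. length (group_list l n p)) = (\<Sum>p<n. \<Sum>u\<in>{v \<in> {..<n}. l v = p}. 1)"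
    by (simp add: length_group_list)
  also have "\<dots> = (\<Sum>u<n. 1)" using assms by (intro sum.group) auto
  finally show ?thesis by simp
qed

lemma length_group_list_le: "length (group_list l n p) \<le> n"
  using card_mono[of "{..<n}" "{v. v < n \<and> l v = p}"] by (auto simp: length_group_list)

lemma pair_score_le:
  assumes "\<And>v. v < n \<Longrightarrow> l v < n"
  shows "pair_score n l l' \<le> 3 * n * n"
proof -
  have "pair_score n l l' \<le> (\<Sum>p<n. 3 * n * length (group_list l n p))"
    unfolding pair_score_def by (intro sum_mono walk_score_le) (simp add: length_group_list_le)
  also have "\<dots> = 3 * n * n" using sum_length_group_list[of n l, OF assms] by (simp add: sum_distrib_left[symmetric])
  finally show ?thesis .
qed

text \<open>The lists partition the vertices, so a score is a sum over vertices although it counts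
  pairs. The squared list lengths add up to \<open>same_pairs n l l\<close>.\<close>

lemma pair_score_eq:
  assumes "\<And>v. v < n \<Longrightarrow> l v < n"
  shows "2 * pair_score n l l' + same_pairs n l l + n = 2 * n * n + 2 * same_pairs n l l'"
proof -
  let ?S = "\<lambda>p. {v. v < n \<and> l v = p}"
  have "2 * walk_score n l' (\<lambda>_. 0) 0 (group_list l n p) + (length (group_list l n p))\<^sup>2 + length (group_list l n p)
     = 2 * n * length (group_list l n p) + 2 * (\<Sum>u\<in>?S p. \<Sum>v\<in>?S p. of_bool (l' u = l' v))" for p
    using walk_score_eq[of "group_list l n p" 0 n l' "\<lambda>_. 0"] length_group_list_le[of l n p] by simp
  then have "(\<Sum>p<n. 2 * walk_score n l' (\<lambda>_. 0) 0 (group_list l n p) + (length (group_list l n p))\<^sup>2 + length (group_list l n p))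
     = (\<Sum>p<n. 2 * n * length (group_list l n p) + 2 * (\<Sum>u\<in>?S p. \<Sum>v\<in>?S p. of_bool (l' u = l' v)))"
    by simp
  then have "2 * pair_score n l l' + (\<Sum>p<n. (length (group_list l n p))\<^sup>2) + n
     = 2 * n * n + 2 * (\<Sum>p<n. \<Sum>u\<in>?S p. \<Sum>v\<in>?S p. of_bool (l' u = l' v))"
    using sum_length_group_list[of n l, OF assms] by (simp add: sum.distrib sum_distrib_left[symmetric] pair_score_def)
  moreover have "(\<Sum>p<n. (length (group_list l n p))\<^sup>2) = same_pairs n l l"
    using sum_group_pairs[of n l "\<lambda>_ _. 1", OF assms]
    by (simp add: same_pairs_def length_group_list power2_eq_square)
  moreover have "(\<Sum>p<n. \<Sum>u\<in>?S p. \<Sum>v\<in>?S p. of_bool (l' u = l' v)) = same_pairs n l l'"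
    using sum_group_pairs[of n l "\<lambda>u v. of_bool (l' u = l' v)", OF assms]
    by (simp add: same_pairs_def of_bool_conj)
  ultimately show ?thesis by simp
qed

definition label_rel :: "(nat \<Rightarrow> nat) \<Rightarrow> nat \<Rightarrow> nat \<Rightarrow> bool" where
  "label_rel l u v \<longleftrightarrow> l u = l v"

text \<open>The size of a symmetric difference: both sizes minus twice the common part.\<close>

lemma rel_dist_same_pairs:
  "rel_dist {..<n} (label_rel l) (label_rel l') + 2 * same_pairs n l l' = same_pairs n l l + same_pairs n l' l'"
  unfolding rel_dist_sum[OF finite_lessThan] same_pairs_def sum_distrib_left sum.distrib[symmetric]
  by (intro sum.cong refl) (simp add: label_rel_def)

text \<open>Twice the total score of copy \<open>k\<close> plus its total distance is the same
  number for all \<open>k\<close>, because \<open>same_pairs n (l k) (l k)\<close> cancels. So the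
  highest score belongs to a one-median.\<close>

lemma score_max_dist_min:
  fixes L n :: nat
  assumes l: "\<And>i v. i < L \<Longrightarrow> v < n \<Longrightarrow> l i v < n" and "m < L" "i < L"
    and "(\<Sum>j<L. pair_score n (l i) (l j)) \<le> (\<Sum>j<L. pair_score n (l m) (l j))"
  shows "(\<Sum>j<L. rel_dist {..<n} (label_rel (l m)) (label_rel (l j)))
    \<le> (\<Sum>j<L. rel_dist {..<n} (label_rel (l i)) (label_rel (l j)))"
proof -
  have "(\<Sum>j<L. rel_dist {..<n} (label_rel (l k)) (label_rel (l j))) + 2 * (\<Sum>j<L. pair_score n (l k) (l j)) + L * n
      = (\<Sum>j<L. same_pairs n (l j) (l j)) + 2 * n * n * L" if "k < L" for k
  proof -
    have "(\<Sum>j<L. rel_dist {..<n} (label_rel (l k)) (label_rel (l j)) + 2 * pair_score n (l k) (l j) + n)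
       = (\<Sum>j<L. same_pairs n (l j) (l j) + 2 * n * n)"
    proof (rule sum.cong[OF refl])
      fix j
      show "rel_dist {..<n} (label_rel (l k)) (label_rel (l j)) + 2 * pair_score n (l k) (l j) + n
          = same_pairs n (l j) (l j) + 2 * n * n"
        using rel_dist_same_pairs[of n "l k" "l j"] pair_score_eq[of n "l k" "l j"] l[OF that] by simp
    qed
    then show ?thesis by (simp add: sum.distrib sum_distrib_left)
  qed
  from this[OF assms(2)] this[OF assms(3)] assms(4) show ?thesis by linarith
qed

section \<open>Labels and lists of equally labelled vertices\<close>

text \<open>A label depends on the pointers alone, so it may overwrite the rank of its vertex.
  Register 9 is raised before it is stored as list head, since \<open>v + 1\<close> encodes
  \<open>v\<close>.\<close>

definition classify_body :: com where
  "classify_body = block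
    [Compute 10 Add (Reg 7) (Reg 9), Compute 11 Add (Reg 10) (Reg 4), Load 11 (Reg 11),
     Compute 12 Add (Reg 7) (Reg 11), Compute 12 Add (Reg 12) (Reg 4), Load 13 (Reg 12),
     Branch Equal (Reg 13) (Reg 11) Skip (Compute 11 Add (Reg 9) (Imm 0)),
     Store (Reg 10) (Reg 11),
     Compute 12 Add (Reg 7) (Reg 11), Compute 12 Add (Reg 12) (Reg 4), Compute 12 Add (Reg 12) (Reg 4),
     Load 13 (Reg 12), Compute 9 Add (Reg 9) (Imm 1), Store (Reg 12) (Reg 9),
     Compute 10 Add (Reg 10) (Reg 20), Store (Reg 10) (Reg 13)]"

definition classify_copy :: com where
  "classify_copy = block
    [Compute 9 Add (Imm 0) (Imm 0), While Less (Reg 9) (Reg 3) classify_body, Compute 7 Add (Reg 7) (Reg 3)]"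

context layout
begin

definition regs_ok_end :: "state \<Rightarrow> bool" where
  "regs_ok_end \<sigma> \<longleftrightarrow> regs_ok \<sigma> \<and> regs \<sigma> 14 = adr (Suc (4 * L)) 0 \<and> regs \<sigma> 20 = L * n * 3"

definition classified :: "(nat \<Rightarrow> nat) \<Rightarrow> nat \<Rightarrow> nat \<Rightarrow> (nat \<Rightarrow> nat) \<Rightarrow> bool" where
  "classified l m i \<mu> \<longleftrightarrow> (\<forall>v<m. \<mu> (adr (Suc i) v) = l v) \<and>
     (\<forall>p<n. linked (\<lambda>v. \<mu> (adr (Suc (i + 3 * L)) v)) (\<mu> (adr (Suc (i + L + L)) p)) (group_list l m p))"

text \<open>\<open>st i\<close> is the number of vertices of copy \<open>i\<close> already
  classified, so one invariant describes the progress of both nested loops. The pointer rows must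
  survive, as later labels consult them.\<close>

definition classify_inv :: "(nat \<Rightarrow> nat \<Rightarrow> nat) \<Rightarrow> (nat \<Rightarrow> nat) \<Rightarrow> state \<Rightarrow> bool" where
  "classify_inv F st \<sigma> \<longleftrightarrow> regs_ok_end \<sigma> \<and>
     (\<forall>i<L. \<forall>v<n. mem \<sigma> (adr (Suc (i + L)) v) = F i v) \<and>
     (\<forall>x. adr (Suc (4 * L)) 0 \<le> x \<longrightarrow> mem \<sigma> x = 0) \<and>
     (\<forall>i<L. classified (cluster_label (F i)) (st i) i (mem \<sigma>))"

lemma classified_cong:
  assumes "m \<le> n" "\<And>v. v < n \<Longrightarrow> \<mu> (adr (Suc i) v) = \<mu>' (adr (Suc i) v)"
    "\<And>v. v < n \<Longrightarrow> \<mu> (adr (Suc (i + L + L)) v) = \<mu>' (adr (Suc (i + L + L)) v)"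
    "\<And>v. v < n \<Longrightarrow> \<mu> (adr (Suc (i + 3 * L)) v) = \<mu>' (adr (Suc (i + 3 * L)) v)"
  shows "classified l m i \<mu> \<longleftrightarrow> classified l m i \<mu>'"
proof -
  have "linked (\<lambda>v. \<mu> (adr (Suc (i + 3 * L)) v)) h (group_list l m p)
     \<longleftrightarrow> linked (\<lambda>v. \<mu>' (adr (Suc (i + 3 * L)) v)) h (group_list l m p)" for h p
    using assms by (intro linked_cong) auto
  then show ?thesis using assms by (auto simp: classified_def)
qed

text \<open>Since \<open>v\<close> occurs in no list so far, writing its link leaves the old lists
  intact, and \<open>v\<close> becomes the new head of the list of its label.\<close>

lemma classified_step:
  assumes c: "classified l v k \<mu>" and v: "v < n" "l v < n" and k: "k < L"
  shows "classified l (Suc v) k (\<mu>(adr (Suc k) v := l v, adr (Suc (k + L + L)) (l v) := Suc v,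
      adr (Suc (k + 3 * L)) v := \<mu> (adr (Suc (k + L + L)) (l v))))"
    (is "classified l (Suc v) k ?\<mu>")
  unfolding classified_def
proof (intro conjI allI impI)
  fix x assume "x < Suc v"
  then show "?\<mu> (adr (Suc k) x) = l x" using c v k L_pos by (auto simp: classified_def less_Suc_eq)
next
  fix p assume p: "p < n"
  have "?\<mu> (adr (Suc (k + 3 * L)) x) = \<mu> (adr (Suc (k + 3 * L)) x)" if "x < v" for x
    using that v k L_pos by simp
  then have "linked (\<lambda>x. ?\<mu> (adr (Suc (k + 3 * L)) x)) h (group_list l v p)
     \<longleftrightarrow> linked (\<lambda>x. \<mu> (adr (Suc (k + 3 * L)) x)) h (group_list l v p)" for h
    by (intro linked_cong) auto
  then show "linked (\<lambda>x. ?\<mu> (adr (Suc (k + 3 * L)) x)) (?\<mu> (adr (Suc (k + L + L)) p)) (group_list l (Suc v) p)"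
    using c v k L_pos p by (auto simp: classified_def group_list_Suc)
qed

lemma linked_head_le: "linked nx h vs \<Longrightarrow> (\<And>v. v \<in> set vs \<Longrightarrow> v < n) \<Longrightarrow> h \<le> n"
  by (cases vs) (auto simp: Suc_le_eq)

lemma wp_classify_body:
  assumes inv: "classify_inv F (\<lambda>i. if i < k then n else if i = k then v else 0) \<sigma>"
    and reg: "regs \<sigma> 7 = adr (Suc k) 0" "regs \<sigma> 9 = v" and kv: "k < L" "v < n"
    and F: "\<And>i x. i < L \<Longrightarrow> x < n \<Longrightarrow> F i x < n"
  shows "wp s w classify_body 40 (\<lambda>\<sigma>. classify_inv F (\<lambda>i. if i < k then n else if i = k then Suc v else 0) \<sigma> \<and>
     regs \<sigma> 7 = adr (Suc k) 0 \<and> regs \<sigma> 9 = Suc v) \<sigma>"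
proof -
  define l where "l = cluster_label (F k)"
  define h where "h = mem \<sigma> (adr (Suc (k + L + L)) (l v))"
  have Fk: "F k v < n" "F k (F k v) < n" using F kv by auto
  then have l: "l v < n" using kv by (simp add: l_def cluster_label_def)
  have c: "classified (cluster_label (F i)) (if i < k then n else if i = k then v else 0) i (mem \<sigma>)" if "i < L" for i
    using inv that by (simp add: classify_inv_def)
  have "h \<le> n" using c[of k] kv l unfolding classified_def h_def l_def[symmetric]
    by (auto intro!: linked_head_le)
  then have h: "h < 2 ^ w" by simp
  have m: "mem \<sigma> (adr (Suc (k + L)) x) = F k x" if "x < n" for x
    using inv that kv by (simp add: classify_inv_def)
  let ?\<mu> = "(mem \<sigma>)(adr (Suc k) v := l v, adr (Suc (k + L + L)) (l v) := Suc v, adr (Suc (k + 3 * L)) v := h)"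
  have "wp s w classify_body 40 (\<lambda>\<sigma>'. (\<forall>r. r \<notin> {9, 10, 11, 12, 13} \<longrightarrow> regs \<sigma>' r = regs \<sigma> r) \<and> regs \<sigma>' 9 = Suc v \<and> mem \<sigma>' = ?\<mu>) \<sigma>"
    unfolding classify_body_def
    using inv reg kv Fk l h m L_pos
    by (intro wp_vc)
      (auto simp: classify_inv_def regs_ok_end_def regs_ok_def l_def h_def cluster_label_def)
  then show ?thesis
  proof (rule wp_mono[OF _ order.refl])
    fix \<tau> :: state assume \<tau>: "(\<forall>r. r \<notin> {9, 10, 11, 12, 13} \<longrightarrow> regs \<tau> r = regs \<sigma> r) \<and> regs \<tau> 9 = Suc v \<and> mem \<tau> = ?\<mu>"
    have "classify_inv F (\<lambda>i. if i < k then n else if i = k then Suc v else 0) \<tau>"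
      unfolding classify_inv_def
    proof (intro conjI allI impI)
      show "regs_ok_end \<tau>" using \<tau> inv by (simp add: classify_inv_def regs_ok_end_def regs_ok_def)
    next
      fix i x assume "i < L" "x < n"
      then show "mem \<tau> (adr (Suc (i + L)) x) = F i x"
        using \<tau> inv kv l L_pos by (simp add: classify_inv_def)
    next
      fix x assume "adr (Suc (4 * L)) 0 \<le> x"
      moreover have "adr (Suc k) v < adr (Suc (4 * L)) 0" "adr (Suc (k + L + L)) (l v) < adr (Suc (4 * L)) 0"
        "adr (Suc (k + 3 * L)) v < adr (Suc (4 * L)) 0"
        using kv l by (auto intro!: adr_less)
      ultimately show "mem \<tau> x = 0" using \<tau> inv by (auto simp: classify_inv_def)
    next
      fix i assume i: "i < L"
      show "classified (cluster_label (F i)) (if i < k then n else if i = k then Suc v else 0) i (mem \<tau>)"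
      proof (cases "i = k")
        case True
        then show ?thesis using \<tau> classified_step[of l v k "mem \<sigma>"] c[OF i] kv l by (simp add: l_def h_def)
      next
        case False
        then have "classified (cluster_label (F i)) (if i < k then n else 0) i (mem \<sigma>)"
          using c[OF i] by (auto split: if_splits)
        moreover have "classified (cluster_label (F i)) (if i < k then n else 0) i (mem \<sigma>)
          \<longleftrightarrow> classified (cluster_label (F i)) (if i < k then n else 0) i (mem \<tau>)"
          by (rule classified_cong) (use \<tau> False i kv l in auto)
        ultimately show ?thesis using False by auto
      qed
    qed
    then show "classify_inv F (\<lambda>i. if i < k then n else if i = k then Suc v else 0) \<tau> \<and>
      regs \<tau> 7 = adr (Suc k) 0 \<and> regs \<tau> 9 = Suc v" using \<tau> reg by simp
  qed
qed

lemma wp_classify_copy: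
  assumes inv: "classify_inv F (\<lambda>i. if i < k then n else 0) \<sigma>"
    and reg: "regs \<sigma> 7 = adr (Suc k) 0" and k: "k < L"
    and F: "\<And>i x. i < L \<Longrightarrow> x < n \<Longrightarrow> F i x < n"
  shows "wp s w classify_copy (41 * n + 10) (\<lambda>\<sigma>. classify_inv F (\<lambda>i. if i < Suc k then n else 0) \<sigma> \<and>
     regs \<sigma> 7 = adr (Suc (Suc k)) 0) \<sigma>"
proof -
  let ?Q = "\<lambda>\<sigma>::state. classify_inv F (\<lambda>i. if i < Suc k then n else 0) \<sigma> \<and> regs \<sigma> 7 = adr (Suc (Suc k)) 0"
  let ?I = "\<lambda>v (\<sigma>::state). classify_inv F (\<lambda>i. if i < k then n else if i = k then v else 0) \<sigma> \<and>
     regs \<sigma> 7 = adr (Suc k) 0 \<and> regs \<sigma> 9 = v"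
  have st: "(\<lambda>i. if i < k then n else if i = k then n else 0) = (\<lambda>i. if i < Suc k then n else 0)"
    "(\<lambda>i. if i < k then n else if i = k then 0 else 0) = (\<lambda>i. if i < k then n else 0)" by auto
  have loop: "wp s w (While Less (Reg 9) (Reg 3) classify_body) (41 * n + 1)
      (wp s w (block [Compute 7 Add (Reg 7) (Reg 3)]) 5 ?Q) \<sigma>" if "?I 0 \<sigma>" for \<sigma>
  proof (rule wp_for[where I = ?I and m = n and b = "\<lambda>_. 40"])
    fix v \<sigma> assume "v < n" "?I v \<sigma>"
    then show "cmpop_val Less (operand_val (Reg 9) \<sigma>) (operand_val (Reg 3) \<sigma>) \<and> wp s w classify_body 40 (?I (Suc v)) \<sigma>"
      using wp_classify_body[of F k v \<sigma>] k F by (simp add: classify_inv_def regs_ok_end_def regs_ok_def)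
  next
    fix \<sigma> assume I: "?I n \<sigma>"
    then have "wp s w (block [Compute 7 Add (Reg 7) (Reg 3)]) 5 ?Q \<sigma>"
      using k unfolding st by (intro wp_vc) (simp add: classify_inv_def regs_ok_end_def regs_ok_def)
    then show "\<not> cmpop_val Less (operand_val (Reg 9) \<sigma>) (operand_val (Reg 3) \<sigma>) \<and>
      wp s w (block [Compute 7 Add (Reg 7) (Reg 3)]) 5 ?Q \<sigma>"
      using I by (simp add: classify_inv_def regs_ok_end_def regs_ok_def)
  qed (use that in auto)
  have "?I 0 (\<sigma>\<lparr>regs := (regs \<sigma>)(9 := 0)\<rparr>)"
    unfolding st using inv reg by (simp add: classify_inv_def regs_ok_end_def regs_ok_def)
  from loop[OF this] show ?thesis unfolding classify_copy_def
    by (intro wp_block_Compute wp_block_Cons[where k = "41 * n + 1" and l = 5]) auto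
qed

lemma wp_classify:
  assumes inv: "classify_inv F (\<lambda>i. 0) \<sigma>" and reg: "regs \<sigma> 7 = n"
    and F: "\<And>i x. i < L \<Longrightarrow> x < n \<Longrightarrow> F i x < n"
  shows "wp s w (While Less (Reg 7) (Reg 5) classify_copy) (L * (41 * n + 11) + 1) (classify_inv F (\<lambda>i. n)) \<sigma>"
proof (rule wp_for[where m = L and b = "\<lambda>_. 41 * n + 10" and I = "\<lambda>k (\<sigma>::state).
    classify_inv F (\<lambda>i. if i < k then n else 0) \<sigma> \<and> regs \<sigma> 7 = adr (Suc k) 0"])
  show "classify_inv F (\<lambda>i. if i < 0 then n else 0) \<sigma> \<and> regs \<sigma> 7 = adr (Suc 0) 0"
    using inv reg by (simp add: adr_def)
next
  fix k \<sigma> assume "k < L" "classify_inv F (\<lambda>i. if i < k then n else 0) \<sigma> \<and> regs \<sigma> 7 = adr (Suc k) 0"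
  then show "cmpop_val Less (operand_val (Reg 7) \<sigma>) (operand_val (Reg 5) \<sigma>) \<and>
     wp s w classify_copy (41 * n + 10) (\<lambda>\<sigma>. classify_inv F (\<lambda>i. if i < Suc k then n else 0) \<sigma> \<and>
     regs \<sigma> 7 = adr (Suc (Suc k)) 0) \<sigma>"
    using wp_classify_copy[of F k \<sigma>] F by (simp add: classify_inv_def regs_ok_end_def regs_ok_def)
next
  fix \<sigma> assume "classify_inv F (\<lambda>i. if i < L then n else 0) \<sigma> \<and> regs \<sigma> 7 = adr (Suc L) 0"
  then show "\<not> cmpop_val Less (operand_val (Reg 7) \<sigma>) (operand_val (Reg 5) \<sigma>) \<and> classify_inv F (\<lambda>i. n) \<sigma>"
    by (simp add: classify_inv_def regs_ok_end_def regs_ok_def)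
qed simp

end

section \<open>Scoring all pairs of copies\<close>

lemma mixed_radix_less: "(a::nat) < A \<Longrightarrow> b < B \<Longrightarrow> a * B + b < A * B"
proof -
  assume "a < A" "b < B"
  then have "a * B + b < Suc a * B" by simp
  also have "\<dots> \<le> A * B" using \<open>a < A\<close> by (intro mult_le_mono1) simp
  finally show ?thesis .
qed

text \<open>Register 11 holds the encoded list element, 8 the tag, 17 the score so far and 18 the
  number of elements visited. Truncated subtraction of the tag makes a counter word left by an
  earlier group read as 0.\<close>

definition walk_body :: com where
  "walk_body = block
    [Compute 11 Sub (Reg 11) (Imm 1),
     Compute 12 Add (Reg 9) (Reg 11), Load 12 (Reg 12), Compute 12 Add (Reg 14) (Reg 12),
     Load 13 (Reg 12), Compute 13 Sub (Reg 13) (Reg 8),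
     Compute 19 Add (Reg 8) (Reg 13), Compute 19 Add (Reg 19) (Imm 1), Store (Reg 12) (Reg 19),
     Compute 17 Add (Reg 17) (Reg 3), Compute 13 Add (Reg 13) (Reg 13), Compute 17 Add (Reg 17) (Reg 13),
     Compute 17 Sub (Reg 17) (Reg 18), Compute 18 Add (Reg 18) (Imm 1),
     Compute 11 Add (Reg 7) (Reg 11), Compute 11 Add (Reg 11) (Reg 20), Load 11 (Reg 11)]"

text \<open>Register 7 is the row of the copy whose lists are walked, register 9 the row of the copy
  whose labels are counted, register 10 the label of the list. The first command raises the
  tag.\<close>

definition group_body :: com where
  "group_body = block
    [Compute 8 Add (Reg 8) (Reg 3), Compute 18 Add (Imm 0) (Imm 0),
     Compute 11 Add (Reg 7) (Reg 10), Compute 11 Add (Reg 11) (Reg 4), Compute 11 Add (Reg 11) (Reg 4),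
     Load 11 (Reg 11), While Unequal (Reg 11) (Imm 0) walk_body, Compute 10 Add (Reg 10) (Imm 1)]"

definition pair_body :: com where
  "pair_body = block
    [Compute 10 Add (Imm 0) (Imm 0), While Less (Reg 10) (Reg 3) group_body, Compute 9 Add (Reg 9) (Reg 3)]"

text \<open>The best score starts at 0, so the non-strict test lets the first copy set register 16
  in any case.\<close>

definition score_body :: com where
  "score_body = block
    [Compute 17 Add (Imm 0) (Imm 0), Compute 9 Add (Reg 3) (Imm 0), While Less (Reg 9) (Reg 5) pair_body,
     Branch Leq (Reg 15) (Reg 17)
       (block [Compute 15 Add (Reg 17) (Imm 0), Compute 16 Add (Reg 7) (Imm 0)]) Skip,
     Compute 7 Add (Reg 7) (Reg 3)]"

definition output_body :: com where
  "output_body = block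
    [Compute 10 Add (Reg 16) (Reg 9), Load 10 (Reg 10), Store (Reg 9) (Reg 10), Compute 9 Add (Reg 9) (Imm 1)]"

definition end_com :: com where
  "end_com = block
    [Compute 14 Mul (Reg 4) (Imm 4), Compute 14 Add (Reg 14) (Reg 3), Compute 20 Mul (Reg 4) (Imm 3),
     Compute 7 Add (Reg 3) (Imm 0), While Less (Reg 7) (Reg 5) classify_copy,
     Compute 15 Add (Imm 0) (Imm 0), Compute 8 Add (Imm 0) (Imm 0), Compute 7 Add (Reg 3) (Imm 0),
     While Less (Reg 7) (Reg 5) score_body,
     Compute 9 Add (Imm 0) (Imm 0), While Less (Reg 9) (Reg 3) output_body]"

context layout
begin

lemma adr_same_block [simp]: "adr b u = adr b v \<longleftrightarrow> u = v"
  by (simp add: adr_def)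

text \<open>Scoring writes only to the counter row, so all memory below it is a fixed
  \<open>\<mu>\<close>.\<close>

definition frame :: "(nat \<Rightarrow> nat) \<Rightarrow> state \<Rightarrow> bool" where
  "frame \<mu> \<sigma> \<longleftrightarrow> regs_ok_end \<sigma> \<and> (\<forall>x<adr (Suc (4 * L)) 0. mem \<sigma> x = \<mu> x)"

definition counter :: "state \<Rightarrow> nat \<Rightarrow> nat" where
  "counter \<sigma> b = mem \<sigma> (adr (Suc (4 * L)) b) - regs \<sigma> 8"

text \<open>A counter is represented by the excess of its memory word over the tag in register 8. Raising
  the tag by \<open>n\<close> thus resets all counters at once, as no counter exceeds \<open>n\<close>.\<close>

definition counters_le :: "state \<Rightarrow> bool" where
  "counters_le \<sigma> \<longleftrightarrow> (\<forall>b<n. mem \<sigma> (adr (Suc (4 * L)) b) \<le> regs \<sigma> 8 + n)"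

lemma frame_upd [simp]:
  "r \<notin> {3, 4, 5, 14, 20} \<Longrightarrow> frame \<mu> (\<sigma>\<lparr>regs := \<rho>(r := x)\<rparr>) \<longleftrightarrow> frame \<mu> (\<sigma>\<lparr>regs := \<rho>\<rparr>)"
  by (auto simp: frame_def regs_ok_end_def regs_ok_def)

lemma counters_le_upd [simp]:
  "r \<noteq> 8 \<Longrightarrow> counters_le (\<sigma>\<lparr>regs := \<rho>(r := x)\<rparr>) \<longleftrightarrow> counters_le (\<sigma>\<lparr>regs := \<rho>\<rparr>)"
  by (auto simp: counters_le_def)

lemma frame_mem:
  "frame \<mu> \<sigma> \<Longrightarrow> v < n \<Longrightarrow> b \<le> 4 * L \<Longrightarrow> mem \<sigma> (adr b v) = \<mu> (adr b v)"
  using adr_less[of v b "Suc (4 * L)" 0] by (simp add: frame_def)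

lemma wp_walk_body:
  assumes fr: "frame \<mu> \<sigma>" and ij: "i < L" "j < L" and v: "v < n" "l v < n"
    and reg: "regs \<sigma> 7 = adr (Suc i) 0" "regs \<sigma> 9 = adr (Suc j) 0" "regs \<sigma> 11 = Suc v"
    and lab: "\<mu> (adr (Suc j) v) = l v" and nx: "\<mu> (adr (Suc (i + 3 * L)) v) \<le> n"
    and cnt: "counters_le \<sigma>" "counter \<sigma> (l v) < n" and k: "regs \<sigma> 18 < n"
    and bnd: "regs \<sigma> 8 + 2 * n < 2 ^ w" "regs \<sigma> 17 + 3 * n < 2 ^ w"
  shows "wp s w walk_body 35 (\<lambda>\<sigma>'. (\<forall>r. r \<notin> {11, 12, 13, 17, 18, 19} \<longrightarrow> regs \<sigma>' r = regs \<sigma> r) \<and>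
     regs \<sigma>' 11 = \<mu> (adr (Suc (i + 3 * L)) v) \<and> regs \<sigma>' 18 = Suc (regs \<sigma> 18) \<and>
     regs \<sigma>' 17 = regs \<sigma> 17 + (n + 2 * counter \<sigma> (l v) - regs \<sigma> 18) \<and>
     mem \<sigma>' = (mem \<sigma>)(adr (Suc (4 * L)) (l v) := Suc (regs \<sigma> 8 + counter \<sigma> (l v)))) \<sigma>"
proof -
  have m: "mem \<sigma> (adr (Suc j) v) = l v" "mem \<sigma> (adr (Suc (i + 3 * L)) v) = \<mu> (adr (Suc (i + 3 * L)) v)"
    using frame_mem[OF fr v(1)] lab ij by auto
  define C where "C = mem \<sigma> (adr (Suc (4 * L)) (l v))"
  have C: "C - regs \<sigma> 8 < n" "C \<le> regs \<sigma> 8 + n" using cnt v by (auto simp: C_def counter_def counters_le_def)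
  have r: "regs \<sigma> 3 = n" "regs \<sigma> 14 = adr (Suc (4 * L)) 0" "regs \<sigma> 20 = L * n * 3" 
    using fr by (auto simp: frame_def regs_ok_end_def regs_ok_def)
  have ne: "adr (Suc (i + 3 * L)) v \<noteq> adr (Suc (4 * L)) (l v)" using ij v by simp
  have nxw: "\<mu> (adr (Suc (i + 3 * L)) v) < 2 ^ w" using nx by simp
  show ?thesis unfolding walk_body_def counter_def C_def[symmetric]
    using reg r m v ij C k bnd ne nxw L_pos
    by (intro wp_vc, simp add: C_def[symmetric], arith)
qed

text \<open>Induction along the list. Each element adds at most \<open>3 * n\<close> to the score,
  the share reserved for it in the bound on register 17.\<close>

lemma wp_walk:
  assumes "frame \<mu> \<sigma>" and ij: "i < L" "j < L"
    and "regs \<sigma> 7 = adr (Suc i) 0" "regs \<sigma> 9 = adr (Suc j) 0"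
    and "linked (\<lambda>v. \<mu> (adr (Suc (i + 3 * L)) v)) (regs \<sigma> 11) vs"
    and "\<And>v. v \<in> set vs \<Longrightarrow> v < n" and lab: "\<And>v. v < n \<Longrightarrow> \<mu> (adr (Suc j) v) = l v \<and> l v < n"
    and "counters_le \<sigma>" "\<And>b. b < n \<Longrightarrow> counter \<sigma> b + length vs \<le> n" and "regs \<sigma> 18 + length vs \<le> n"
    and "regs \<sigma> 8 + 2 * n < 2 ^ w" "regs \<sigma> 17 + 3 * n * length vs < 2 ^ w"
  shows "wp s w (While Unequal (Reg 11) (Imm 0) walk_body) (36 * length vs + 1)
    (\<lambda>\<sigma>'. (\<forall>r. r \<notin> {11, 12, 13, 17, 18, 19} \<longrightarrow> regs \<sigma>' r = regs \<sigma> r) \<and> frame \<mu> \<sigma>' \<and> counters_le \<sigma>' \<and>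
      regs \<sigma>' 17 = regs \<sigma> 17 + walk_score n l (counter \<sigma>) (regs \<sigma> 18) vs) \<sigma>"
  using assms(1,4-7,9-13)
proof (induction vs arbitrary: \<sigma>)
  case Nil
  then show ?case by (intro wp_While_exit) auto
next
  case (Cons v vs)
  let ?nx = "\<mu> (adr (Suc (i + 3 * L)) v)"
  have v: "v < n" "l v < n" "\<mu> (adr (Suc j) v) = l v" using Cons.prems(5)[of v] lab[of v] by auto
  have link: "linked (\<lambda>v. \<mu> (adr (Suc (i + 3 * L)) v)) ?nx vs" and h: "regs \<sigma> 11 = Suc v"
    using Cons.prems(4) by auto
  have nx: "?nx \<le> n" using link Cons.prems(5) by (auto intro: linked_head_le)
  have c: "counter \<sigma> (l v) < n" using Cons.prems(7)[OF v(2)] by simp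
  have bnd: "regs \<sigma> 17 + 3 * n + 3 * n * length vs < 2 ^ w" using Cons.prems(10) by simp
  let ?Q = "\<lambda>\<sigma>'. (\<forall>r. r \<notin> {11, 12, 13, 17, 18, 19} \<longrightarrow> regs \<sigma>' r = regs \<sigma> r) \<and> frame \<mu> \<sigma>' \<and> counters_le \<sigma>' \<and>
      regs \<sigma>' 17 = regs \<sigma> 17 + walk_score n l (counter \<sigma>) (regs \<sigma> 18) (v # vs)"
  have "wp s w walk_body 35 (wp s w (While Unequal (Reg 11) (Imm 0) walk_body) (36 * length vs + 1) ?Q) \<sigma>"
  proof (rule wp_mono[OF wp_walk_body[where \<mu> = \<mu> and i = i and j = j and v = v and l = l] order.refl])
    fix \<tau> :: state assume \<tau>: "(\<forall>r. r \<notin> {11, 12, 13, 17, 18, 19} \<longrightarrow> regs \<tau> r = regs \<sigma> r) \<and>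
     regs \<tau> 11 = ?nx \<and> regs \<tau> 18 = Suc (regs \<sigma> 18) \<and>
     regs \<tau> 17 = regs \<sigma> 17 + (n + 2 * counter \<sigma> (l v) - regs \<sigma> 18) \<and>
     mem \<tau> = (mem \<sigma>)(adr (Suc (4 * L)) (l v) := Suc (regs \<sigma> 8 + counter \<sigma> (l v)))"
    have fr: "frame \<mu> \<tau>"
    proof -
      have "x \<noteq> adr (Suc (4 * L)) (l v)" if "x < adr (Suc (4 * L)) 0" for x
        using that by (auto simp: adr_def)
      then show ?thesis using \<tau> Cons.prems(1) by (auto simp: frame_def regs_ok_end_def regs_ok_def)
    qed
    have cnt: "counter \<tau> = (counter \<sigma>)(l v := Suc (counter \<sigma> (l v)))"
      using \<tau> by (auto simp: counter_def fun_eq_iff)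
    have cle: "counters_le \<tau>"
      using \<tau> Cons.prems(6) c by (auto simp: counters_le_def)
    have "wp s w (While Unequal (Reg 11) (Imm 0) walk_body) (36 * length vs + 1)
      (\<lambda>\<sigma>'. (\<forall>r. r \<notin> {11, 12, 13, 17, 18, 19} \<longrightarrow> regs \<sigma>' r = regs \<tau> r) \<and> frame \<mu> \<sigma>' \<and> counters_le \<sigma>' \<and>
      regs \<sigma>' 17 = regs \<tau> 17 + walk_score n l (counter \<tau>) (regs \<tau> 18) vs) \<tau>"
    proof (rule Cons.IH)
      show "counter \<tau> b + length vs \<le> n" if "b < n" for b
        using Cons.prems(7)[OF that] by (auto simp: cnt)
      have "n + 2 * counter \<sigma> (l v) - regs \<sigma> 18 \<le> 3 * n" using c by simp
      then show "regs \<tau> 17 + 3 * n * length vs < 2 ^ w" using \<tau> bnd by linarith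
    qed (use fr \<tau> Cons.prems link cle in auto)
    then show "wp s w (While Unequal (Reg 11) (Imm 0) walk_body) (36 * length vs + 1) ?Q \<tau>"
      by (rule wp_mono[OF _ order.refl]) (use \<tau> cnt in \<open>auto simp del: fun_upd_apply\<close>)
  qed (use Cons.prems ij v h nx c bnd in auto)
  from wp_While_step[OF _ this] show ?case using h by simp
qed

definition prepared :: "(nat \<Rightarrow> nat \<Rightarrow> nat) \<Rightarrow> (nat \<Rightarrow> nat) \<Rightarrow> bool" where
  "prepared l \<mu> \<longleftrightarrow> (\<forall>i<L. \<forall>v<n. l i v < n) \<and> (\<forall>i<L. classified (l i) n i \<mu>)"

text \<open>The tag is \<open>n\<close> times the number of groups handled, counted in mixed radix
  by \<open>i\<close>, \<open>j\<close>, \<open>p\<close>. It is not reset between groups, hence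
  words for values of order \<open>L * L * n * n\<close>; the margin \<open>3 * n\<close> leaves
  room for raising the tag once more and for the counters above it.\<close>

lemma tag_bound:
  assumes "i < L" "j < L" "p < n"
  shows "((i * L + j) * n + p) * n + 3 * n < 2 ^ w"
proof -
  have "(i * L + j) * n + p < L * L * n"
    using assms by (intro mixed_radix_less)
  then have "((i * L + j) * n + p) * n \<le> L * L * n * n" by (intro mult_le_mono1) simp
  then show ?thesis using word_bounds by linarith
qed

lemma wp_group_body:
  assumes pr: "prepared l \<mu>" and ij: "i < L" "j < L" and p: "p < n"
    and fr: "frame \<mu> \<sigma>" and reg: "regs \<sigma> 7 = adr (Suc i) 0" "regs \<sigma> 9 = adr (Suc j) 0" "regs \<sigma> 10 = p"
      "regs \<sigma> 8 = ((i * L + j) * n + p) * n"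
    and cnt: "counters_le \<sigma>" and acc: "regs \<sigma> 17 + 3 * n * n < 2 ^ w"
  shows "wp s w group_body (36 * length (group_list (l i) n p) + 20)
    (\<lambda>\<sigma>'. frame \<mu> \<sigma>' \<and> counters_le \<sigma>' \<and> regs \<sigma>' 7 = regs \<sigma> 7 \<and> regs \<sigma>' 9 = regs \<sigma> 9 \<and> regs \<sigma>' 10 = Suc p \<and>
      regs \<sigma>' 15 = regs \<sigma> 15 \<and> regs \<sigma>' 16 = regs \<sigma> 16 \<and>
      regs \<sigma>' 8 = ((i * L + j) * n + Suc p) * n \<and>
      regs \<sigma>' 17 = regs \<sigma> 17 + walk_score n (l j) (\<lambda>_. 0) 0 (group_list (l i) n p)) \<sigma>"
    (is "wp s w group_body _ ?Q \<sigma>")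
proof -
  let ?vs = "group_list (l i) n p" and ?h = "\<mu> (adr (Suc (i + L + L)) p)"
  define g where "g = ((i * L + j) * n + Suc p) * n"
  have tag: "regs \<sigma> 8 + n = g" "g + 2 * n < 2 ^ w" "g < 2 ^ w"
    using tag_bound[OF ij p] reg(4) by (auto simp: g_def algebra_simps)
  have link: "linked (\<lambda>v. \<mu> (adr (Suc (i + 3 * L)) v)) ?h ?vs"
    using pr ij p by (simp add: prepared_def classified_def)
  have h: "?h < 2 ^ w" using linked_head_le[OF link] by simp
  have mh: "mem \<sigma> (adr (Suc (i + L + L)) p) = ?h" using frame_mem[OF fr p] ij by simp
  have r: "regs \<sigma> 3 = n" "regs \<sigma> 4 = L * n" using fr by (auto simp: frame_def regs_ok_end_def regs_ok_def)
  define \<tau> where "\<tau> = \<sigma>\<lparr>regs := (regs \<sigma>)(8 := g, 18 := 0, 11 := ?h)\<rparr>"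
  have fr': "frame \<mu> \<tau>" using fr by (simp add: frame_def regs_ok_end_def regs_ok_def \<tau>_def)
  \<comment> \<open>By \<open>counters_le\<close> no counter word exceeds the old tag by more than
    \<open>n\<close>, so none exceeds the raised tag and all counters read 0.\<close>
  have c0: "mem \<sigma> (adr (Suc (4 * L)) b) \<le> g" if "b < n" for b
    using cnt that tag(1) by (simp add: counters_le_def)
  have cnt': "counters_le \<tau>" "counter \<tau> b = 0" if "b < n" for b
    using c0 by (auto simp: counters_le_def counter_def \<tau>_def that le_SucI trans_le_add1)
  have ws: "walk_score n (l j) (counter \<tau>) 0 ?vs = walk_score n (l j) (\<lambda>_. 0) 0 ?vs"
  proof -
    \<comment> \<open>The counters are known to be 0 only below \<open>n\<close>; this suffices,
      because all labels on the list are below \<open>n\<close>.\<close>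
    have cong: "walk_score n (l j) c k vs = walk_score n (l j) c' k vs"
      if "\<And>v. v \<in> set vs \<Longrightarrow> v < n" "\<And>b. b < n \<Longrightarrow> c b = c' b" for c c' k vs
      using that
    proof (induction vs arbitrary: c c' k)
      case (Cons v vs)
      have "l j v < n" using Cons.prems(1)[of v] pr ij by (simp add: prepared_def)
      moreover have "walk_score n (l j) (c(l j v := Suc (c (l j v)))) (Suc k) vs
          = walk_score n (l j) (c'(l j v := Suc (c' (l j v)))) (Suc k) vs"
        using Cons.prems by (intro Cons.IH) auto
      ultimately show ?case using Cons.prems(2) by simp
    qed simp
    show ?thesis by (rule cong) (use cnt' in auto)
  qed
  have walk: "wp s w (While Unequal (Reg 11) (Imm 0) walk_body) (36 * length ?vs + 1)
      (\<lambda>\<sigma>'. (\<forall>r. r \<notin> {11, 12, 13, 17, 18, 19} \<longrightarrow> regs \<sigma>' r = regs \<tau> r) \<and> frame \<mu> \<sigma>' \<and> counters_le \<sigma>' \<and>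
      regs \<sigma>' 17 = regs \<tau> 17 + walk_score n (l j) (counter \<tau>) (regs \<tau> 18) ?vs) \<tau>"
  proof (rule wp_walk[OF fr' ij])
    show "\<mu> (adr (Suc j) v) = l j v \<and> l j v < n" if "v < n" for v
      using pr ij that by (simp add: prepared_def classified_def)
    show "counters_le \<tau>" using cnt' p by blast
    show "counter \<tau> b + length ?vs \<le> n" if "b < n" for b
      using cnt'(2)[OF that] length_group_list_le by simp
    have "3 * n * length ?vs \<le> 3 * n * n" using length_group_list_le by (intro mult_le_mono2)
    moreover have "regs \<tau> 17 = regs \<sigma> 17" by (simp add: \<tau>_def)
    ultimately show "regs \<tau> 17 + 3 * n * length ?vs < 2 ^ w" using acc by linarith
  qed (use reg link tag length_group_list_le in \<open>auto simp: \<tau>_def\<close>)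
  have "wp s w (block [While Unequal (Reg 11) (Imm 0) walk_body, Compute 10 Add (Reg 10) (Imm 1)])
      (36 * length ?vs + 5) ?Q \<tau>"
  proof (rule wp_block_Cons[where l = 3], rule wp_mono[OF walk order.refl])
    fix \<sigma>' :: state assume S: "(\<forall>r. r \<notin> {11, 12, 13, 17, 18, 19} \<longrightarrow> regs \<sigma>' r = regs \<tau> r) \<and> frame \<mu> \<sigma>' \<and> counters_le \<sigma>' \<and>
      regs \<sigma>' 17 = regs \<tau> 17 + walk_score n (l j) (counter \<tau>) (regs \<tau> 18) ?vs"
    have "frame \<mu> (\<sigma>'\<lparr>regs := (regs \<sigma>')(10 := Suc p)\<rparr>)" "counters_le (\<sigma>'\<lparr>regs := (regs \<sigma>')(10 := Suc p)\<rparr>)"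
      using S by simp_all
    then show "wp s w (block [Compute 10 Add (Reg 10) (Imm 1)]) 3 ?Q \<sigma>'"
      using S reg p ws by (intro wp_vc) (simp add: \<tau>_def g_def)
  qed simp
  then show ?thesis unfolding group_body_def
    by (intro wp_block_Compute wp_block_Cons[where k = 1 and c = "Load _ _" and l = "36 * length ?vs + 5"] wp_vc)
      (use reg(1-3) r tag mh h ij p in \<open>simp_all add: \<tau>_def\<close>)
qed

lemma wp_pair_body:
  assumes pr: "prepared l \<mu>" and ij: "i < L" "j < L"
    and fr: "frame \<mu> \<sigma>" and reg: "regs \<sigma> 7 = adr (Suc i) 0" "regs \<sigma> 9 = adr (Suc j) 0"
      "regs \<sigma> 8 = (i * L + j) * n * n"
    and cnt: "counters_le \<sigma>" and acc: "regs \<sigma> 17 + 6 * n * n < 2 ^ w"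
  shows "wp s w pair_body (75 * n + 10)
    (\<lambda>\<sigma>'. frame \<mu> \<sigma>' \<and> counters_le \<sigma>' \<and> regs \<sigma>' 7 = regs \<sigma> 7 \<and> regs \<sigma>' 9 = adr (Suc (Suc j)) 0 \<and>
      regs \<sigma>' 15 = regs \<sigma> 15 \<and> regs \<sigma>' 16 = regs \<sigma> 16 \<and> regs \<sigma>' 8 = (i * L + Suc j) * n * n \<and>
      regs \<sigma>' 17 = regs \<sigma> 17 + pair_score n (l i) (l j)) \<sigma>"
    (is "wp s w pair_body _ ?Q \<sigma>")
proof -
  let ?W = "\<lambda>q. walk_score n (l j) (\<lambda>_. 0) 0 (group_list (l i) n q)"
  let ?I = "\<lambda>p (\<tau>::state). frame \<mu> \<tau> \<and> counters_le \<tau> \<and> regs \<tau> 7 = adr (Suc i) 0 \<and> regs \<tau> 9 = adr (Suc j) 0 \<and>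
     regs \<tau> 10 = p \<and> regs \<tau> 15 = regs \<sigma> 15 \<and> regs \<tau> 16 = regs \<sigma> 16 \<and>
     regs \<tau> 8 = ((i * L + j) * n + p) * n \<and> regs \<tau> 17 = regs \<sigma> 17 + (\<Sum>q<p. ?W q)"
  have li: "l i v < n" if "v < n" for v using pr ij that by (simp add: prepared_def)
  have le: "(\<Sum>q<p. ?W q) \<le> 3 * n * n" if "p \<le> n" for p
  proof -
    have "(\<Sum>q<p. ?W q) \<le> (\<Sum>q<n. ?W q)" using that by (intro sum_mono2) auto
    also have "\<dots> \<le> 3 * n * n" using pair_score_le[of n "l i" "l j", OF li] by (simp add: pair_score_def)
    finally show ?thesis .
  qed
  have loop: "wp s w (While Less (Reg 10) (Reg 3) group_body) (57 * n + 1)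
      (wp s w (block [Compute 9 Add (Reg 9) (Reg 3)]) 3 ?Q) \<tau>" if "?I 0 \<tau>" for \<tau>
  \<comment> \<open>A round costs time proportional to its list; the lengths add up to
    \<open>n\<close> over all labels, so a pair of copies takes linear time.\<close>
  proof (rule wp_for[where I = ?I and m = n and b = "\<lambda>p. 36 * length (group_list (l i) n p) + 20"])
    fix p and \<tau> :: state assume p: "p < n" and I: "?I p \<tau>"
    have "regs \<tau> 17 + 3 * n * n < 2 ^ w" using I le[of p] p acc by linarith
    then have "wp s w group_body (36 * length (group_list (l i) n p) + 20) (?I (Suc p)) \<tau>"
      using I by (intro wp_mono[OF wp_group_body[OF pr ij p, of \<tau>] order.refl]) auto
    then show "cmpop_val Less (operand_val (Reg 10) \<tau>) (operand_val (Reg 3) \<tau>) \<and>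
        wp s w group_body (36 * length (group_list (l i) n p) + 20) (?I (Suc p)) \<tau>"
      using I p by (simp add: frame_def regs_ok_end_def regs_ok_def)
  next
    fix \<tau> :: state assume I: "?I n \<tau>"
    have r: "regs \<tau> 3 = n" using I by (simp add: frame_def regs_ok_end_def regs_ok_def)
    have "frame \<mu> (\<tau>\<lparr>regs := (regs \<tau>)(9 := adr (Suc (Suc j)) 0)\<rparr>)"
      "counters_le (\<tau>\<lparr>regs := (regs \<tau>)(9 := adr (Suc (Suc j)) 0)\<rparr>)"
      using I by simp_all
    moreover have "regs \<tau> 8 = (i * L + Suc j) * n * n" using I by (simp add: algebra_simps)
    ultimately have "wp s w (block [Compute 9 Add (Reg 9) (Reg 3)]) 3 ?Q \<tau>"
      using I r reg ij by (intro wp_vc) (simp add: pair_score_def)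
    then show "\<not> cmpop_val Less (operand_val (Reg 10) \<tau>) (operand_val (Reg 3) \<tau>) \<and>
        wp s w (block [Compute 9 Add (Reg 9) (Reg 3)]) 3 ?Q \<tau>"
      using I r by simp
  next
    have "(\<Sum>p<n. Suc (36 * length (group_list (l i) n p) + 20)) = 36 * n + 21 * n"
      using sum_length_group_list[of n "l i", OF li]
      by (simp add: sum.distrib sum_distrib_left[symmetric] sum_Suc)
    then show "(\<Sum>p<n. Suc (36 * length (group_list (l i) n p) + 20)) + 1 \<le> 57 * n + 1" by simp
  qed (use that in auto)
  have "?I 0 (\<sigma>\<lparr>regs := (regs \<sigma>)(10 := 0)\<rparr>)"
    using fr cnt reg by (simp add: frame_def regs_ok_end_def regs_ok_def counters_le_def)
  note L0 = loop[OF this]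
  show ?thesis unfolding pair_body_def
    by (rule wp_block_Compute, rule wp_block_Cons[where k = "57 * n + 1" and l = 3])
      (use L0 in \<open>auto simp del: block.simps\<close>)
qed

lemma pair_scores_bound:
  assumes "prepared l \<mu>" "i < L" "j \<le> L"
  shows "(\<Sum>q<j. pair_score n (l i) (l q)) + 6 * n * n < 2 ^ w"
proof -
  have "(\<Sum>q<j. pair_score n (l i) (l q)) \<le> (\<Sum>q<j. 3 * n * n)"
    using assms by (intro sum_mono pair_score_le) (auto simp: prepared_def)
  also have "\<dots> \<le> L * (3 * n * n)" using assms(3) by simp
  finally show ?thesis using word_bounds by (simp add: algebra_simps)
qed

lemma wp_score_body:
  assumes pr: "prepared l \<mu>" and i: "i < L"
    and fr: "frame \<mu> \<sigma>" and reg: "regs \<sigma> 7 = adr (Suc i) 0" "regs \<sigma> 8 = i * L * n * n"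
    and cnt: "counters_le \<sigma>"
  defines "score \<equiv> \<Sum>j<L. pair_score n (l i) (l j)"
  shows "wp s w score_body (L * (75 * n + 11) + 20)
    (\<lambda>\<sigma>'. frame \<mu> \<sigma>' \<and> counters_le \<sigma>' \<and> regs \<sigma>' 7 = adr (Suc (Suc i)) 0 \<and> regs \<sigma>' 8 = Suc i * L * n * n \<and>
      regs \<sigma>' 15 = (if regs \<sigma> 15 \<le> score then score else regs \<sigma> 15) \<and>
      regs \<sigma>' 16 = (if regs \<sigma> 15 \<le> score then adr (Suc i) 0 else regs \<sigma> 16)) \<sigma>"
    (is "wp s w score_body _ ?Q \<sigma>")
proof -
  let ?I = "\<lambda>j (\<tau>::state). frame \<mu> \<tau> \<and> counters_le \<tau> \<and> regs \<tau> 7 = adr (Suc i) 0 \<and> regs \<tau> 9 = adr (Suc j) 0 \<and>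
     regs \<tau> 15 = regs \<sigma> 15 \<and> regs \<tau> 16 = regs \<sigma> 16 \<and>
     regs \<tau> 8 = (i * L + j) * n * n \<and> regs \<tau> 17 = (\<Sum>q<j. pair_score n (l i) (l q))"
  let ?E = "block [Branch Leq (Reg 15) (Reg 17)
       (block [Compute 15 Add (Reg 17) (Imm 0), Compute 16 Add (Reg 7) (Imm 0)]) Skip,
     Compute 7 Add (Reg 7) (Reg 3)]"
  have loop: "wp s w (While Less (Reg 9) (Reg 5) pair_body) (L * (75 * n + 11) + 1) (wp s w ?E 12 ?Q) \<tau>"
    if "?I 0 \<tau>" for \<tau>
  proof (rule wp_for[where I = ?I and m = L and b = "\<lambda>_. 75 * n + 10"])
    fix j and \<tau> :: state assume j: "j < L" and I: "?I j \<tau>"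
    have "regs \<tau> 17 + 6 * n * n < 2 ^ w" using I j pair_scores_bound[OF pr i, of j] by simp
    then have "wp s w pair_body (75 * n + 10) (?I (Suc j)) \<tau>"
      using I by (intro wp_mono[OF wp_pair_body[OF pr i j, of \<tau>] order.refl]) auto
    then show "cmpop_val Less (operand_val (Reg 9) \<tau>) (operand_val (Reg 5) \<tau>) \<and> wp s w pair_body (75 * n + 10) (?I (Suc j)) \<tau>"
      using I j by (simp add: frame_def regs_ok_end_def regs_ok_def)
  next
    fix \<tau> :: state assume I: "?I L \<tau>"
    have r: "regs \<tau> 3 = n" "regs \<tau> 5 = adr (Suc L) 0" using I by (simp_all add: frame_def regs_ok_end_def regs_ok_def)
    have "regs \<tau> 17 < 2 ^ w" using I pair_scores_bound[OF pr i, of L] by simp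
    moreover have "regs \<tau> 8 = Suc i * L * n * n" using I by (simp add: algebra_simps)
    ultimately have "wp s w ?E 12 ?Q \<tau>"
      using I r i by (intro wp_vc) (simp add: score_def)
    then show "\<not> cmpop_val Less (operand_val (Reg 9) \<tau>) (operand_val (Reg 5) \<tau>) \<and> wp s w ?E 12 ?Q \<tau>"
      using I r by simp
  qed (use that in auto)
  have r: "regs \<sigma> 3 = n" using fr by (simp add: frame_def regs_ok_end_def regs_ok_def)
  have "?I 0 (\<sigma>\<lparr>regs := (regs \<sigma>)(17 := 0, 9 := n)\<rparr>)"
    using fr cnt reg by (simp add: frame_def regs_ok_end_def regs_ok_def counters_le_def) (simp add: adr_def)
  note L0 = loop[OF this]
  show ?thesis unfolding score_body_def
    by (rule wp_block_Compute, rule wp_block_Compute, rule wp_block_Cons[where k = "L * (75 * n + 11) + 1" and l = 12])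
      (use L0 r in \<open>auto simp del: block.simps\<close>)
qed

lemma wp_scores:
  assumes pr: "prepared l \<mu>"
    and fr: "frame \<mu> \<sigma>" and reg: "regs \<sigma> 7 = n" "regs \<sigma> 8 = 0" "regs \<sigma> 15 = 0"
    and cnt: "counters_le \<sigma>"
  defines "score \<equiv> \<lambda>i. \<Sum>j<L. pair_score n (l i) (l j)"
  shows "wp s w (While Less (Reg 7) (Reg 5) score_body) (L * (L * (75 * n + 11) + 21) + 1)
    (\<lambda>\<sigma>'. frame \<mu> \<sigma>' \<and> (\<exists>m<L. (\<forall>i<L. score i \<le> score m) \<and> regs \<sigma>' 16 = adr (Suc m) 0)) \<sigma>"
\<comment> \<open>The invariant keeps a maximizer among the copies scored so far; before the first
  one there is none, hence the case \<open>i = 0\<close>.\<close>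
proof (rule wp_for[where m = L and b = "\<lambda>_. L * (75 * n + 11) + 20" and I = "\<lambda>i (\<sigma>::state).
    frame \<mu> \<sigma> \<and> counters_le \<sigma> \<and> regs \<sigma> 7 = adr (Suc i) 0 \<and> regs \<sigma> 8 = i * L * n * n \<and>
    (i = 0 \<and> regs \<sigma> 15 = 0 \<or> (\<exists>m<i. (\<forall>k<i. score k \<le> score m) \<and> regs \<sigma> 15 = score m \<and> regs \<sigma> 16 = adr (Suc m) 0))"])
  fix i and \<sigma> :: state assume i: "i < L" and I: "frame \<mu> \<sigma> \<and> counters_le \<sigma> \<and> regs \<sigma> 7 = adr (Suc i) 0 \<and> regs \<sigma> 8 = i * L * n * n \<and>
    (i = 0 \<and> regs \<sigma> 15 = 0 \<or> (\<exists>m<i. (\<forall>k<i. score k \<le> score m) \<and> regs \<sigma> 15 = score m \<and> regs \<sigma> 16 = adr (Suc m) 0))"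
  have "wp s w score_body (L * (75 * n + 11) + 20)
    (\<lambda>\<sigma>'. frame \<mu> \<sigma>' \<and> counters_le \<sigma>' \<and> regs \<sigma>' 7 = adr (Suc (Suc i)) 0 \<and> regs \<sigma>' 8 = Suc i * L * n * n \<and>
      regs \<sigma>' 15 = (if regs \<sigma> 15 \<le> score i then score i else regs \<sigma> 15) \<and>
      regs \<sigma>' 16 = (if regs \<sigma> 15 \<le> score i then adr (Suc i) 0 else regs \<sigma> 16)) \<sigma>"
    unfolding score_def using I by (intro wp_score_body pr i) auto
  then have "wp s w score_body (L * (75 * n + 11) + 20) (\<lambda>\<sigma>. frame \<mu> \<sigma> \<and> counters_le \<sigma> \<and> regs \<sigma> 7 = adr (Suc (Suc i)) 0 \<and>
    regs \<sigma> 8 = Suc i * L * n * n \<and> (Suc i = 0 \<and> regs \<sigma> 15 = 0 \<or>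
    (\<exists>m<Suc i. (\<forall>k<Suc i. score k \<le> score m) \<and> regs \<sigma> 15 = score m \<and> regs \<sigma> 16 = adr (Suc m) 0))) \<sigma>"
  proof (rule wp_mono[OF _ order.refl], goal_cases)
    case (1 \<tau>)
    show ?case
    proof (cases "regs \<sigma> 15 \<le> score i")
      case True
      then have "\<forall>k<Suc i. score k \<le> score i" using I by (auto simp: less_Suc_eq intro: order_trans)
      then show ?thesis using 1 True by auto
    next
      case False
      then obtain m where "m < i" "\<forall>k<i. score k \<le> score m" "regs \<sigma> 15 = score m" "regs \<sigma> 16 = adr (Suc m) 0"
        using I by auto
      then show ?thesis using 1 False by (auto simp: less_Suc_eq)
    qed
  qed
  then show "cmpop_val Less (operand_val (Reg 7) \<sigma>) (operand_val (Reg 5) \<sigma>) \<and>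
    wp s w score_body (L * (75 * n + 11) + 20) (\<lambda>\<sigma>. frame \<mu> \<sigma> \<and> counters_le \<sigma> \<and> regs \<sigma> 7 = adr (Suc (Suc i)) 0 \<and>
    regs \<sigma> 8 = Suc i * L * n * n \<and> (Suc i = 0 \<and> regs \<sigma> 15 = 0 \<or>
    (\<exists>m<Suc i. (\<forall>k<Suc i. score k \<le> score m) \<and> regs \<sigma> 15 = score m \<and> regs \<sigma> 16 = adr (Suc m) 0))) \<sigma>"
    using I i by (simp add: frame_def regs_ok_end_def regs_ok_def)
qed (use fr reg cnt L_pos in \<open>auto simp: frame_def regs_ok_end_def regs_ok_def adr_def\<close>)

lemma wp_output:
  assumes "regs_ok \<sigma>" "regs \<sigma> 16 = adr (Suc m) 0" "m < L" "regs \<sigma> 9 = 0"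
    and l: "\<And>v. v < n \<Longrightarrow> mem \<sigma> (adr (Suc m) v) = l v" "\<And>v. v < n \<Longrightarrow> l v < n"
  shows "wp s w (While Less (Reg 9) (Reg 3) output_body) (10 * n + 1) (\<lambda>\<sigma>'. \<forall>v<n. mem \<sigma>' v = l v) \<sigma>"
proof (rule wp_for[where m = n and b = "\<lambda>_. 9" and I = "\<lambda>k (\<sigma>::state). regs \<sigma> 3 = n \<and> regs \<sigma> 16 = adr (Suc m) 0 \<and>
    regs \<sigma> 9 = k \<and> (\<forall>v<n. mem \<sigma> (adr (Suc m) v) = l v) \<and> (\<forall>v<k. mem \<sigma> v = l v)"])
  fix k and \<sigma> :: state assume k: "k < n" and I: "regs \<sigma> 3 = n \<and> regs \<sigma> 16 = adr (Suc m) 0 \<and>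
    regs \<sigma> 9 = k \<and> (\<forall>v<n. mem \<sigma> (adr (Suc m) v) = l v) \<and> (\<forall>v<k. mem \<sigma> v = l v)"
  have "k < s" using adr_less_s[of k 0] k by (simp add: adr_def)
  \<comment> \<open>The output fills row 0, which meets no label row, so the source stays
    intact.\<close>
  moreover have "adr (Suc m) v \<noteq> k" for v using k by (simp add: adr_def)
  ultimately show "cmpop_val Less (operand_val (Reg 9) \<sigma>) (operand_val (Reg 3) \<sigma>) \<and>
    wp s w output_body 9 (\<lambda>\<sigma>. regs \<sigma> 3 = n \<and> regs \<sigma> 16 = adr (Suc m) 0 \<and>
    regs \<sigma> 9 = Suc k \<and> (\<forall>v<n. mem \<sigma> (adr (Suc m) v) = l v) \<and> (\<forall>v<Suc k. mem \<sigma> v = l v)) \<sigma>"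
    unfolding output_body_def using I k l(2)[OF k] assms(3)
    by (intro conjI wp_vc) (auto simp: less_Suc_eq)
qed (use assms in \<open>auto simp: regs_ok_def\<close>)

lemma wp_end:
  assumes inv: "stream_inv f Nb \<sigma>" and Nb: "\<And>i x. x < n \<Longrightarrow> Nb i x \<subseteq> {..<n}"
  shows "wp s w end_com (500 * (n * L * L)) (\<lambda>\<sigma>'. \<exists>l m. m < L \<and>
    (\<forall>i<L. \<exists>F. l i = cluster_label F \<and> (\<forall>v<n. lowest (\<lambda>u. f (adr (Suc i) u)) (Nb i v) (F v))) \<and>
    (\<forall>i<L. (\<Sum>j<L. pair_score n (l i) (l j)) \<le> (\<Sum>j<L. pair_score n (l m) (l j))) \<and>
    (\<forall>v<n. mem \<sigma>' v = l m v)) \<sigma>"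
    (is "wp s w end_com _ ?Q \<sigma>")
proof -
  define F where "F i v = mem \<sigma> (adr (Suc (i + L)) v)" for i v
  define l where "l i = cluster_label (F i)" for i
  have low: "lowest (\<lambda>u. f (adr (Suc i) u)) (Nb i v) (F i v)" if "i < L" "v < n" for i v
    using inv that by (simp add: stream_inv_def F_def)
  have F: "F i v < n" if "i < L" "v < n" for i v
    using low[OF that] Nb[OF that(2), of i] by (auto simp: lowest_def)
  have ln: "l i v < n" if "i < L" "v < n" for i v
    using F that by (auto simp: l_def cluster_label_def)
  have zero: "mem \<sigma> x = 0" if "adr (Suc (2 * L)) 0 \<le> x" for x using inv that by (simp add: stream_inv_def)
  have ok: "regs_ok \<sigma>" using inv by (simp add: stream_inv_def)
  define \<tau> where "\<tau> = \<sigma>\<lparr>regs := (regs \<sigma>)(14 := adr (Suc (4 * L)) 0, 20 := L * n * 3, 7 := n)\<rparr>"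
  have base: "L * n * 4 + n = adr (Suc (4 * L)) 0" by (simp add: adr_def)
  have ci: "classify_inv F (\<lambda>i. 0) \<tau>"
    unfolding classify_inv_def classified_def
  proof (intro conjI allI impI)
    show "regs_ok_end \<tau>" using ok by (simp add: regs_ok_end_def regs_ok_def \<tau>_def)
    show "mem \<tau> x = 0" if "adr (Suc (4 * L)) 0 \<le> x" for x
    proof -
      have "adr (Suc (2 * L)) 0 \<le> adr (Suc (4 * L)) 0" by (simp add: adr_def)
      then show ?thesis using zero that by (simp add: \<tau>_def)
    qed
    fix i p assume "i < L" "p < n"
    have "adr (Suc (2 * L)) 0 \<le> adr (Suc (i + L + L)) p" by (simp add: adr_def algebra_simps)
    then have "mem \<tau> (adr (Suc (i + L + L)) p) = 0" using zero by (simp add: \<tau>_def)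
    then show "linked (\<lambda>v. mem \<tau> (adr (Suc (i + 3 * L)) v)) (mem \<tau> (adr (Suc (i + L + L)) p))
       (group_list (cluster_label (F i)) 0 p)"
      by (simp add: group_list_def)
  qed (simp_all add: F_def \<tau>_def)
  let ?O = "block [Compute 9 Add (Imm 0) (Imm 0), While Less (Reg 9) (Reg 3) output_body]"
  let ?S = "block [Compute 15 Add (Imm 0) (Imm 0), Compute 8 Add (Imm 0) (Imm 0), Compute 7 Add (Reg 3) (Imm 0),
     While Less (Reg 7) (Reg 5) score_body, Compute 9 Add (Imm 0) (Imm 0), While Less (Reg 9) (Reg 3) output_body]"
  have S: "wp s w ?S (L * (L * (75 * n + 11) + 21) + 10 * n + 20) ?Q \<rho>" if ci: "classify_inv F (\<lambda>i. n) \<rho>" for \<rho>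
  proof -
    define \<mu> where "\<mu> = mem \<rho>"
    have pr: "prepared l \<mu>" using ci ln by (simp add: classify_inv_def prepared_def l_def \<mu>_def)
    define \<rho>' where "\<rho>' = \<rho>\<lparr>regs := (regs \<rho>)(15 := 0, 8 := 0, 7 := n)\<rparr>"
    have r: "regs \<rho> 3 = n" using ci by (simp add: classify_inv_def regs_ok_end_def regs_ok_def)
    have "frame \<mu> \<rho>'" using ci by (simp add: classify_inv_def frame_def regs_ok_end_def regs_ok_def \<rho>'_def \<mu>_def)
    moreover have "counters_le \<rho>'"
      using ci by (auto simp: classify_inv_def counters_le_def \<rho>'_def adr_def)
    ultimately have sc: "wp s w (While Less (Reg 7) (Reg 5) score_body) (L * (L * (75 * n + 11) + 21) + 1)
      (\<lambda>\<sigma>'. frame \<mu> \<sigma>' \<and> (\<exists>m<L. (\<forall>i<L. (\<Sum>j<L. pair_score n (l i) (l j)) \<le> (\<Sum>j<L. pair_score n (l m) (l j))) \<and>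
        regs \<sigma>' 16 = adr (Suc m) 0)) \<rho>'"
      using pr by (intro wp_scores) (auto simp: \<rho>'_def)
    have "wp s w (While Less (Reg 7) (Reg 5) score_body) (L * (L * (75 * n + 11) + 21) + 1) (wp s w ?O (10 * n + 6) ?Q) \<rho>'"
    proof (rule wp_mono[OF sc order.refl])
      fix \<sigma>' :: state assume "frame \<mu> \<sigma>' \<and> (\<exists>m<L. (\<forall>i<L. (\<Sum>j<L. pair_score n (l i) (l j)) \<le> (\<Sum>j<L. pair_score n (l m) (l j))) \<and>
        regs \<sigma>' 16 = adr (Suc m) 0)"
      then obtain m where fr: "frame \<mu> \<sigma>'" and m: "m < L"
        "\<forall>i<L. (\<Sum>j<L. pair_score n (l i) (l j)) \<le> (\<Sum>j<L. pair_score n (l m) (l j))" "regs \<sigma>' 16 = adr (Suc m) 0"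
        by blast
      have "wp s w (While Less (Reg 9) (Reg 3) output_body) (10 * n + 1) (\<lambda>\<sigma>'. \<forall>v<n. mem \<sigma>' v = l m v)
        (\<sigma>'\<lparr>regs := (regs \<sigma>')(9 := 0)\<rparr>)"
      proof (rule wp_output)
        show "mem (\<sigma>'\<lparr>regs := (regs \<sigma>')(9 := 0)\<rparr>) (adr (Suc m) v) = l m v" if "v < n" for v
          using frame_mem[OF fr that, of "Suc m"] pr m(1) that by (simp add: prepared_def classified_def)
      qed (use fr m ln in \<open>auto simp: frame_def regs_ok_end_def regs_ok_def\<close>)
      then have "wp s w (While Less (Reg 9) (Reg 3) output_body) (10 * n + 1) ?Q (\<sigma>'\<lparr>regs := (regs \<sigma>')(9 := 0)\<rparr>)"
        by (rule wp_mono[OF _ order.refl]) (use m low l_def in blast)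
      then show "wp s w ?O (10 * n + 6) ?Q \<sigma>'"
        by (intro wp_block_Compute wp_block_last) auto
    qed
    then show ?thesis
      by (intro wp_block_Compute wp_block_Cons[where k = "L * (L * (75 * n + 11) + 21) + 1" and l = "10 * n + 6"])
        (use r in \<open>auto simp: \<rho>'_def simp del: block.simps\<close>)
  qed
  have "wp s w (While Less (Reg 7) (Reg 5) classify_copy) (L * (41 * n + 11) + 1)
      (wp s w ?S (L * (L * (75 * n + 11) + 21) + 10 * n + 20) ?Q) \<tau>"
    by (rule wp_mono[OF wp_classify[OF ci] order.refl]) (use F S in \<open>auto simp: \<tau>_def simp del: block.simps\<close>)
  moreover have "L * (41 * n + 11) + 1 + (L * (L * (75 * n + 11) + 21) + 10 * n + 20) + 10 \<le> 500 * (n * L * L)"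
  proof -
    \<comment> \<open>Both \<open>n\<close> and \<open>L\<close> are positive, so each lower
      monomial is at most \<open>n * L * L\<close>; the coefficients add up to 200.\<close>
    have "1 \<le> n * L * L" "L \<le> n * L * L" "n \<le> n * L * L" "L * n \<le> n * L * L" "L * L \<le> n * L * L"
      using n_pos L_pos by (auto simp: Suc_le_eq)
    moreover have "L * (41 * n + 11) + 1 + (L * (L * (75 * n + 11) + 21) + 10 * n + 20) + 10
        = 75 * (n * L * L) + 41 * (L * n) + 11 * (L * L) + 32 * L + 10 * n + 31"
      by (simp add: algebra_simps)
    ultimately show ?thesis by linarith
  qed
  ultimately have "wp s w end_com (L * (41 * n + 11) + 1 + (L * (L * (75 * n + 11) + 21) + 10 * n + 20) + 10) ?Q \<sigma>"
    unfolding end_com_def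
    by (intro wp_block_Compute wp_block_Cons[where k = "L * (41 * n + 11) + 1" and l = "L * (L * (75 * n + 11) + 21) + 10 * n + 20"])
      (use ok base in \<open>simp_all add: regs_ok_def \<tau>_def del: block.simps\<close>)
  then show ?thesis using \<open>_ \<le> 500 * (n * L * L)\<close> by (rule wp_mono)
qed

end

section \<open>The algorithm\<close>

lemma rel_dist_cong:
  assumes "\<And>u v. u \<in> V \<Longrightarrow> v \<in> V \<Longrightarrow> R u v = R' u v"
  shows "rel_dist V R S = rel_dist V R' S"
  unfolding rel_dist_def using assms by (intro arg_cong[of _ _ card]) auto

lemma lowest_cong:
  assumes "\<And>x. x \<in> S \<Longrightarrow> f x = g x"
  shows "lowest f S p = lowest g S p"
  using assms by (auto simp: lowest_def)

definition plus_nbhd :: "nat \<Rightarrow> (nat set \<Rightarrow> label) \<Rightarrow> nat \<Rightarrow> nat set" where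
  "plus_nbhd n lab v = {u. u < n \<and> plus_rel lab v u}"

interpretation plus_graph "{..<n}" "plus_nbhd n lab" for n lab
  by unfold_locales (auto simp: plus_nbhd_def plus_rel_def insert_commute)

text \<open>Without ties the lowest vertex is unique, so the \<open>p\<close> in
  \<open>together\<close> can only be \<open>F u = F v\<close>, and it is lowest in its own
  neighbourhood iff it points to itself.\<close>

lemma label_rel_iff_together:
  assumes inj: "inj_on g {..<n}" and F: "\<And>v. v < n \<Longrightarrow> lowest g (plus_nbhd n lab v) (F v)"
    and u: "u < n" and v: "v < n"
  shows "label_rel (cluster_label F) u v \<longleftrightarrow> together n lab g u v"
proof -
  have Fn: "F x < n" if "x < n" for x using F[OF that] by (simp add: lowest_def plus_nbhd_def)
  have uniq: "p = F x" if "x < n" "lowest g (plus_nbhd n lab x) p" for x p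
    using lowest_unique[OF inj _ that(2) F[OF that(1)]] by (auto simp: plus_nbhd_def)
  have "together n lab g u v \<longleftrightarrow> u = v \<or> (F u = F v \<and> F (F u) = F u)"
  proof (cases "u = v")
    case False
    have "(\<exists>p. lowest g (plus_nbhd n lab u) p \<and> lowest g (plus_nbhd n lab v) p \<and> lowest g (plus_nbhd n lab p) p)
        \<longleftrightarrow> F u = F v \<and> F (F u) = F u"
    proof
      assume "\<exists>p. lowest g (plus_nbhd n lab u) p \<and> lowest g (plus_nbhd n lab v) p \<and> lowest g (plus_nbhd n lab p) p"
      then obtain p where p: "lowest g (plus_nbhd n lab u) p" "lowest g (plus_nbhd n lab v) p" "lowest g (plus_nbhd n lab p) p"
        by blast
      have "p = F u" "p = F v" using uniq u v p by auto
      then show "F u = F v \<and> F (F u) = F u" using uniq[OF Fn[OF u]] p(3) by auto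
    next
      assume "F u = F v \<and> F (F u) = F u"
      then show "\<exists>p. lowest g (plus_nbhd n lab u) p \<and> lowest g (plus_nbhd n lab v) p \<and> lowest g (plus_nbhd n lab p) p"
        using F[OF u] F[OF v] F[OF Fn[OF u]] by (intro exI[of _ "F u"]) auto
    qed
    then show ?thesis using False by (simp add: together_def)
  qed (simp add: together_def)
  then show ?thesis by (auto simp: label_rel_def cluster_label_def)
qed

lemma output_clustering_label:
  assumes "\<And>v. v < n \<Longrightarrow> mem \<sigma> v = l v"
  shows "partition_on {..<n} (output_clustering n \<sigma>)"
    and "u < n \<Longrightarrow> v < n \<Longrightarrow> same_cluster (output_clustering n \<sigma>) {u, v} \<longleftrightarrow> label_rel l u v"
proof -
  show "partition_on {..<n} (output_clustering n \<sigma>)"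
    by (rule partition_onI) (auto simp: output_clustering_def disjnt_def)
  show "u < n \<Longrightarrow> v < n \<Longrightarrow> same_cluster (output_clustering n \<sigma>) {u, v} \<longleftrightarrow> label_rel l u v"
    using assms by (auto simp: same_cluster_iff output_clustering_def label_rel_def)
qed

text \<open>The factor 2 converts the optimal cost into a distance, which counts ordered
  pairs.\<close>

definition unlucky :: "nat \<Rightarrow> (nat set \<Rightarrow> label) \<Rightarrow> (nat \<Rightarrow> nat) set" where
  "unlucky n lab = {g \<in> {..<n} \<rightarrow>\<^sub>E {..<512 * n\<^sup>2}. inj_on g {..<n} \<longrightarrow>
     rel_dist {..<n} (together n lab g) (plus_rel lab) > 6144 * (2 * opt_cost {..<n} lab)}"

lemma rel_dist_plus_nbhd:
  "rel_dist {..<n} R (\<lambda>u v. v \<in> plus_nbhd n lab u) = rel_dist {..<n} R (plus_rel lab)"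
  unfolding rel_dist_def by (rule arg_cong[of _ _ card]) (auto simp: plus_nbhd_def)

text \<open>An optimal clustering serves as the symmetric and transitive relation of the charging
  argument.\<close>

lemma card_unlucky_le:
  assumes "n > 0"
  shows "256 * card (unlucky n lab) \<le> (512 * n\<^sup>2) ^ n"
proof -
  obtain \<C> where \<C>: "partition_on {..<n} \<C>" "cost {..<n} lab \<C> = opt_cost {..<n} lab"
    using opt_cost_attained by blast
  let ?R = "\<lambda>u v. same_cluster \<C> {u, v}"
  have trans: "?R a c" if "?R a b" "?R b c" for a b c
  proof -
    obtain A B where "A \<in> \<C>" "B \<in> \<C>" "a \<in> A" "b \<in> A" "b \<in> B" "c \<in> B"
      using \<open>?R a b\<close> \<open>?R b c\<close> by (auto simp: same_cluster_iff)
    moreover from this have "A = B" using \<C>(1) by (metis disjointD IntI empty_iff partition_onD2)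
    ultimately show ?thesis by (auto simp: same_cluster_iff)
  qed
  have sym: "?R b a" if "?R a b" for a b using that by (simp add: insert_commute)
  have R: "rel_dist {..<n} ?R (plus_rel lab) = 2 * opt_cost {..<n} lab"
    using twice_cost[OF finite_lessThan \<C>(1), of lab] \<C>(2) by simp
  have "256 * card {f \<in> {..<n} \<rightarrow>\<^sub>E {..<512 * n\<^sup>2}. inj_on f {..<n} \<longrightarrow>
      rel_dist {..<n} (together n lab f) (\<lambda>u v. v \<in> plus_nbhd n lab u)
      > 6144 * rel_dist {..<n} ?R (\<lambda>u v. v \<in> plus_nbhd n lab u)} \<le> (512 * n\<^sup>2) ^ card {..<n}"
    by (rule card_unlucky) (erule (1) trans, erule sym, use assms in auto)
  then show ?thesis by (simp only: rel_dist_plus_nbhd R unlucky_def card_lessThan)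
qed

section \<open>A complete run\<close>

context layout
begin

definition ranks_space :: "(nat \<Rightarrow> nat) set" where
  "ranks_space = {n..<Suc L * n} \<rightarrow>\<^sub>E {..<512 * n\<^sup>2}"

text \<open>The preparation before the draws and the filling of the pointers after them are
  deterministic, so the state after initialization is a function of the uniform table
  \<open>f\<close>.\<close>

lemma exec_start:
  assumes "L = copies c n" "1000 * (n * L * L) \<le> t"
  obtains S where "exec s w t [start_com c] (start_state n) = map_spmf S (spmf_of_set ranks_space)"
    "\<And>f. stream_inv f (\<lambda>i v. {v}) (S f)"
proof -
  let ?post = "block [Compute 7 Add (Reg 3) (Imm 0), init_com]"
  let ?e = "Suc L * n"
  have e: "adr (Suc L) 0 = ?e" by (simp add: adr_def)
  have "1 \<le> n * L * L" "n \<le> n * L * L" "L * n \<le> n * L * L" using n_pos L_pos by (auto simp: Suc_le_eq)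
  then have T: "6 * n + 20 * (L * n) + 100 \<le> t" using assms(2) by linarith
  obtain t1 \<sigma> where \<sigma>: "t - Suc (5 + 6 * n + 40) \<le> t1"
    "regs_ok \<sigma> \<and> regs \<sigma> 7 = n \<and> regs \<sigma> 8 = 512 * n\<^sup>2 \<and> regs \<sigma> 9 = 0 \<and> mem \<sigma> = (\<lambda>_. 0)"
    "exec s w t (Seq (prep_com c) (Seq random_fill ?post) # []) (start_state n) = exec s w t1 (Seq random_fill ?post # []) \<sigma>"
    using exec_Seq_wp[OF wp_prep[OF assms(1)], of t "Seq random_fill ?post" "[]"] T by auto
  have t1: "20 * (L * n) + 50 \<le> t1" using \<sigma>(1) T by linarith
  then obtain t2 where t2: "t1 = Suc t2" by (cases t1) auto
  have "exec s w t1 (Seq random_fill ?post # []) \<sigma> = exec s w t2 (random_fill # [?post]) \<sigma>" by (simp add: t2)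
  also have "\<dots> = bind_spmf (spmf_of_set ({n..<?e} \<rightarrow>\<^sub>E {..<512 * n\<^sup>2}))
     (\<lambda>f. exec s w (t2 - (10 * (?e - n) + 1)) [?post] (filled n ?e f \<sigma>))"
  proof (rule exec_random_fill)
    show "512 * n\<^sup>2 < 2 ^ w" "?e \<le> s" "?e < 2 ^ w" using word_bounds memory by (auto simp: power2_eq_square algebra_simps)
    show "10 * (?e - n) + 1 \<le> t2" using t1 t2 by simp
  qed (use \<sigma>(2) n_pos in \<open>auto simp: regs_ok_def adr_def\<close>)
  finally have run: "exec s w t [start_com c] (start_state n) = bind_spmf (spmf_of_set ranks_space)
     (\<lambda>f. exec s w (t2 - (10 * (?e - n) + 1)) [?post] (filled n ?e f \<sigma>))"
    using \<sigma>(3) by (simp only: start_com_def ranks_space_def)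
  have "\<exists>\<tau>. exec s w (t2 - (10 * (?e - n) + 1)) [?post] (filled n ?e f \<sigma>) = return_spmf \<tau> \<and> stream_inv f (\<lambda>i v. {v}) \<tau>" for f
  proof -
    have "wp s w ?post (10 * (L * n) + 10) (stream_inv f (\<lambda>i v. {v})) (filled n ?e f \<sigma>)"
      by (rule wp_init) (use \<sigma>(2) in \<open>auto simp: filled_def regs_ok_def e\<close>)
    moreover have "10 * (L * n) + 10 \<le> t2 - (10 * (?e - n) + 1)" using t1 t2 by simp
    ultimately show ?thesis by (rule exec_wp) blast
  qed
  then obtain S where "\<And>f. exec s w (t2 - (10 * (?e - n) + 1)) [?post] (filled n ?e f \<sigma>) = return_spmf (S f)"
    "\<And>f. stream_inv f (\<lambda>i v. {v}) (S f)" by metis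
  then show ?thesis using run that by (simp add: map_spmf_conv_bind_spmf)
qed

definition nbhds :: "(nat \<times> nat \<times> label) list \<Rightarrow> nat \<Rightarrow> nat \<Rightarrow> nat set" where
  "nbhds xs i v = insert v {u. (u, v, Plus) \<in> set xs \<or> (v, u, Plus) \<in> set xs}"

lemma wp_edge:
  assumes inv: "stream_inv f (nbhds ys) \<sigma>" and f: "\<And>x. n \<le> x \<Longrightarrow> x < adr (Suc L) 0 \<Longrightarrow> f x < 2 ^ w"
    and ys: "\<And>a b l'. (a, b, l') \<in> set ys \<Longrightarrow> a < n \<and> b < n" and uv: "u < n" "v < n" "u \<noteq> v"
  shows "wp s w edge_com (80 * L + 15) (stream_inv f (nbhds (ys @ [(u, v, l)]))) (feed (u, v, l) \<sigma>)"
proof -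
  have inv': "stream_inv f (nbhds ys) (feed (u, v, l) \<sigma>)"
    using inv by (simp add: stream_inv_def regs_ok_def)
  have sub: "nbhds ys i x \<subseteq> {..<n}" if "x < n" for i x using ys that by (auto simp: nbhds_def)
  show ?thesis
  proof (cases l)
    case Plus
    let ?W = "block [Compute 7 Add (Reg 3) (Imm 0), While Less (Reg 7) (Reg 5)
       (block [half_edge 0 1, half_edge 1 0, Compute 7 Add (Reg 7) (Reg 3)])]"
    have eq: "(\<lambda>i. (nbhds ys i)(u := insert v (nbhds ys i u), v := insert u (nbhds ys i v))) = nbhds (ys @ [(u, v, l)])"
      using uv Plus by (auto simp: nbhds_def fun_eq_iff)
    have "wp s w ?W (80 * L + 10) (stream_inv f (nbhds (ys @ [(u, v, l)]))) (feed (u, v, l) \<sigma>)"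
      unfolding eq[symmetric] by (rule wp_edge_plus[OF inv']) (use f sub uv in auto)
    then obtain k \<tau> where k: "k \<le> 80 * L + 10" "runs s w ?W (feed (u, v, l) \<sigma>) k \<tau>" "stream_inv f (nbhds (ys @ [(u, v, l)])) \<tau>"
      by (auto simp: wp_def simp del: block.simps)
    have "runs s w edge_com (feed (u, v, l) \<sigma>) (Suc k) \<tau>"
      by (rule runs_then[OF _ k(2)]) (simp add: edge_com_def Plus del: block.simps)
    then show ?thesis unfolding wp_def using k by (intro exI[of _ "Suc k"] exI[of _ \<tau>]) auto
  next
    case Minus
    then have "nbhds (ys @ [(u, v, l)]) = nbhds ys" by (auto simp: nbhds_def fun_eq_iff)
    then show ?thesis using inv' Minus unfolding edge_com_def by (intro wp_vc) simp
  qed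
qed

lemma process_stream_inv:
  assumes f: "\<And>x. n \<le> x \<Longrightarrow> x < adr (Suc L) 0 \<Longrightarrow> f x < 2 ^ w"
    and "stream_inv f (nbhds ys) \<sigma>" and "\<And>a b l'. (a, b, l') \<in> set (ys @ xs) \<Longrightarrow> a < n \<and> b < n \<and> a \<noteq> b"
    and t: "80 * L + 15 \<le> t"
  shows "\<exists>\<sigma>'. process_stream s w t edge_com xs \<sigma> = return_spmf \<sigma>' \<and> stream_inv f (nbhds (ys @ xs)) \<sigma>'"
  using assms(2,3)
proof (induction xs arbitrary: ys \<sigma>)
  case (Cons e xs)
  obtain u v l where e: "e = (u, v, l)" by (cases e)
  have "wp s w edge_com (80 * L + 15) (stream_inv f (nbhds (ys @ [(u, v, l)]))) (feed (u, v, l) \<sigma>)"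
    using Cons.prems by (intro wp_edge f) (auto simp: e)
  then obtain \<tau> where \<tau>: "exec s w t [edge_com] (feed (u, v, l) \<sigma>) = return_spmf \<tau>" "stream_inv f (nbhds (ys @ [e])) \<tau>"
    using t unfolding e by (rule exec_wp)
  have "\<exists>\<sigma>'. process_stream s w t edge_com xs \<tau> = return_spmf \<sigma>' \<and> stream_inv f (nbhds ((ys @ [e]) @ xs)) \<sigma>'"
    using Cons.prems(2) by (intro Cons.IH \<tau>(2)) auto
  then show ?case using \<tau>(1) by (simp add: e)
qed auto

text \<open>Every edge occurs in the stream in one of its two orientations, which
  \<open>nbhds\<close> does not distinguish.\<close>

lemma nbhds_edge_stream:
  assumes "edge_stream n lab xs" "v < n"
  shows "nbhds xs i v = plus_nbhd n lab v"
proof -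
  have lab: "l = lab {a, b}" if "(a, b, l) \<in> set xs" for a b l
    using assms(1) that by (auto simp: edge_stream_def)
  have in_edges: "{a, b} \<in> edges {..<n}" if "(a, b, l) \<in> set xs" for a b l
  proof -
    have "{a, b} \<in> (\<lambda>(u, v, l). {u, v}) ` set xs" using that by force
    then show ?thesis using assms(1) by (simp add: edge_stream_def)
  qed
  have "(u, v, Plus) \<in> set xs \<or> (v, u, Plus) \<in> set xs \<longleftrightarrow> u < n \<and> u \<noteq> v \<and> lab {v, u} = Plus" for u
  proof
    assume "(u, v, Plus) \<in> set xs \<or> (v, u, Plus) \<in> set xs"
    then show "u < n \<and> u \<noteq> v \<and> lab {v, u} = Plus"
      using lab[of u v Plus] lab[of v u Plus] in_edges[of u v Plus] in_edges[of v u Plus]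
      by (auto simp: edges_def insert_commute card_insert_if)
  next
    assume u: "u < n \<and> u \<noteq> v \<and> lab {v, u} = Plus"
    then have "{v, u} \<in> edges {..<n}" using assms(2) by (auto simp: edges_def)
    then have "{v, u} \<in> (\<lambda>(u, v, l). {u, v}) ` set xs" using assms(1) by (simp add: edge_stream_def)
    then obtain a b l where abl: "(a, b, l) \<in> set xs" "{v, u} = {a, b}" by auto
    moreover have "l = Plus" using lab[OF abl(1)] abl(2) u by simp
    ultimately show "(u, v, Plus) \<in> set xs \<or> (v, u, Plus) \<in> set xs" by (auto simp: doubleton_eq_iff)
  qed
  then show ?thesis using assms(2) by (auto simp: nbhds_def plus_nbhd_def plus_rel_def)
qed

text \<open>A lucky copy lies within \<open>?r\<close> of \<open>plus_rel lab\<close>. With at most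
  a quarter unlucky, the copy of highest score, being a one-median, lies within
  \<open>7 * ?r\<close>; halving distances back to costs gives
  \<open>43008 = 7 * 6144\<close>.\<close>

lemma good_output:
  assumes f: "f \<in> ranks_space" and few: "4 * card {i. i < L \<and> copy_of n f i \<in> unlucky n lab} \<le> L"
    and m: "m < L"
    and l: "\<And>i. i < L \<Longrightarrow> \<exists>F. l i = cluster_label F \<and> (\<forall>v<n. lowest (\<lambda>u. f (adr (Suc i) u)) (plus_nbhd n lab v) (F v))"
    and max: "\<And>i. i < L \<Longrightarrow> (\<Sum>j<L. pair_score n (l i) (l j)) \<le> (\<Sum>j<L. pair_score n (l m) (l j))"
    and out: "\<And>v. v < n \<Longrightarrow> mem \<sigma> v = l m v"
  shows "approx_clustering 43008 {..<n} lab (output_clustering n \<sigma>)"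
proof -
  let ?r = "6144 * (2 * opt_cost {..<n} lab)"
  have copy: "copy_of n f i v = f (adr (Suc i) v)" if "v < n" for i v
    using that by (simp add: copy_of_def adr_def)
  have near: "rel_dist {..<n} (label_rel (l i)) (plus_rel lab) \<le> ?r"
    if i: "i < L" and lucky: "copy_of n f i \<notin> unlucky n lab" for i
  proof -
    obtain F where F: "l i = cluster_label F" "\<forall>v<n. lowest (\<lambda>u. f (adr (Suc i) u)) (plus_nbhd n lab v) (F v)"
      using l[OF i] by blast
    have "copy_of n f i v < 512 * n\<^sup>2" if "v < n" for v
    proof -
      have "adr (Suc i) v < adr (Suc L) 0" using that i by (intro adr_less) auto
      then have "adr (Suc i) v \<in> {n..<Suc L * n}" by (simp add: adr_def)
      then have "f (adr (Suc i) v) < 512 * n\<^sup>2" using f unfolding ranks_space_def by blast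
      then show ?thesis using copy[OF that] by simp
    qed
    then have "copy_of n f i \<in> {..<n} \<rightarrow>\<^sub>E {..<512 * n\<^sup>2}"
      by (auto simp: copy_of_def)
    then have inj: "inj_on (copy_of n f i) {..<n}"
      and far: "rel_dist {..<n} (together n lab (copy_of n f i)) (plus_rel lab) \<le> ?r"
      using lucky by (auto simp: unlucky_def)
    have low: "lowest (copy_of n f i) (plus_nbhd n lab v) (F v)" if "v < n" for v
    proof -
      have "lowest (copy_of n f i) (plus_nbhd n lab v) (F v) = lowest (\<lambda>u. f (adr (Suc i) u)) (plus_nbhd n lab v) (F v)"
        by (rule lowest_cong) (simp add: copy plus_nbhd_def)
      then show ?thesis using F(2) that by simp
    qed
    have "rel_dist {..<n} (label_rel (l i)) (plus_rel lab) = rel_dist {..<n} (together n lab (copy_of n f i)) (plus_rel lab)"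
      by (rule rel_dist_cong) (use label_rel_iff_together[OF inj low] F(1) in auto)
    then show ?thesis using far by simp
  qed
  have ln: "l i v < n" if i: "i < L" and v: "v < n" for i v
  proof -
    obtain F where F: "l i = cluster_label F" "\<forall>v<n. lowest (\<lambda>u. f (adr (Suc i) u)) (plus_nbhd n lab v) (F v)"
      using l[OF i] by blast
    then have "F v < n" using v by (auto simp: lowest_def plus_nbhd_def)
    then show ?thesis using v F(1) by (simp add: cluster_label_def)
  qed
  have "rel_dist {..<n} (label_rel (l m)) (plus_rel lab) \<le> 7 * ?r"
  proof (rule one_median_near[where x = "\<lambda>i. label_rel (l i)" and d = "rel_dist {..<n}" and L = L])
    show "(\<Sum>j<L. rel_dist {..<n} (label_rel (l m)) (label_rel (l j))) \<le> (\<Sum>j<L. rel_dist {..<n} (label_rel (l i)) (label_rel (l j)))"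
      if "i < L" for i using ln m that max[OF that] by (intro score_max_dist_min) auto
    have "card {i. i < L \<and> rel_dist {..<n} (label_rel (l i)) (plus_rel lab) > ?r} \<le> card {i. i < L \<and> copy_of n f i \<in> unlucky n lab}"
    proof (rule card_mono)
      show "{i. i < L \<and> rel_dist {..<n} (label_rel (l i)) (plus_rel lab) > ?r} \<subseteq> {i. i < L \<and> copy_of n f i \<in> unlucky n lab}"
      proof
        fix i assume "i \<in> {i. i < L \<and> rel_dist {..<n} (label_rel (l i)) (plus_rel lab) > ?r}"
        then show "i \<in> {i. i < L \<and> copy_of n f i \<in> unlucky n lab}"
          using near[of i] by (cases "copy_of n f i \<in> unlucky n lab") auto
      qed
    qed simp
    then show "4 * card {i. i < L \<and> rel_dist {..<n} (label_rel (l i)) (plus_rel lab) > ?r} \<le> L" using few by simp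
  qed (use m in \<open>auto intro: rel_dist_triangle rel_dist_commute\<close>)
  moreover have part: "partition_on {..<n} (output_clustering n \<sigma>)" using out by (rule output_clustering_label(1))
  have "2 * cost {..<n} lab (output_clustering n \<sigma>) = rel_dist {..<n} (label_rel (l m)) (plus_rel lab)"
    unfolding twice_cost[OF finite_lessThan part]
    by (rule rel_dist_cong) (use output_clustering_label(2)[of n \<sigma> "l m", OF out] in auto)
  ultimately have "cost {..<n} lab (output_clustering n \<sigma>) \<le> 43008 * opt_cost {..<n} lab" by simp
  then show ?thesis using part unfolding approx_clustering_def by (metis of_nat_le_iff of_nat_mult of_nat_numeral)
qed

text \<open>For fixed ranks, stream processing and post-processing yield a single state, so the
  final state can be chosen as a function of the ranks and the run becomes the image of one uniform
  draw.\<close>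

lemma run_alg_eq:
  assumes L: "L = copies c n" and xs: "edge_stream n lab xs"
    and t: "80 * L + 15 \<le> t" and T: "1000 * (n * L * L) \<le> T"
  obtains out where "run_alg s w t T (Stream_Alg (start_com c) edge_com end_com) n xs = map_spmf out (spmf_of_set ranks_space)"
    "\<And>f. f \<in> ranks_space \<Longrightarrow> 4 * card {i. i < L \<and> copy_of n f i \<in> unlucky n lab} \<le> L \<Longrightarrow>
       approx_clustering 43008 {..<n} lab (out f)"
proof -
  obtain S where S: "exec s w T [start_com c] (start_state n) = map_spmf S (spmf_of_set ranks_space)"
    "\<And>f. stream_inv f (\<lambda>i v. {v}) (S f)" using exec_start[OF L T] by blast
  have xs': "a < n \<and> b < n \<and> a \<noteq> b" if "(a, b, l) \<in> set xs" for a b l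
  proof -
    have "{a, b} \<in> (\<lambda>(u, v, l). {u, v}) ` set xs" using that by force
    then have "{a, b} \<in> edges {..<n}" using xs by (simp add: edge_stream_def)
    then show ?thesis by (auto simp: edges_def card_insert_if split: if_splits)
  qed
  let ?run = "\<lambda>f. bind_spmf (process_stream s w t edge_com xs (S f)) (\<lambda>\<sigma>\<^sub>1. exec s w T [end_com] \<sigma>\<^sub>1)"
  let ?good = "\<lambda>f \<sigma>. 4 * card {i. i < L \<and> copy_of n f i \<in> unlucky n lab} \<le> L \<longrightarrow>
     approx_clustering 43008 {..<n} lab (output_clustering n \<sigma>)"
  have "\<forall>f\<in>ranks_space. \<exists>\<sigma>. ?run f = return_spmf \<sigma> \<and> ?good f \<sigma>"
  proof
    fix f assume f: "f \<in> ranks_space"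
    have fw: "f x < 2 ^ w" if "n \<le> x" "x < adr (Suc L) 0" for x
    proof -
      have "x \<in> {n..<Suc L * n}" using that by (simp add: adr_def)
      then have "f x < 512 * n\<^sup>2" using f unfolding ranks_space_def by blast
      then show ?thesis using word_bounds by (simp add: power2_eq_square)
    qed
    have "nbhds [] = (\<lambda>i v. {v})" by (simp add: nbhds_def fun_eq_iff)
    then have "stream_inv f (nbhds []) (S f)" using S(2) by simp
    from process_stream_inv[OF fw this, of xs t]
    obtain \<sigma>1 where \<sigma>1: "process_stream s w t edge_com xs (S f) = return_spmf \<sigma>1" "stream_inv f (nbhds xs) \<sigma>1"
      using xs' t by auto
    have "wp s w end_com (500 * (n * L * L)) (\<lambda>\<sigma>'. \<exists>l m. m < L \<and>
      (\<forall>i<L. \<exists>F. l i = cluster_label F \<and> (\<forall>v<n. lowest (\<lambda>u. f (adr (Suc i) u)) (nbhds xs i v) (F v))) \<and>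
      (\<forall>i<L. (\<Sum>j<L. pair_score n (l i) (l j)) \<le> (\<Sum>j<L. pair_score n (l m) (l j))) \<and>
      (\<forall>v<n. mem \<sigma>' v = l m v)) \<sigma>1"
      by (rule wp_end[OF \<sigma>1(2)]) (auto simp: nbhds_edge_stream[OF xs] plus_nbhd_def)
    moreover have "500 * (n * L * L) \<le> T" using T by linarith
    ultimately obtain \<sigma>2 where \<sigma>2: "exec s w T [end_com] \<sigma>1 = return_spmf \<sigma>2" "\<exists>l m. m < L \<and>
      (\<forall>i<L. \<exists>F. l i = cluster_label F \<and> (\<forall>v<n. lowest (\<lambda>u. f (adr (Suc i) u)) (nbhds xs i v) (F v))) \<and>
      (\<forall>i<L. (\<Sum>j<L. pair_score n (l i) (l j)) \<le> (\<Sum>j<L. pair_score n (l m) (l j))) \<and>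
      (\<forall>v<n. mem \<sigma>2 v = l m v)" by (rule exec_wp)
    obtain l m where lm: "m < L"
      "\<forall>i<L. \<exists>F. l i = cluster_label F \<and> (\<forall>v<n. lowest (\<lambda>u. f (adr (Suc i) u)) (nbhds xs i v) (F v))"
      "\<forall>i<L. (\<Sum>j<L. pair_score n (l i) (l j)) \<le> (\<Sum>j<L. pair_score n (l m) (l j))"
      "\<forall>v<n. mem \<sigma>2 v = l m v" using \<sigma>2(2) by blast
    have "approx_clustering 43008 {..<n} lab (output_clustering n \<sigma>2)"
      if "4 * card {i. i < L \<and> copy_of n f i \<in> unlucky n lab} \<le> L"
      by (rule good_output[OF f that lm(1), where l = l]) (use lm nbhds_edge_stream[OF xs] in auto)
    then show "\<exists>\<sigma>. ?run f = return_spmf \<sigma> \<and> ?good f \<sigma>" using \<sigma>1(1) \<sigma>2(1) by auto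
  qed
  from bchoice[OF this] obtain G where "\<forall>f\<in>ranks_space. ?run f = return_spmf (G f) \<and> ?good f (G f)" ..
  then have G: "\<And>f. f \<in> ranks_space \<Longrightarrow> ?run f = return_spmf (G f)"
    "\<And>f. f \<in> ranks_space \<Longrightarrow> 4 * card {i. i < L \<and> copy_of n f i \<in> unlucky n lab} \<le> L \<Longrightarrow>
      approx_clustering 43008 {..<n} lab (output_clustering n (G f))" by auto
  have fin: "finite ranks_space" by (simp add: ranks_space_def finite_PiE)
  have "n \<le> s" "n < 2 ^ w" using memory word_bounds by simp_all
  then have "run_alg s w t T (Stream_Alg (start_com c) edge_com end_com) n xs =
     bind_spmf (spmf_of_set ranks_space) (\<lambda>f. bind_spmf (bind_spmf (process_stream s w t edge_com xs (S f))
       (\<lambda>\<sigma>\<^sub>1. exec s w T [end_com] \<sigma>\<^sub>1)) (\<lambda>\<sigma>\<^sub>2. return_spmf (output_clustering n \<sigma>\<^sub>2)))"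
    by (simp add: run_alg_def S(1) bind_map_spmf o_def)
  also have "\<dots> = bind_spmf (spmf_of_set ranks_space) (\<lambda>f. return_spmf (output_clustering n (G f)))"
    by (rule bind_spmf_cong[OF refl]) (simp add: G(1) fin)
  finally show ?thesis using G(2) by (intro that[of "\<lambda>f. output_clustering n (G f)"]) (simp_all add: map_spmf_conv_bind_spmf)
qed

lemma run_alg_good:
  assumes L: "L = copies c n" and xs: "edge_stream n lab xs"
    and t: "80 * L + 15 \<le> t" and T: "1000 * (n * L * L) \<le> T"
  shows "lossless_spmf (run_alg s w t T (Stream_Alg (start_com c) edge_com end_com) n xs)"
    and "measure (measure_spmf (run_alg s w t T (Stream_Alg (start_com c) edge_com end_com) n xs))
      {\<C>. approx_clustering 43008 {..<n} lab \<C>} \<ge> 1 - 1 / real n ^ c"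
proof -
  obtain out where out: "run_alg s w t T (Stream_Alg (start_com c) edge_com end_com) n xs = map_spmf out (spmf_of_set ranks_space)"
    "\<And>f. f \<in> ranks_space \<Longrightarrow> 4 * card {i. i < L \<and> copy_of n f i \<in> unlucky n lab} \<le> L \<Longrightarrow>
       approx_clustering 43008 {..<n} lab (out f)"
    using run_alg_eq[OF assms] by blast
  have fin: "finite ranks_space" by (simp add: ranks_space_def finite_PiE)
  have ne: "ranks_space \<noteq> {}" using n_pos by (auto simp: ranks_space_def PiE_eq_empty_iff lessThan_empty_iff)
  show "lossless_spmf (run_alg s w t T (Stream_Alg (start_com c) edge_com end_com) n xs)"
    using fin ne by (simp add: out(1))
  define bad where "bad = {f \<in> ranks_space. L < 4 * card {i. i < L \<and> copy_of n f i \<in> unlucky n lab}}"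
  have "2 ^ L * card bad \<le> card ranks_space"
    unfolding bad_def ranks_space_def
    by (rule card_many_unlucky) (use card_unlucky_le[OF n_pos] in \<open>auto simp: unlucky_def\<close>)
  \<comment> \<open>The number of copies is chosen for this: the failure probability
    \<open>1 / 2 ^ L\<close> is at most \<open>1 / n ^ c\<close>.\<close>
  moreover have "n ^ c \<le> 2 ^ L"
  proof -
    have "n ^ c \<le> (2 ^ log_ceil n) ^ c" by (intro power_mono log_ceil) simp
    also have "\<dots> = 2 ^ (c * log_ceil n)" by (simp add: power_mult[symmetric] mult.commute)
    also have "\<dots> \<le> 2 ^ L" unfolding L copies_def by (intro power_increasing) auto
    finally show ?thesis .
  qed
  ultimately have "n ^ c * card bad \<le> card ranks_space" by (meson le_trans mult_le_mono1)
  then have "real (n ^ c) * real (card bad) \<le> real (card ranks_space)" by (metis of_nat_le_iff of_nat_mult)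
  moreover have "card ranks_space > 0" using fin ne by (simp add: card_gt_0_iff)
  ultimately have b: "real (card bad) / real (card ranks_space) \<le> 1 / real n ^ c"
    using n_pos by (simp add: field_simps)
  have "1 - real (card bad) / real (card ranks_space) = real (card (ranks_space - bad)) / real (card ranks_space)"
  proof -
    have "bad \<subseteq> ranks_space" by (auto simp: bad_def)
    then have "card (ranks_space - bad) = card ranks_space - card bad" "card bad \<le> card ranks_space"
      using fin by (auto simp: card_Diff_subset finite_subset card_mono)
    then show ?thesis using \<open>card ranks_space > 0\<close> by (simp add: of_nat_diff field_simps)
  qed
  also have "\<dots> \<le> real (card (ranks_space \<inter> {f. approx_clustering 43008 {..<n} lab (out f)})) / real (card ranks_space)"
  proof -
    have "ranks_space - bad \<subseteq> ranks_space \<inter> {f. approx_clustering 43008 {..<n} lab (out f)}"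
      unfolding bad_def by (auto simp: not_less intro: out(2))
    then show ?thesis using fin by (intro divide_right_mono of_nat_mono card_mono) auto
  qed
  also have "\<dots> = measure (measure_spmf (run_alg s w t T (Stream_Alg (start_com c) edge_com end_com) n xs))
      {\<C>. approx_clustering 43008 {..<n} lab \<C>}"
    by (simp add: out(1) measure_map_spmf measure_spmf_of_set vimage_def)
  finally show "measure (measure_spmf (run_alg s w t T (Stream_Alg (start_com c) edge_com end_com) n xs))
      {\<C>. approx_clustering 43008 {..<n} lab \<C>} \<ge> 1 - 1 / real n ^ c" using b by linarith
qed

end

section \<open>Resource bounds\<close>

text \<open>The summands are exponents of 2 for \<open>1024\<close>, \<open>(L + 1)\<^sup>2\<close>
  and \<open>(n + 1)\<^sup>2\<close> in the word bound, by the crude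
  \<open>L + 1 \<le> 2 ^ L\<close>. For fixed \<open>c\<close> the length stays logarithmic because
  \<open>L\<close> is.\<close>

definition word_length :: "nat \<Rightarrow> nat \<Rightarrow> nat" where
  "word_length c n = 10 + 2 * copies c n + 2 * Suc (log_ceil n)"

lemma layout_copies:
  assumes "n \<ge> 1"
  shows "layout n (copies c n) ((4 * copies c n + 2) * n) (word_length c n)"
proof
  let ?L = "copies c n"
  have "?L < 2 ^ ?L" by (rule less_exp)
  then have "?L + 1 \<le> 2 ^ ?L" by (simp add: Suc_le_eq)
  then have "(?L + 1)\<^sup>2 \<le> (2 ^ ?L)\<^sup>2" by (rule power_mono) simp
  moreover have "n + 1 \<le> 2 ^ Suc (log_ceil n)" using log_ceil(1)[of n] assms by simp
  then have "(n + 1)\<^sup>2 \<le> (2 ^ Suc (log_ceil n))\<^sup>2" by (intro power_mono) auto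
  ultimately have "1024 * ((?L + 1)\<^sup>2 * (n + 1)\<^sup>2) \<le> 1024 * ((2 ^ ?L)\<^sup>2 * (2 ^ Suc (log_ceil n))\<^sup>2)"
    by (intro mult_le_mono order.refl)
  also have "\<dots> = 2 ^ word_length c n"
  proof -
    have "(1024::nat) = 2 ^ 10" by simp
    then show ?thesis unfolding word_length_def power_add power_mult[symmetric]
      by (simp only: mult.commute[of _ 2] mult.assoc)
  qed
  finally show "1024 * ((?L + 1)\<^sup>2 * (n + 1)\<^sup>2) \<le> 2 ^ word_length c n" .
qed (use assms in \<open>auto simp: copies_def\<close>)

text \<open>Minimality gives \<open>2 ^ k < n\<close> for \<open>log_ceil n = Suc k\<close>, so
  \<open>log_ceil n\<close> exceeds the binary logarithm by at most 1, which is absorbed from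
  \<open>n = 2\<close> on.\<close>

lemma log_ceil_bigo: "(\<lambda>n. real (log_ceil n)) \<in> O(\<lambda>n. ln (real n))"
proof (rule bigoI)
  show "\<forall>\<^sub>F n in sequentially. norm (real (log_ceil n)) \<le> (2 / ln 2) * norm (ln (real n))"
    using eventually_ge_at_top[of 2]
  proof eventually_elim
    case (elim n)
    have "real (log_ceil n) \<le> 1 + ln (real n) / ln 2"
    proof (cases "log_ceil n")
      case (Suc k)
      then have "2 ^ k < n" by (intro log_ceil(2)) simp
      then have "(2::real) ^ k < real n" by (metis of_nat_less_iff of_nat_numeral of_nat_power)
      then have "ln ((2::real) ^ k) \<le> ln (real n)" by (subst ln_le_cancel_iff) auto
      then show ?thesis using Suc by (simp add: ln_realpow field_simps)
    qed (use elim in simp)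
    moreover have "1 \<le> ln (real n) / ln 2" using elim by (simp add: field_simps)
    moreover have "ln (real n) \<ge> 0" using elim by simp
    ultimately show ?case by (simp add: field_simps)
  qed
qed

lemma one_bigo_ln: "(\<lambda>n. 1) \<in> O(\<lambda>n::nat. ln (real n))"
proof (rule bigoI)
  show "\<forall>\<^sub>F n in sequentially. norm (1::real) \<le> (1 / ln 2) * norm (ln (real n))"
    using eventually_ge_at_top[of 2] by eventually_elim (simp add: field_simps)
qed

lemma const_bigo_ln: "(\<lambda>n. k) \<in> O(\<lambda>n::nat. ln (real n))" for k :: real
  using landau_o.big.mult[OF _ one_bigo_ln, of "\<lambda>_. k" "\<lambda>_. 1"] by simp

lemma copies_bigo: "(\<lambda>n. real (copies c n)) \<in> O(\<lambda>n. ln (real n))"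
  unfolding copies_def of_nat_add of_nat_mult
  by (intro sum_in_bigo const_bigo_ln) (use log_ceil_bigo in \<open>cases "c = 0"; simp\<close>)

theorem theorem5p2:
  "\<exists>\<alpha>::real. \<forall>c::nat. \<exists>(\<A>::stream_alg) (s::nat \<Rightarrow> nat) (w::nat \<Rightarrow> nat) (t::nat \<Rightarrow> nat) (T::nat \<Rightarrow> nat).
     (\<lambda>n. real (w n)) \<in> O(\<lambda>n. ln (real n)) \<and>
     (\<lambda>n. real (s n)) \<in> O(\<lambda>n. real n * ln (real n)) \<and>
     (\<lambda>n. real (t n)) \<in> O(\<lambda>n. ln (real n)) \<and>
     (\<lambda>n. real (T n)) \<in> O(\<lambda>n. real n * (ln (real n))\<^sup>2) \<and>
     (\<forall>n\<ge>1. \<forall>(lab::nat set \<Rightarrow> label) xs. edge_stream n lab xs \<longrightarrow>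
        lossless_spmf (run_alg (s n) (w n) (t n) (T n) \<A> n xs) \<and>
        measure (measure_spmf (run_alg (s n) (w n) (t n) (T n) \<A> n xs))
          {\<C>. approx_clustering \<alpha> {..<n} lab \<C>} \<ge> 1 - 1 / real n ^ c)"
\<comment> \<open>The ratio is fixed before \<open>c\<close>: a larger \<open>c\<close> only adds
  copies, which lowers the failure probability and enlarges the resource bounds by constant
  factors.\<close>
proof (intro exI[of _ 43008] allI)
  fix c :: nat
  let ?\<A> = "Stream_Alg (start_com c) edge_com end_com"
  let ?s = "\<lambda>n. (4 * copies c n + 2) * n" and ?w = "word_length c"
    and ?t = "\<lambda>n. 80 * copies c n + 15" and ?T = "\<lambda>n. 1000 * (n * copies c n * copies c n)"
  have w: "(\<lambda>n. real (?w n)) \<in> O(\<lambda>n. ln (real n))"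
    unfolding word_length_def of_nat_add of_nat_mult of_nat_Suc
    by (intro sum_in_bigo const_bigo_ln) (use log_ceil_bigo copies_bigo one_bigo_ln in \<open>auto intro: sum_in_bigo\<close>)
  have s: "(\<lambda>n. real (?s n)) \<in> O(\<lambda>n. real n * ln (real n))"
  proof -
    have "(\<lambda>n. 4 * real (copies c n) + 2) \<in> O(\<lambda>n. ln (real n))"
      using copies_bigo by (intro sum_in_bigo const_bigo_ln) auto
    then have "(\<lambda>n. real n * (4 * real (copies c n) + 2)) \<in> O(\<lambda>n. real n * ln (real n))"
      by (rule landau_o.big.mult_left)
    moreover have "real (?s n) = real n * (4 * real (copies c n) + 2)" for n by (simp add: algebra_simps)
    ultimately show ?thesis by (simp only:)
  qed
  have t: "(\<lambda>n. real (?t n)) \<in> O(\<lambda>n. ln (real n))"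
    unfolding of_nat_add of_nat_mult using copies_bigo by (intro sum_in_bigo const_bigo_ln) auto
  have T: "(\<lambda>n. real (?T n)) \<in> O(\<lambda>n. real n * (ln (real n))\<^sup>2)"
  proof -
    have "(\<lambda>n. 1000 * (real n * (real (copies c n) * real (copies c n)))) \<in> O(\<lambda>n. real n * (ln (real n) * ln (real n)))"
      using landau_o.big.mult_left[OF landau_o.big.mult[OF copies_bigo copies_bigo], of real c] by simp
    then show ?thesis by (simp add: power2_eq_square mult.assoc)
  qed
  have run: "\<forall>n\<ge>1. \<forall>(lab::nat set \<Rightarrow> label) xs. edge_stream n lab xs \<longrightarrow>
        lossless_spmf (run_alg (?s n) (?w n) (?t n) (?T n) ?\<A> n xs) \<and>
        measure (measure_spmf (run_alg (?s n) (?w n) (?t n) (?T n) ?\<A> n xs))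
          {\<C>. approx_clustering 43008 {..<n} lab \<C>} \<ge> 1 - 1 / real n ^ c"
  proof (intro allI impI)
    fix n :: nat and lab xs assume n: "1 \<le> n" and xs: "edge_stream n lab xs"
    interpret layout n "copies c n" "?s n" "?w n" using n by (rule layout_copies)
    show "lossless_spmf (run_alg (?s n) (?w n) (?t n) (?T n) ?\<A> n xs) \<and>
        measure (measure_spmf (run_alg (?s n) (?w n) (?t n) (?T n) ?\<A> n xs))
          {\<C>. approx_clustering 43008 {..<n} lab \<C>} \<ge> 1 - 1 / real n ^ c"
      by (intro conjI run_alg_good[OF refl xs order.refl order.refl])
  qed
  show "\<exists>(\<A>::stream_alg) (s::nat \<Rightarrow> nat) (w::nat \<Rightarrow> nat) (t::nat \<Rightarrow> nat) (T::nat \<Rightarrow> nat).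
     (\<lambda>n. real (w n)) \<in> O(\<lambda>n. ln (real n)) \<and>
     (\<lambda>n. real (s n)) \<in> O(\<lambda>n. real n * ln (real n)) \<and>
     (\<lambda>n. real (t n)) \<in> O(\<lambda>n. ln (real n)) \<and>
     (\<lambda>n. real (T n)) \<in> O(\<lambda>n. real n * (ln (real n))\<^sup>2) \<and>
     (\<forall>n\<ge>1. \<forall>(lab::nat set \<Rightarrow> label) xs. edge_stream n lab xs \<longrightarrow>
        lossless_spmf (run_alg (s n) (w n) (t n) (T n) \<A> n xs) \<and>
        measure (measure_spmf (run_alg (s n) (w n) (t n) (T n) \<A> n xs))
          {\<C>. approx_clustering 43008 {..<n} lab \<C>} \<ge> 1 - 1 / real n ^ c)"
    by (rule exI[of _ ?\<A>], rule exI[of _ ?s], rule exI[of _ ?w], rule exI[of _ ?t], rule exI[of _ ?T])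
      (intro conjI w s t T run)
qed

end
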